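(* Let $k$ be a field and let $A$ be a finite-dimensional $k$-algebra. Then for all objects $(X,m),(Y,n)$ of the stabilization $\mathcal{S}(A\text{-}\underline{\mathrm{mod}})$ of the stable module category one has $(X,m)\leq_{\mathrm{qst}}(Y,n)$ if and only if $(X,m)\leq_{\bigtriangleup}(Y,n)$.
   Context: $A\text{-}\mathrm{mod}$ is the category of finite-dimensional left $A$-modules. $A\text{-}\underline{\mathrm{mod}}$ is the stable category: same objects, morphisms modulo those factoring through a projective module. $\Omega=\Omega_A$ is the syzygy functor on $A\text{-}\underline{\mathrm{mod}}$ (kernel of a projective cover). Degeneration and stable degeneration: for $X,Y\in A\text{-}\mathrm{mod}$, $X\leq_{\deg}Y$ means that there exist $Z\in A\text{-}\mathrm{mod}$ and an exact sequence $0\to Y\to X\oplus Z\to Z\to 0$ in $A\text{-}\mathrm{mod}$. $X\leq_{\mathrm{st}}Y$ means that there exist projective modules $P,Q\in A\text{-}\mathrm{mod}$ with $X\oplus P\leq_{\deg}Y\oplus Q$; this induces a relation on isomorphism classes of objects of $A\text{-}\underline{\mathrm{mod}}$. Left triangulated structure: $A\text{-}\underline{\mathrm{mod}}$ is left triangulated with translation functor $\Omega$; its exact triangles are the diagrams isomorphic in $A\text{-}\underline{\mathrm{mod}}$ to $\Omega(W)\to U\to V\to W$ arising from short exact sequences $0\to U\to V\to W\to 0$ in $A\text{-}\mathrm{mod}$, where $\Omega(W)\to U$ is induced by lifting the projective cover of $W$ along $V\to W$. Stabilization: the category $\mathcal{S}(A\text{-}\underline{\mathrm{mod}})$ has as objects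 pairs $(X,m)$ with $X\in A\text{-}\underline{\mathrm{mod}}$, $m\in\mathbb{Z}$, and $$\mathrm{Hom}((X,m),(Y,n))=\varinjlim_{j\geq m,n}\underline{\mathrm{Hom}}_A(\Omega^{j-m}X,\Omega^{j-n}Y),$$ with transition maps given by $\Omega$. It is a triangulated category with translation functor $\tilde\Omega(X,m)=(X,m-1)$ (playing the role of $[-1]$). A diagram $\tilde\Omega(Z,l)\to(X,m)\to(Y,n)\to(Z,l)$ is an exact triangle if and only if there exist an even integer $j$ (large enough for all the exponents to be non-negative) and an exact triangle $\Omega(\Omega^{j-l}Z)\to\Omega^{j-m}X\to\Omega^{j-n}Y\to\Omega^{j-l}Z$ in $A\text{-}\underline{\mathrm{mod}}$ representing it. Quasi-stable degeneration: $(X,m)\leq_{\mathrm{qst}}(Y,n)$ means that there exists $j\in\mathbb{N}$ with $j\geq m,n$ such that $\Omega^{j-m}(X)\leq_{\mathrm{st}}\Omega^{j-n}(Y)$ in $A\text{-}\underline{\mathrm{mod}}$. Triangle relation: for objects $X',Y'$ of $\mathcal{S}(A\text{-}\underline{\mathrm{mod}})$, $X'\leq_{\bigtriangleup}Y'$ means that there exist an object $Z'$ and an exact triangle $\tilde\Omega(Z')\to Y'\to X'\oplus Z'\to Z'$ in $\mathcal{S}(A\text{-}\underline{\mathrm{mod}})$. *)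

theory Defs
  imports "HOL-Algebra.Module" "HOL-Algebra.AbelCoset"
begin

section \<open>Algebras and modules\<close>

text \<open>The library locale \<^locale>\<open>algebra\<close> is restricted to commutative algebras and
  \<^locale>\<open>module\<close> to commutative base rings, hence the two locales below. The zero algebra is
  allowed. The fields \<^const>\<open>mult\<close> and \<^const>\<open>one\<close> of a record that
  represents a module (and not an algebra) are never looked at.\<close>

locale fd_algebra =
  K: field K + A: ring A + module K A
  for K :: "'k ring" and A :: "('k, 'a) module" +
  assumes smult_mult_left:
      "\<lbrakk>c \<in> carrier K; x \<in> carrier A; y \<in> carrier A\<rbrakk> \<Longrightarrow>
       (c \<odot>\<^bsub>A\<^esub> x) \<otimes>\<^bsub>A\<^esub> y = c \<odot>\<^bsub>A\<^esub> (x \<otimes>\<^bsub>A\<^esub> y)"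
    and smult_mult_right:
      "\<lbrakk>c \<in> carrier K; x \<in> carrier A; y \<in> carrier A\<rbrakk> \<Longrightarrow>
       x \<otimes>\<^bsub>A\<^esub> (c \<odot>\<^bsub>A\<^esub> y) = c \<odot>\<^bsub>A\<^esub> (x \<otimes>\<^bsub>A\<^esub> y)"
    and finite_dim:
      "\<exists>B. finite B \<and> B \<subseteq> carrier A \<and>
         (\<forall>x \<in> carrier A. \<exists>c \<in> B \<rightarrow> carrier K. x = (\<Oplus>\<^bsub>A\<^esub>b\<in>B. c b \<odot>\<^bsub>A\<^esub> b))"

locale left_module =
  A: ring A + M: abelian_group M
  for A :: "('k, 'a) module" and M :: "('a, 'u) module" +
  assumes act_closed: "\<lbrakk>a \<in> carrier A; x \<in> carrier M\<rbrakk> \<Longrightarrow> a \<odot>\<^bsub>M\<^esub> x \<in> carrier M"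
    and act_l_distr:
      "\<lbrakk>a \<in> carrier A; b \<in> carrier A; x \<in> carrier M\<rbrakk> \<Longrightarrow>
       (a \<oplus>\<^bsub>A\<^esub> b) \<odot>\<^bsub>M\<^esub> x = a \<odot>\<^bsub>M\<^esub> x \<oplus>\<^bsub>M\<^esub> b \<odot>\<^bsub>M\<^esub> x"
    and act_r_distr:
      "\<lbrakk>a \<in> carrier A; x \<in> carrier M; y \<in> carrier M\<rbrakk> \<Longrightarrow>
       a \<odot>\<^bsub>M\<^esub> (x \<oplus>\<^bsub>M\<^esub> y) = a \<odot>\<^bsub>M\<^esub> x \<oplus>\<^bsub>M\<^esub> a \<odot>\<^bsub>M\<^esub> y"
    and act_assoc:
      "\<lbrakk>a \<in> carrier A; b \<in> carrier A; x \<in> carrier M\<rbrakk> \<Longrightarrow>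
       (a \<otimes>\<^bsub>A\<^esub> b) \<odot>\<^bsub>M\<^esub> x = a \<odot>\<^bsub>M\<^esub> (b \<odot>\<^bsub>M\<^esub> x)"
    and act_one: "x \<in> carrier M \<Longrightarrow> \<one>\<^bsub>A\<^esub> \<odot>\<^bsub>M\<^esub> x = x"

text \<open>The objects of \<open>A\<close>-mod whose underlying set lies in the universe type \<^typ>\<open>'u\<close>.
  A finite-dimensional module has the cardinality of a power of \<open>K\<close>, so as soon as \<^typ>\<open>'u\<close>
  has room for all lists over \<open>K\<close>, every finite-dimensional module has an isomorphic copy
  here, and this set is closed up to isomorphism under all the constructions below. The scalar
  \<open>c\<close> of \<open>K\<close> acts on a module as the element \<open>c 1\<close> of \<open>A\<close>.\<close>

definition fd_modules :: "'k ring \<Rightarrow> ('k, 'a) module \<Rightarrow> ('a, 'u) module set" where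
  "fd_modules K A = {M. left_module A M \<and>
     (\<exists>B. finite B \<and> B \<subseteq> carrier M \<and>
        (\<forall>x \<in> carrier M. \<exists>c \<in> B \<rightarrow> carrier K.
           x = (\<Oplus>\<^bsub>M\<^esub>b\<in>B. (c b \<odot>\<^bsub>A\<^esub> \<one>\<^bsub>A\<^esub>) \<odot>\<^bsub>M\<^esub> b)))}"

text \<open>Homomorphisms are extensional functions, so that equality of morphisms is equality in HOL.\<close>

definition lmod_hom ::
  "('k, 'a) module \<Rightarrow> ('a, 'u) module \<Rightarrow> ('a, 'v) module \<Rightarrow> ('u \<Rightarrow> 'v) set" where
  "lmod_hom A M N = {f \<in> carrier M \<rightarrow>\<^sub>E carrier N.
     (\<forall>x \<in> carrier M. \<forall>y \<in> carrier M. f (x \<oplus>\<^bsub>M\<^esub> y) = f x \<oplus>\<^bsub>N\<^esub> f y) \<and>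
     (\<forall>a \<in> carrier A. \<forall>x \<in> carrier M. f (a \<odot>\<^bsub>M\<^esub> x) = a \<odot>\<^bsub>N\<^esub> f x)}"

definition short_exact ::
  "('k, 'a) module \<Rightarrow> ('a, 'u) module \<Rightarrow> ('a, 'v) module \<Rightarrow> ('a, 'w) module
     \<Rightarrow> ('u \<Rightarrow> 'v) \<Rightarrow> ('v \<Rightarrow> 'w) \<Rightarrow> bool" where
  "short_exact A L M N f g \<longleftrightarrow>
     f \<in> lmod_hom A L M \<and> g \<in> lmod_hom A M N \<and>
     inj_on f (carrier L) \<and> f ` carrier L = a_kernel M N g \<and> g ` carrier M = carrier N"

definition dsum :: "('a, 'u) module \<Rightarrow> ('a, 'v) module \<Rightarrow> ('a, 'u \<times> 'v) module" where
  "dsum M N = \<lparr>carrier = carrier M \<times> carrier N, mult = undefined, one = undefined,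
     zero = (\<zero>\<^bsub>M\<^esub>, \<zero>\<^bsub>N\<^esub>),
     add = (\<lambda>(x, y) (x', y'). (x \<oplus>\<^bsub>M\<^esub> x', y \<oplus>\<^bsub>N\<^esub> y')),
     smult = (\<lambda>a (x, y). (a \<odot>\<^bsub>M\<^esub> x, a \<odot>\<^bsub>N\<^esub> y))\<rparr>"

definition projective :: "'k ring \<Rightarrow> ('k, 'a) module \<Rightarrow> ('a, 'u) module \<Rightarrow> bool" where
  "projective K A P \<longleftrightarrow> P \<in> fd_modules K A \<and>
     (\<forall>M \<in> (fd_modules K A :: ('a, 'u) module set). \<forall>N \<in> (fd_modules K A :: ('a, 'u) module set).
        \<forall>g \<in> lmod_hom A M N. \<forall>f \<in> lmod_hom A P N.
          g ` carrier M = carrier N \<longrightarrow> (\<exists>h \<in> lmod_hom A P M. compose (carrier P) g h = f))"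


section \<open>Degeneration and stable degeneration\<close>

definition deg_le ::
  "'k ring \<Rightarrow> ('k, 'a) module \<Rightarrow> ('a, 'u) module \<Rightarrow> ('a, 'u) module \<Rightarrow> bool" where
  "deg_le K A X Y \<longleftrightarrow>
     (\<exists>Z \<in> (fd_modules K A :: ('a, 'u) module set). \<exists>f g. short_exact A Y (dsum X Z) Z f g)"

definition st_le ::
  "'k ring \<Rightarrow> ('k, 'a) module \<Rightarrow> ('a, 'u) module \<Rightarrow> ('a, 'u) module \<Rightarrow> bool" where
  "st_le K A X Y \<longleftrightarrow>
     (\<exists>P Q :: ('a, 'u) module. projective K A P \<and> projective K A Q \<and>
        deg_le K A (dsum X P) (dsum Y Q))"


section \<open>Category data\<close>

text \<open>\<open>cmp C X Y Z g f\<close> is the composite of \<open>f\<close> from \<open>X\<close> to \<open>Y\<close> followed by \<open>g\<close> from \<open>Y\<close> to \<open>Z\<close>.\<close>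

record ('o, 'm) precat =
  Ob :: "'o set"
  Mor :: "'o \<Rightarrow> 'o \<Rightarrow> 'm set"
  idm :: "'o \<Rightarrow> 'm"
  cmp :: "'o \<Rightarrow> 'o \<Rightarrow> 'o \<Rightarrow> 'm \<Rightarrow> 'm \<Rightarrow> 'm"
  plus_mor :: "'o \<Rightarrow> 'o \<Rightarrow> 'm \<Rightarrow> 'm \<Rightarrow> 'm"

record ('o, 'm) precat_endo = "('o, 'm) precat" +
  Om :: "'o \<Rightarrow> 'o"
  Om_mor :: "'o \<Rightarrow> 'o \<Rightarrow> 'm \<Rightarrow> 'm"

definition is_iso :: "('o, 'm, 'z) precat_scheme \<Rightarrow> 'o \<Rightarrow> 'o \<Rightarrow> 'm \<Rightarrow> bool" where
  "is_iso C X Y f \<longleftrightarrow> f \<in> Mor C X Y \<and>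
     (\<exists>g \<in> Mor C Y X. cmp C X Y X g f = idm C X \<and> cmp C Y X Y f g = idm C Y)"

text \<open>Mac Lane's definition of a biproduct in a preadditive category; the equations
  \<open>p\<^sub>1 i\<^sub>2 = 0\<close> and \<open>p\<^sub>2 i\<^sub>1 = 0\<close> follow.\<close>

definition is_biproduct :: "('o, 'm, 'z) precat_scheme \<Rightarrow> 'o \<Rightarrow> 'o \<Rightarrow> 'o \<Rightarrow> bool" where
  "is_biproduct C X Y E \<longleftrightarrow> E \<in> Ob C \<and>
     (\<exists>i1 \<in> Mor C X E. \<exists>i2 \<in> Mor C Y E. \<exists>p1 \<in> Mor C E X. \<exists>p2 \<in> Mor C E Y.
        cmp C X E X p1 i1 = idm C X \<and> cmp C Y E Y p2 i2 = idm C Y \<and>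
        plus_mor C E E (cmp C E X E i1 p1) (cmp C E Y E i2 p2) = idm C E)"


section \<open>The stable category with its syzygy functor\<close>

definition stab_rel ::
  "'k ring \<Rightarrow> ('k, 'a) module \<Rightarrow> ('a, 'u) module \<Rightarrow> ('a, 'u) module \<Rightarrow> (('u \<Rightarrow> 'u) \<times> ('u \<Rightarrow> 'u)) set"
  where
  "stab_rel K A M N = {(f, g). f \<in> lmod_hom A M N \<and> g \<in> lmod_hom A M N \<and>
     (\<exists>P :: ('a, 'u) module. projective K A P \<and>
        (\<exists>a \<in> lmod_hom A M P. \<exists>b \<in> lmod_hom A P N.
           \<forall>x \<in> carrier M. f x \<ominus>\<^bsub>N\<^esub> g x = b (a x)))}"

definition stab_class ::
  "'k ring \<Rightarrow> ('k, 'a) module \<Rightarrow> ('a, 'u) module \<Rightarrow> ('a, 'u) module \<Rightarrow> ('u \<Rightarrow> 'u) \<Rightarrow> ('u \<Rightarrow> 'u) set" where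
  "stab_class K A M N f = stab_rel K A M N `` {f}"

text \<open>A projective cover is a surjection from a projective module with superfluous kernel.\<close>

definition is_proj_cover ::
  "'k ring \<Rightarrow> ('k, 'a) module \<Rightarrow> ('a, 'u) module \<Rightarrow> ('a, 'u) module \<Rightarrow> ('u \<Rightarrow> 'u) \<Rightarrow> bool" where
  "is_proj_cover K A M P p \<longleftrightarrow> projective K A P \<and> p \<in> lmod_hom A P M \<and>
     p ` carrier P = carrier M \<and>
     (\<forall>N. submodule N A P \<and> N <+>\<^bsub>P\<^esub> a_kernel P M p = carrier P \<longrightarrow> N = carrier P)"

definition proj_cover ::
  "'k ring \<Rightarrow> ('k, 'a) module \<Rightarrow> ('a, 'u) module \<Rightarrow> ('a, 'u) module \<times> ('u \<Rightarrow> 'u)" where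
  "proj_cover K A M = (SOME (P, p). is_proj_cover K A M P p)"

abbreviation cover_mod :: "'k ring \<Rightarrow> ('k, 'a) module \<Rightarrow> ('a, 'u) module \<Rightarrow> ('a, 'u) module" where
  "cover_mod K A M \<equiv> fst (proj_cover K A M)"

abbreviation cover_map :: "'k ring \<Rightarrow> ('k, 'a) module \<Rightarrow> ('a, 'u) module \<Rightarrow> 'u \<Rightarrow> 'u" where
  "cover_map K A M \<equiv> snd (proj_cover K A M)"

definition syz :: "'k ring \<Rightarrow> ('k, 'a) module \<Rightarrow> ('a, 'u) module \<Rightarrow> ('a, 'u) module" where
  "syz K A M = (cover_mod K A M)
     \<lparr>carrier := a_kernel (cover_mod K A M) M (cover_map K A M)\<rparr>"

text \<open>A stable morphism is an equivalence class of homomorphisms. All operations on classes are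
  defined as the union of the classes of the results over all choices of representatives (and, for
  the syzygy of a morphism, over all lifts \<open>h\<close> to the projective covers).\<close>

definition syz_mor ::
  "'k ring \<Rightarrow> ('k, 'a) module \<Rightarrow> ('a, 'u) module \<Rightarrow> ('a, 'u) module \<Rightarrow> ('u \<Rightarrow> 'u) set \<Rightarrow> ('u \<Rightarrow> 'u) set"
  where
  "syz_mor K A M N \<phi> =
     (\<Union>f \<in> \<phi>. \<Union>h \<in> {h \<in> lmod_hom A (cover_mod K A M) (cover_mod K A N).
        compose (carrier (cover_mod K A M)) (cover_map K A N) h =
        compose (carrier (cover_mod K A M)) f (cover_map K A M)}.
        stab_class K A (syz K A M) (syz K A N) (restrict h (carrier (syz K A M))))"

definition stmod :: "'k ring \<Rightarrow> ('k, 'a) module \<Rightarrow> (('a, 'u) module, ('u \<Rightarrow> 'u) set) precat_endo" where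
  "stmod K A = \<lparr>
     Ob = fd_modules K A,
     Mor = (\<lambda>M N. lmod_hom A M N // stab_rel K A M N),
     idm = (\<lambda>M. stab_class K A M M (\<lambda>x \<in> carrier M. x)),
     cmp = (\<lambda>L M N \<psi> \<phi>. \<Union>f \<in> \<phi>. \<Union>g \<in> \<psi>. stab_class K A L N (compose (carrier L) g f)),
     plus_mor = (\<lambda>M N \<phi> \<psi>. \<Union>f \<in> \<phi>. \<Union>g \<in> \<psi>.
        stab_class K A M N (\<lambda>x \<in> carrier M. f x \<oplus>\<^bsub>N\<^esub> g x)),
     Om = syz K A,
     Om_mor = syz_mor K A\<rparr>"

text \<open>Exact triangles \<open>Om W \<rightarrow> U \<rightarrow> V \<rightarrow> W\<close>. First those coming from a short exact sequence, with
  \<open>h\<close> induced by a lift \<open>q\<close> of the projective cover of \<open>W\<close> along \<open>g\<close>; then their isomorphic copies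
  in the stable category.\<close>

definition standard_triangle ::
  "'k ring \<Rightarrow> ('k, 'a) module \<Rightarrow> ('a, 'u) module \<Rightarrow> ('a, 'u) module \<Rightarrow> ('a, 'u) module
     \<Rightarrow> ('u \<Rightarrow> 'u) set \<Rightarrow> ('u \<Rightarrow> 'u) set \<Rightarrow> ('u \<Rightarrow> 'u) set \<Rightarrow> bool" where
  "standard_triangle K A W U V a b c \<longleftrightarrow>
     W \<in> fd_modules K A \<and> U \<in> fd_modules K A \<and> V \<in> fd_modules K A \<and>
     (\<exists>f g h. short_exact A U V W f g \<and> h \<in> lmod_hom A (syz K A W) U \<and>
        (\<exists>q \<in> lmod_hom A (cover_mod K A W) V.
           compose (carrier (cover_mod K A W)) g q = cover_map K A W \<and>
           (\<forall>x \<in> carrier (syz K A W). f (h x) = q x)) \<and>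
        a = stab_class K A (syz K A W) U h \<and>
        b = stab_class K A U V f \<and>
        c = stab_class K A V W g)"

definition exact_triangle ::
  "'k ring \<Rightarrow> ('k, 'a) module \<Rightarrow> ('a, 'u) module \<Rightarrow> ('a, 'u) module \<Rightarrow> ('a, 'u) module
     \<Rightarrow> ('u \<Rightarrow> 'u) set \<Rightarrow> ('u \<Rightarrow> 'u) set \<Rightarrow> ('u \<Rightarrow> 'u) set \<Rightarrow> bool" where
  "exact_triangle K A W U V a b c \<longleftrightarrow> (let C = stmod K A in
     W \<in> Ob C \<and> U \<in> Ob C \<and> V \<in> Ob C \<and>
     a \<in> Mor C (Om C W) U \<and> b \<in> Mor C U V \<and> c \<in> Mor C V W \<and>
     (\<exists>W' U' V' a' b' c' \<omega> \<upsilon> \<nu>. standard_triangle K A W' U' V' a' b' c' \<and>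
        is_iso C W' W \<omega> \<and> is_iso C U' U \<upsilon> \<and> is_iso C V' V \<nu> \<and>
        cmp C (Om C W') U' U \<upsilon> a' = cmp C (Om C W') (Om C W) U a (Om_mor C W' W \<omega>) \<and>
        cmp C U' V' V \<nu> b' = cmp C U' U V b \<upsilon> \<and>
        cmp C V' W' W \<omega> c' = cmp C V' V W c \<nu>))"


section \<open>Stabilization\<close>

text \<open>\<open>lift_ob C X m j\<close> is the \<open>(j - m)\<close>-th iterate of \<open>Om\<close> at \<open>X\<close>, used only for \<open>j \<ge> m\<close>.\<close>

definition lift_ob :: "('o, 'm) precat_endo \<Rightarrow> 'o \<Rightarrow> int \<Rightarrow> int \<Rightarrow> 'o" where
  "lift_ob C X m j = (Om C ^^ nat (j - m)) X"

primrec Om_mor_pow :: "('o, 'm) precat_endo \<Rightarrow> nat \<Rightarrow> 'o \<Rightarrow> 'o \<Rightarrow> 'm \<Rightarrow> 'm" where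
  "Om_mor_pow C 0 X Y f = f"
| "Om_mor_pow C (Suc r) X Y f = Om_mor C ((Om C ^^ r) X) ((Om C ^^ r) Y) (Om_mor_pow C r X Y f)"

text \<open>The direct limit of the morphism sets at the levels \<open>j \<ge> m, n\<close>: a morphism of the
  stabilization is an equivalence class of germs \<open>(j, f)\<close>.\<close>

definition germs :: "('o, 'm) precat_endo \<Rightarrow> 'o \<times> int \<Rightarrow> 'o \<times> int \<Rightarrow> (int \<times> 'm) set" where
  "germs C = (\<lambda>(X, m) (Y, n).
     {(j, f). m \<le> j \<and> n \<le> j \<and> f \<in> Mor C (lift_ob C X m j) (lift_ob C Y n j)})"

definition germ_rel ::
  "('o, 'm) precat_endo \<Rightarrow> 'o \<times> int \<Rightarrow> 'o \<times> int \<Rightarrow> ((int \<times> 'm) \<times> (int \<times> 'm)) set" where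
  "germ_rel C = (\<lambda>(X, m) (Y, n).
     {((i, f), (j, g)). (i, f) \<in> germs C (X, m) (Y, n) \<and> (j, g) \<in> germs C (X, m) (Y, n) \<and>
        (\<exists>l. i \<le> l \<and> j \<le> l \<and>
           Om_mor_pow C (nat (l - i)) (lift_ob C X m i) (lift_ob C Y n i) f =
           Om_mor_pow C (nat (l - j)) (lift_ob C X m j) (lift_ob C Y n j) g)})"

definition stabilization ::
  "('o, 'm) precat_endo \<Rightarrow> ('o \<times> int, (int \<times> 'm) set) precat" where
  "stabilization C = \<lparr>
     Ob = Ob C \<times> UNIV,
     Mor = (\<lambda>X Y. germs C X Y // germ_rel C X Y),
     idm = (\<lambda>(X, m). germ_rel C (X, m) (X, m) `` {(m, idm C X)}),
     cmp = (\<lambda>(X, m) (Y, n) (Z, l) v u.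
        \<Union>(j, f, g) \<in> {(j, f, g). (j, f) \<in> u \<and> (j, g) \<in> v}.
          germ_rel C (X, m) (Z, l) ``
            {(j, cmp C (lift_ob C X m j) (lift_ob C Y n j) (lift_ob C Z l j) g f)}),
     plus_mor = (\<lambda>(X, m) (Y, n) u v.
        \<Union>(j, f, g) \<in> {(j, f, g). (j, f) \<in> u \<and> (j, g) \<in> v}.
          germ_rel C (X, m) (Y, n) ``
            {(j, plus_mor C (lift_ob C X m j) (lift_ob C Y n j) f g)})\<rparr>"

abbreviation stab_mod ::
  "'k ring \<Rightarrow> ('k, 'a) module \<Rightarrow> (('a, 'u) module \<times> int, (int \<times> ('u \<Rightarrow> 'u) set) set) precat" where
  "stab_mod K A \<equiv> stabilization (stmod K A)"

definition Om_tilde :: "'o \<times> int \<Rightarrow> 'o \<times> int" where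
  "Om_tilde = (\<lambda>(X, m). (X, m - 1))"

text \<open>Exact triangles \<open>Om_tilde (Z, l) \<rightarrow> (X, m) \<rightarrow> (Y, n) \<rightarrow> (Z, l)\<close>. Note that
  \<open>lift_ob C Z (l - 1) j = Om C (lift_ob C Z l j)\<close> for \<open>j \<ge> l\<close>.\<close>

definition stab_triangle ::
  "'k ring \<Rightarrow> ('k, 'a) module \<Rightarrow> ('a, 'u) module \<times> int \<Rightarrow> ('a, 'u) module \<times> int
     \<Rightarrow> ('a, 'u) module \<times> int \<Rightarrow> (int \<times> ('u \<Rightarrow> 'u) set) set \<Rightarrow> (int \<times> ('u \<Rightarrow> 'u) set) set
     \<Rightarrow> (int \<times> ('u \<Rightarrow> 'u) set) set \<Rightarrow> bool" where
  "stab_triangle K A = (\<lambda>(Z, l) (X, m) (Y, n) u v w. let C = stmod K A; S = stab_mod K A in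
     (Z, l) \<in> Ob S \<and> (X, m) \<in> Ob S \<and> (Y, n) \<in> Ob S \<and>
     u \<in> Mor S (Om_tilde (Z, l)) (X, m) \<and> v \<in> Mor S (X, m) (Y, n) \<and> w \<in> Mor S (Y, n) (Z, l) \<and>
     (\<exists>j a b c. even j \<and> l \<le> j \<and> m \<le> j \<and> n \<le> j \<and>
        (j, a) \<in> u \<and> (j, b) \<in> v \<and> (j, c) \<in> w \<and>
        exact_triangle K A (lift_ob C Z l j) (lift_ob C X m j) (lift_ob C Y n j) a b c))"


section \<open>The two relations\<close>

definition qst_le ::
  "'k ring \<Rightarrow> ('k, 'a) module \<Rightarrow> ('a, 'u) module \<times> int \<Rightarrow> ('a, 'u) module \<times> int \<Rightarrow> bool" where
  "qst_le K A = (\<lambda>(X, m) (Y, n). \<exists>j :: nat. m \<le> int j \<and> n \<le> int j \<and>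
     st_le K A (lift_ob (stmod K A) X m (int j)) (lift_ob (stmod K A) Y n (int j)))"

definition tri_le ::
  "'k ring \<Rightarrow> ('k, 'a) module \<Rightarrow> ('a, 'u) module \<times> int \<Rightarrow> ('a, 'u) module \<times> int \<Rightarrow> bool" where
  "tri_le K A X Y \<longleftrightarrow>
     (\<exists>Z \<in> Ob (stab_mod K A). \<exists>E u v w.
        is_biproduct (stab_mod K A) X Z E \<and> stab_triangle K A Z Y E u v w)"

end

theory Submission
  imports Defs
begin

text \<open>
  Both relations are compared with a third one, \<open>tri_deg X Y\<close>, inside the stable category: there are
  \<open>V\<close> and \<open>W\<close> such that \<open>V\<close> is a biproduct of \<open>X\<close> and \<open>W\<close> in the stable category, and such that
  \<open>Y\<close>, \<open>V\<close>, \<open>W\<close> are stably isomorphic to the terms of a short exact sequence of modules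
  (\<open>sxt Y V W\<close>).

  For two modules, \<open>tri_deg\<close> is stable degeneration (\<open>st_le_tri_deg\<close>, \<open>tri_deg_st_le\<close>). The substantial
  direction rests on the fact that stably isomorphic modules become isomorphic after adding
  projective summands (\<open>st_inv_iso\<close>). This suffices: a short exact sequence stays exact when a
  projective is added to its first two or to its last two terms, so its terms can be brought to
  \<open>Y \<oplus> Q\<close>, \<open>(X \<oplus> P) \<oplus> (W \<oplus> R)\<close> and \<open>W \<oplus> R\<close>. No cancellation of summands is needed.

  \<open>tri_deg\<close> is stable under syzygies (\<open>tri_deg_syz\<close>). The biproduct is preserved because the
  syzygy functor is additive. The sequence is transported by three rotations, the rotation of
  \<open>0 \<rightarrow> U \<rightarrow> V \<rightarrow> W \<rightarrow> 0\<close> being \<open>0 \<rightarrow> \<Omega> W \<rightarrow> U \<oplus> P \<rightarrow> V \<rightarrow> 0\<close> with \<open>P\<close> the projective cover of \<open>W\<close>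
  (\<open>ses_rotate\<close>, \<open>sxt_syz\<close>).

  Finally the triangle relation in the stabilization says exactly that \<open>tri_deg\<close> holds at some level
  \<open>j\<close>. A triangle and a biproduct at an even level \<open>j\<close> define such data in the stabilization
  (\<open>tri_deg_tri_le\<close>), and an odd level is raised by one with \<open>tri_deg_syz\<close>. Conversely the equations
  between germs that express a biproduct hold from some level on, and the short exact sequence
  behind a triangle is carried up to that level by \<open>sxt_syz\<close> (\<open>tri_le_tri_deg\<close>).

  Two facts underlie all this: the existence of projective covers (\<open>ex_proj_cover\<close>, by a dimension
  count), which makes the syzygy meaningful, and the fact that the stable category is
  a category on which the syzygy is a functor compatible with addition (\<open>stmod_endo_cat\<close>).
\<close>

section \<open>Modules and homomorphisms\<close>

context abelian_group
begin

lemma diff_closed [simp]: "x \<in> carrier G \<Longrightarrow> y \<in> carrier G \<Longrightarrow> x \<ominus> y \<in> carrier G"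
  by (simp add: minus_eq)

lemma diff_self [simp]: "x \<in> carrier G \<Longrightarrow> x \<ominus> x = \<zero>"
  by (simp add: minus_eq r_neg)

lemma diff_zero [simp]: "x \<in> carrier G \<Longrightarrow> x \<ominus> \<zero> = x"
  by (simp add: minus_eq)

lemma diff_eq_zero_iff: "x \<in> carrier G \<Longrightarrow> y \<in> carrier G \<Longrightarrow> x \<ominus> y = \<zero> \<longleftrightarrow> x = y"
  by (metis diff_self minus_eq a_inv_closed minus_equality minus_minus)

lemma diff_add_cancel:
  "x \<in> carrier G \<Longrightarrow> y \<in> carrier G \<Longrightarrow> (x \<ominus> y) \<oplus> y = x"
  by (simp add: minus_eq a_assoc l_neg)

lemma add_diff_cancel:
  "x \<in> carrier G \<Longrightarrow> y \<in> carrier G \<Longrightarrow> (x \<oplus> y) \<ominus> y = x"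
  by (simp add: minus_eq a_assoc r_neg)

lemma add_diff_cancel2:
  "x \<in> carrier G \<Longrightarrow> y \<in> carrier G \<Longrightarrow> (x \<oplus> y) \<ominus> x = y"
  by (metis add_diff_cancel a_comm)

lemma diff_trans:
  "x \<in> carrier G \<Longrightarrow> y \<in> carrier G \<Longrightarrow> z \<in> carrier G \<Longrightarrow> (x \<ominus> y) \<oplus> (y \<ominus> z) = x \<ominus> z"
  by (simp add: minus_eq) (metis a_assoc a_inv_closed add.m_closed l_neg l_zero)

lemma diff_flip:
  "x \<in> carrier G \<Longrightarrow> y \<in> carrier G \<Longrightarrow> \<ominus> (x \<ominus> y) = y \<ominus> x"
  by (simp add: minus_eq minus_add a_comm)

lemma diff_add_diff:
  "x \<in> carrier G \<Longrightarrow> y \<in> carrier G \<Longrightarrow> x' \<in> carrier G \<Longrightarrow> y' \<in> carrier G \<Longrightarrow>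
   (x \<oplus> x') \<ominus> (y \<oplus> y') = (x \<ominus> y) \<oplus> (x' \<ominus> y')"
  by (simp add: minus_eq minus_add a_ac)

lemma eq_diff_iff:
  "x \<in> carrier G \<Longrightarrow> y \<in> carrier G \<Longrightarrow> z \<in> carrier G \<Longrightarrow> x = y \<ominus> z \<longleftrightarrow> x \<oplus> z = y"
  by (metis add_diff_cancel diff_add_cancel)

end

lemma (in left_module) act_r_null [simp]:
  "a \<in> carrier A \<Longrightarrow> a \<odot>\<^bsub>M\<^esub> \<zero>\<^bsub>M\<^esub> = \<zero>\<^bsub>M\<^esub>"
  using act_r_distr[of a "\<zero>\<^bsub>M\<^esub>" "\<zero>\<^bsub>M\<^esub>"] act_closed[of a "\<zero>\<^bsub>M\<^esub>"] by simp

lemma submodule_iff: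
  fixes M :: "('a, 'v) module"
  assumes "left_module A M"
  shows "submodule N A M \<longleftrightarrow> N \<subseteq> carrier M \<and> \<zero>\<^bsub>M\<^esub> \<in> N \<and>
    (\<forall>x\<in>N. \<forall>y\<in>N. x \<oplus>\<^bsub>M\<^esub> y \<in> N) \<and> (\<forall>a\<in>carrier A. \<forall>x\<in>N. a \<odot>\<^bsub>M\<^esub> x \<in> N)"
proof -
  interpret left_module A M by fact
  have neg: "\<ominus>\<^bsub>M\<^esub> x = (\<ominus>\<^bsub>A\<^esub> \<one>\<^bsub>A\<^esub>) \<odot>\<^bsub>M\<^esub> x" if x: "x \<in> carrier M" for x
  proof -
    have z: "\<zero>\<^bsub>A\<^esub> \<odot>\<^bsub>M\<^esub> x = \<zero>\<^bsub>M\<^esub>"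
      using act_l_distr[of "\<zero>\<^bsub>A\<^esub>" "\<zero>\<^bsub>A\<^esub>" x] x act_closed[of "\<zero>\<^bsub>A\<^esub>" x]
      by (metis A.l_zero A.zero_closed M.add.r_cancel_one')
    have "(\<ominus>\<^bsub>A\<^esub> \<one>\<^bsub>A\<^esub>) \<odot>\<^bsub>M\<^esub> x \<oplus>\<^bsub>M\<^esub> x = (\<ominus>\<^bsub>A\<^esub> \<one>\<^bsub>A\<^esub> \<oplus>\<^bsub>A\<^esub> \<one>\<^bsub>A\<^esub>) \<odot>\<^bsub>M\<^esub> x"
      using x by (simp add: act_l_distr act_one)
    also have "\<dots> = \<zero>\<^bsub>M\<^esub>" using z by (simp add: A.l_neg)
    finally show ?thesis
      using x act_closed[of "\<ominus>\<^bsub>A\<^esub> \<one>\<^bsub>A\<^esub>" x] by (simp add: M.minus_equality)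
  qed
  show ?thesis
  proof
    assume "submodule N A M"
    then show "N \<subseteq> carrier M \<and> \<zero>\<^bsub>M\<^esub> \<in> N \<and>
      (\<forall>x\<in>N. \<forall>y\<in>N. x \<oplus>\<^bsub>M\<^esub> y \<in> N) \<and> (\<forall>a\<in>carrier A. \<forall>x\<in>N. a \<odot>\<^bsub>M\<^esub> x \<in> N)"
      by (auto simp: submodule_def submodule_axioms_def subgroup_def)
  next
    assume a: "N \<subseteq> carrier M \<and> \<zero>\<^bsub>M\<^esub> \<in> N \<and>
      (\<forall>x\<in>N. \<forall>y\<in>N. x \<oplus>\<^bsub>M\<^esub> y \<in> N) \<and> (\<forall>a\<in>carrier A. \<forall>x\<in>N. a \<odot>\<^bsub>M\<^esub> x \<in> N)"
    then have "\<ominus>\<^bsub>M\<^esub> x \<in> N" if "x \<in> N" for x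
      using neg[of x] that by auto
    with a show "submodule N A M"
      by (auto simp: submodule_def submodule_axioms_def subgroup_def a_inv_def)
  qed
qed

lemma submodule_subset:
  fixes M :: "('a, 'v) module"
  assumes "submodule N A M" shows "N \<subseteq> carrier M"
  using assms by (simp add: submodule_def subgroup_def)

lemma left_moduleI:
  assumes "ring A"
    and "\<And>x y. x \<in> carrier M \<Longrightarrow> y \<in> carrier M \<Longrightarrow> x \<oplus>\<^bsub>M\<^esub> y \<in> carrier M"
    and "\<zero>\<^bsub>M\<^esub> \<in> carrier M"
    and "\<And>x y z. x \<in> carrier M \<Longrightarrow> y \<in> carrier M \<Longrightarrow> z \<in> carrier M \<Longrightarrow>
      (x \<oplus>\<^bsub>M\<^esub> y) \<oplus>\<^bsub>M\<^esub> z = x \<oplus>\<^bsub>M\<^esub> (y \<oplus>\<^bsub>M\<^esub> z)"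
    and "\<And>x y. x \<in> carrier M \<Longrightarrow> y \<in> carrier M \<Longrightarrow> x \<oplus>\<^bsub>M\<^esub> y = y \<oplus>\<^bsub>M\<^esub> x"
    and "\<And>x. x \<in> carrier M \<Longrightarrow> \<zero>\<^bsub>M\<^esub> \<oplus>\<^bsub>M\<^esub> x = x"
    and "\<And>x. x \<in> carrier M \<Longrightarrow> \<exists>y\<in>carrier M. y \<oplus>\<^bsub>M\<^esub> x = \<zero>\<^bsub>M\<^esub>"
    and "\<And>a x. a \<in> carrier A \<Longrightarrow> x \<in> carrier M \<Longrightarrow> a \<odot>\<^bsub>M\<^esub> x \<in> carrier M"
    and "\<And>a b x. a \<in> carrier A \<Longrightarrow> b \<in> carrier A \<Longrightarrow> x \<in> carrier M \<Longrightarrow>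
       (a \<oplus>\<^bsub>A\<^esub> b) \<odot>\<^bsub>M\<^esub> x = a \<odot>\<^bsub>M\<^esub> x \<oplus>\<^bsub>M\<^esub> b \<odot>\<^bsub>M\<^esub> x"
    and "\<And>a x y. a \<in> carrier A \<Longrightarrow> x \<in> carrier M \<Longrightarrow> y \<in> carrier M \<Longrightarrow>
       a \<odot>\<^bsub>M\<^esub> (x \<oplus>\<^bsub>M\<^esub> y) = a \<odot>\<^bsub>M\<^esub> x \<oplus>\<^bsub>M\<^esub> a \<odot>\<^bsub>M\<^esub> y"
    and "\<And>a b x. a \<in> carrier A \<Longrightarrow> b \<in> carrier A \<Longrightarrow> x \<in> carrier M \<Longrightarrow>
       (a \<otimes>\<^bsub>A\<^esub> b) \<odot>\<^bsub>M\<^esub> x = a \<odot>\<^bsub>M\<^esub> (b \<odot>\<^bsub>M\<^esub> x)"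
    and "\<And>x. x \<in> carrier M \<Longrightarrow> \<one>\<^bsub>A\<^esub> \<odot>\<^bsub>M\<^esub> x = x"
  shows "left_module A M"
proof -
  have "abelian_group M" by (rule abelian_groupI) (use assms in auto)
  then show ?thesis using assms by (auto simp: left_module_def left_module_axioms_def)
qed

lemma left_module_sub:
  fixes M :: "('a, 'v) module"
  assumes M: "left_module A M" and N: "submodule N A M"
  shows "left_module A (M\<lparr>carrier := N\<rparr>)"
proof -
  interpret left_module A M by fact
  have c: "N \<subseteq> carrier M" "\<zero>\<^bsub>M\<^esub> \<in> N" "\<And>x y. x \<in> N \<Longrightarrow> y \<in> N \<Longrightarrow> x \<oplus>\<^bsub>M\<^esub> y \<in> N"
    "\<And>a x. a \<in> carrier A \<Longrightarrow> x \<in> N \<Longrightarrow> a \<odot>\<^bsub>M\<^esub> x \<in> N"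
    using N[unfolded submodule_iff[OF M]] by auto
  have inv: "\<exists>y\<in>N. y \<oplus>\<^bsub>M\<^esub> x = \<zero>\<^bsub>M\<^esub>" if "x \<in> N" for x
    using that N c(1) subgroup.m_inv_closed[of N "add_monoid M" x] M.l_neg
    by (auto simp: submodule_def a_inv_def[symmetric])
  show ?thesis
    by (rule left_moduleI)
      (use c inv in \<open>auto simp: A.ring_axioms subset_iff M.a_ac act_l_distr act_r_distr
        act_assoc act_one\<close>)
qed

lemma a_kernel_eq: "a_kernel M N f = {x \<in> carrier M. f x = \<zero>\<^bsub>N\<^esub>}"
  by (rule a_kernel_def')

subsection \<open>Homomorphisms\<close>

lemma lmod_homI:
  assumes "left_module A M"
    and "\<And>x. x \<in> carrier M \<Longrightarrow> f x \<in> carrier N"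
    and "\<And>x y. x \<in> carrier M \<Longrightarrow> y \<in> carrier M \<Longrightarrow> f (x \<oplus>\<^bsub>M\<^esub> y) = f x \<oplus>\<^bsub>N\<^esub> f y"
    and "\<And>a x. a \<in> carrier A \<Longrightarrow> x \<in> carrier M \<Longrightarrow> f (a \<odot>\<^bsub>M\<^esub> x) = a \<odot>\<^bsub>N\<^esub> f x"
  shows "restrict f (carrier M) \<in> lmod_hom A M N"
proof -
  interpret left_module A M by fact
  show ?thesis using assms act_closed by (simp add: lmod_hom_def)
qed

lemma hom_closed [simp]: "f \<in> lmod_hom A M N \<Longrightarrow> x \<in> carrier M \<Longrightarrow> f x \<in> carrier N"
  by (auto simp: lmod_hom_def)

lemma hom_add: "f \<in> lmod_hom A M N \<Longrightarrow> x \<in> carrier M \<Longrightarrow> y \<in> carrier M \<Longrightarrow>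
    f (x \<oplus>\<^bsub>M\<^esub> y) = f x \<oplus>\<^bsub>N\<^esub> f y"
  by (simp add: lmod_hom_def)

lemma hom_smult: "f \<in> lmod_hom A M N \<Longrightarrow> a \<in> carrier A \<Longrightarrow> x \<in> carrier M \<Longrightarrow>
    f (a \<odot>\<^bsub>M\<^esub> x) = a \<odot>\<^bsub>N\<^esub> f x"
  by (simp add: lmod_hom_def)

lemma hom_extensional: "f \<in> lmod_hom A M N \<Longrightarrow> f \<in> extensional (carrier M)"
  unfolding lmod_hom_def PiE_def by blast

lemma hom_ext:
  assumes "f \<in> lmod_hom A M N" "g \<in> lmod_hom A M N" "\<And>x. x \<in> carrier M \<Longrightarrow> f x = g x"
  shows "f = g"
  using assms by (meson extensionalityI hom_extensional)

lemma hom_zero: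
  assumes "left_module A M" "left_module A N" "f \<in> lmod_hom A M N"
  shows "f \<zero>\<^bsub>M\<^esub> = \<zero>\<^bsub>N\<^esub>"
proof -
  interpret M: left_module A M by fact
  interpret N: left_module A N by fact
  have "f \<zero>\<^bsub>M\<^esub> \<oplus>\<^bsub>N\<^esub> f \<zero>\<^bsub>M\<^esub> = f \<zero>\<^bsub>M\<^esub>"
    using hom_add[OF assms(3), of "\<zero>\<^bsub>M\<^esub>" "\<zero>\<^bsub>M\<^esub>"] by simp
  then show ?thesis using assms(3) by simp
qed

lemma hom_neg:
  assumes "left_module A M" "left_module A N" "f \<in> lmod_hom A M N" "x \<in> carrier M"
  shows "f (\<ominus>\<^bsub>M\<^esub> x) = \<ominus>\<^bsub>N\<^esub> f x"
proof -
  interpret M: left_module A M by fact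
  interpret N: left_module A N by fact
  have "f (\<ominus>\<^bsub>M\<^esub> x) \<oplus>\<^bsub>N\<^esub> f x = \<zero>\<^bsub>N\<^esub>"
    using hom_add[OF assms(3), of "\<ominus>\<^bsub>M\<^esub> x" x] assms hom_zero[OF assms(1-3)] by (simp add: M.M.l_neg)
  then show ?thesis using assms by (simp add: N.M.minus_equality)
qed

lemma hom_diff:
  assumes "left_module A M" "left_module A N" "f \<in> lmod_hom A M N" "x \<in> carrier M" "y \<in> carrier M"
  shows "f (x \<ominus>\<^bsub>M\<^esub> y) = f x \<ominus>\<^bsub>N\<^esub> f y"
proof -
  interpret M: left_module A M by fact
  interpret N: left_module A N by fact
  show ?thesis using assms by (simp add: a_minus_def hom_add[OF assms(3)] hom_neg)
qed

lemma hom_id: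
  assumes "left_module A M" shows "(\<lambda>x\<in>carrier M. x) \<in> lmod_hom A M M"
  by (rule lmod_homI) (use assms in auto)

lemma hom_compose:
  assumes "left_module A L" "f \<in> lmod_hom A L M" "g \<in> lmod_hom A M N"
  shows "compose (carrier L) g f \<in> lmod_hom A L N"
  unfolding compose_def
  by (rule lmod_homI) (use assms in \<open>auto simp: hom_add hom_smult\<close>)

lemma compose_pt: "x \<in> carrier L \<Longrightarrow> compose (carrier L) g f x = g (f x)"
  by (simp add: compose_def)

lemma hom_sum:
  assumes "left_module A M" "left_module A N" "f \<in> lmod_hom A M N" "g \<in> lmod_hom A M N"
  shows "(\<lambda>x\<in>carrier M. f x \<oplus>\<^bsub>N\<^esub> g x) \<in> lmod_hom A M N"
proof -
  interpret M: left_module A M by fact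
  interpret N: left_module A N by fact
  show ?thesis
    by (rule lmod_homI[OF assms(1)])
      (use assms(3,4) in \<open>auto simp: hom_add[OF assms(3)] hom_add[OF assms(4)] N.M.a_ac
        hom_smult[OF assms(3)] hom_smult[OF assms(4)] N.act_r_distr\<close>)
qed

lemma hom_negmap:
  assumes "left_module A M" "left_module A N" "f \<in> lmod_hom A M N"
  shows "(\<lambda>x\<in>carrier M. \<ominus>\<^bsub>N\<^esub> f x) \<in> lmod_hom A M N"
proof -
  interpret M: left_module A M by fact
  interpret N: left_module A N by fact
  have "\<ominus>\<^bsub>N\<^esub> (a \<odot>\<^bsub>N\<^esub> y) = a \<odot>\<^bsub>N\<^esub> (\<ominus>\<^bsub>N\<^esub> y)" if "a \<in> carrier A" "y \<in> carrier N" for a y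
  proof -
    have "a \<odot>\<^bsub>N\<^esub> (\<ominus>\<^bsub>N\<^esub> y) \<oplus>\<^bsub>N\<^esub> a \<odot>\<^bsub>N\<^esub> y = \<zero>\<^bsub>N\<^esub>"
      using N.act_r_distr[of a "\<ominus>\<^bsub>N\<^esub> y" y] that by (simp add: N.M.l_neg)
    then show ?thesis using that N.act_closed by (simp add: N.M.minus_equality)
  qed
  then show ?thesis
    by (intro lmod_homI[OF assms(1)])
      (use assms(3) in \<open>auto simp: hom_add[OF assms(3)] hom_smult[OF assms(3)] N.M.minus_add\<close>)
qed

lemma hom_diffmap:
  assumes "left_module A M" "left_module A N" "f \<in> lmod_hom A M N" "g \<in> lmod_hom A M N"
  shows "(\<lambda>x\<in>carrier M. f x \<ominus>\<^bsub>N\<^esub> g x) \<in> lmod_hom A M N"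
proof -
  have "(\<lambda>x\<in>carrier M. f x \<ominus>\<^bsub>N\<^esub> g x) = (\<lambda>x\<in>carrier M. f x \<oplus>\<^bsub>N\<^esub> (\<lambda>x\<in>carrier M. \<ominus>\<^bsub>N\<^esub> g x) x)"
    by (auto simp: a_minus_def)
  with hom_sum[OF assms(1-3) hom_negmap[OF assms(1,2,4)]] show ?thesis by simp
qed

lemma hom_zeromap:
  assumes "left_module A M" "left_module A N"
  shows "(\<lambda>x\<in>carrier M. \<zero>\<^bsub>N\<^esub>) \<in> lmod_hom A M N"
proof -
  interpret N: left_module A N by fact
  show ?thesis by (intro lmod_homI[OF assms(1)]) auto
qed

lemma hom_incl:
  fixes M :: "('a, 'v) module"
  assumes "left_module A M" "submodule N A M"
  shows "(\<lambda>x\<in>N. x) \<in> lmod_hom A (M\<lparr>carrier := N\<rparr>) M"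
proof -
  have "N \<subseteq> carrier M" using submodule_subset[OF assms(2)] .
  then have "restrict (\<lambda>x. x) (carrier (M\<lparr>carrier := N\<rparr>)) \<in> lmod_hom A (M\<lparr>carrier := N\<rparr>) M"
    by (intro lmod_homI[OF left_module_sub[OF assms]]) auto
  then show ?thesis by simp
qed

lemma sub_diff:
  fixes M :: "('a, 'v) module"
  assumes "left_module A M" "submodule N A M" "x \<in> N" "y \<in> N"
  shows "x \<ominus>\<^bsub>M\<lparr>carrier := N\<rparr>\<^esub> y = x \<ominus>\<^bsub>M\<^esub> y"
proof -
  interpret S: left_module A "M\<lparr>carrier := N\<rparr>" by (rule left_module_sub) fact+
  have "x \<ominus>\<^bsub>M\<lparr>carrier := N\<rparr>\<^esub> y \<in> N" using S.M.diff_closed[of x y] assms(3,4) by simp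
  then show ?thesis
    using hom_diff[OF left_module_sub[OF assms(1,2)] assms(1) hom_incl[OF assms(1,2)], of x y] assms(3,4)
    by simp
qed

lemma hom_restrict:
  fixes M :: "('a, 'v) module"
  assumes "left_module A M" "submodule S A M" "f \<in> lmod_hom A M N"
  shows "restrict f S \<in> lmod_hom A (M\<lparr>carrier := S\<rparr>) N"
proof -
  have "S \<subseteq> carrier M" using submodule_subset[OF assms(2)] .
  then have "restrict f (carrier (M\<lparr>carrier := S\<rparr>)) \<in> lmod_hom A (M\<lparr>carrier := S\<rparr>) N"
    using assms(3)
    by (intro lmod_homI[OF left_module_sub[OF assms(1,2)]]) (auto simp: hom_add hom_smult subset_iff)
  then show ?thesis by simp
qed

lemma hom_corestrict:
  fixes N :: "('a, 'v) module"
  assumes "f \<in> lmod_hom A M N" "f ` carrier M \<subseteq> T"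
  shows "f \<in> lmod_hom A M (N\<lparr>carrier := T\<rparr>)"
  using assms by (auto simp: lmod_hom_def PiE_def simp del: hom_closed)

lemma kernel_submodule:
  fixes M :: "('a, 'v) module"
  assumes "left_module A M" "left_module A N" "f \<in> lmod_hom A M N"
  shows "submodule (a_kernel M N f) A M"
proof -
  interpret M: left_module A M by fact
  interpret N: left_module A N by fact
  show ?thesis
    using hom_zero[OF assms] assms(3) M.act_closed
    by (auto simp: submodule_iff[OF assms(1)] a_kernel_eq hom_add hom_smult)
qed

lemma image_submodule:
  fixes M :: "('a, 'v) module" and N :: "('a, 'w) module"
  assumes "left_module A M" "left_module A N" "f \<in> lmod_hom A M N"
  shows "submodule (f ` carrier M) A N"
proof -
  interpret M: left_module A M by fact
  have "f x \<oplus>\<^bsub>N\<^esub> f y \<in> f ` carrier M" if "x \<in> carrier M" "y \<in> carrier M" for x y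
    using hom_add[OF assms(3) that] that by (metis M.M.a_closed imageI)
  moreover have "a \<odot>\<^bsub>N\<^esub> f x \<in> f ` carrier M" if "a \<in> carrier A" "x \<in> carrier M" for x a
    using hom_smult[OF assms(3) that] that by (metis M.act_closed imageI)
  moreover have "\<zero>\<^bsub>N\<^esub> \<in> f ` carrier M" using hom_zero[OF assms] by (metis M.M.zero_closed imageI)
  ultimately show ?thesis
    using assms(3) by (auto simp: submodule_iff[OF assms(2)])
qed

subsection \<open>Isomorphic modules\<close>

text \<open>Isomorphic modules, possibly with carriers in different types.\<close>

definition lmod_iso :: "('k, 'a) module \<Rightarrow> ('a, 'v) module \<Rightarrow> ('a, 'w) module \<Rightarrow> bool" where
  "lmod_iso A M N \<longleftrightarrow> (\<exists>f g. f \<in> lmod_hom A M N \<and> g \<in> lmod_hom A N M \<and>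
     (\<forall>x\<in>carrier M. g (f x) = x) \<and> (\<forall>y\<in>carrier N. f (g y) = y))"

lemma lmod_iso_refl: "left_module A M \<Longrightarrow> lmod_iso A M M"
  unfolding lmod_iso_def
  by (rule exI[of _ "\<lambda>x\<in>carrier M. x"], rule exI[of _ "\<lambda>x\<in>carrier M. x"]) (simp add: hom_id)

lemma lmod_iso_sym: "lmod_iso A M N \<Longrightarrow> lmod_iso A N M"
  unfolding lmod_iso_def by blast

lemma lmod_iso_trans:
  assumes "left_module A L" "left_module A N" "lmod_iso A L M" "lmod_iso A M N"
  shows "lmod_iso A L N"
proof -
  obtain f g where 1: "f \<in> lmod_hom A L M" "g \<in> lmod_hom A M L"
     "\<forall>x\<in>carrier L. g (f x) = x" "\<forall>y\<in>carrier M. f (g y) = y"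
    using assms unfolding lmod_iso_def by blast
  obtain f' g' where 2: "f' \<in> lmod_hom A M N" "g' \<in> lmod_hom A N M"
     "\<forall>x\<in>carrier M. g' (f' x) = x" "\<forall>y\<in>carrier N. f' (g' y) = y"
    using assms unfolding lmod_iso_def by blast
  show ?thesis
    unfolding lmod_iso_def
    by (rule exI[of _ "compose (carrier L) f' f"], rule exI[of _ "compose (carrier N) g g'"])
      (use 1 2 hom_compose[OF assms(1) 1(1) 2(1)] hom_compose[OF assms(2) 2(2) 1(2)]
        in \<open>auto simp: compose_pt\<close>)
qed

lemma bij_hom_inverse:
  assumes "left_module A M" "left_module A N" "f \<in> lmod_hom A M N" "bij_betw f (carrier M) (carrier N)"
  obtains g where "g \<in> lmod_hom A N M" "\<forall>x\<in>carrier M. g (f x) = x" "\<forall>y\<in>carrier N. f (g y) = y"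
proof -
  interpret M: left_module A M by fact
  let ?g = "inv_into (carrier M) f"
  have inj: "inj_on f (carrier M)" and im: "f ` carrier M = carrier N"
    using assms(4) by (auto simp: bij_betw_def)
  have g: "?g y \<in> carrier M" "f (?g y) = y" if "y \<in> carrier N" for y
    using that im by (auto simp: f_inv_into_f inv_into_into)
  have "restrict ?g (carrier N) \<in> lmod_hom A N M"
  proof (rule lmod_homI[OF assms(2)])
    fix x y assume "x \<in> carrier N" "y \<in> carrier N"
    then have "?g x \<oplus>\<^bsub>M\<^esub> ?g y \<in> carrier M" "f (?g x \<oplus>\<^bsub>M\<^esub> ?g y) = x \<oplus>\<^bsub>N\<^esub> y"
      using g by (auto simp: hom_add[OF assms(3)])
    then show "?g (x \<oplus>\<^bsub>N\<^esub> y) = ?g x \<oplus>\<^bsub>M\<^esub> ?g y" using inj by (metis inv_into_f_f)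
  next
    fix a x assume "x \<in> carrier N" "a \<in> carrier A"
    then have "a \<odot>\<^bsub>M\<^esub> ?g x \<in> carrier M" "f (a \<odot>\<^bsub>M\<^esub> ?g x) = a \<odot>\<^bsub>N\<^esub> x"
      using g M.act_closed by (auto simp: hom_smult[OF assms(3)])
    then show "?g (a \<odot>\<^bsub>N\<^esub> x) = a \<odot>\<^bsub>M\<^esub> ?g x" using inj by (metis inv_into_f_f)
  qed (use g in auto)
  moreover have "\<forall>x\<in>carrier M. restrict ?g (carrier N) (f x) = x"
    using inj im by auto
  moreover have "\<forall>y\<in>carrier N. f (restrict ?g (carrier N) y) = y"
    using g by auto
  ultimately show ?thesis by (rule that)
qed

lemma lmod_isoI_bij:
  assumes "left_module A M" "left_module A N" "f \<in> lmod_hom A M N" "bij_betw f (carrier M) (carrier N)"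
  shows "lmod_iso A M N"
  by (rule bij_hom_inverse[OF assms]) (use assms(3) in \<open>auto simp: lmod_iso_def\<close>)

subsection \<open>Direct sums\<close>

lemma dsum_simps [simp]:
  "carrier (dsum M N) = carrier M \<times> carrier N"
  "\<zero>\<^bsub>dsum M N\<^esub> = (\<zero>\<^bsub>M\<^esub>, \<zero>\<^bsub>N\<^esub>)"
  "(x, y) \<oplus>\<^bsub>dsum M N\<^esub> (x', y') = (x \<oplus>\<^bsub>M\<^esub> x', y \<oplus>\<^bsub>N\<^esub> y')"
  "a \<odot>\<^bsub>dsum M N\<^esub> (x, y) = (a \<odot>\<^bsub>M\<^esub> x, a \<odot>\<^bsub>N\<^esub> y)"
  by (simp_all add: dsum_def)

lemma left_module_dsum:
  assumes "left_module A M" "left_module A N"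
  shows "left_module A (dsum M N)"
proof -
  interpret M: left_module A M by fact
  interpret N: left_module A N by fact
  show ?thesis
    by (rule left_moduleI)
      (auto simp: M.A.ring_axioms M.M.a_ac N.M.a_ac M.act_closed N.act_closed M.act_l_distr N.act_l_distr
        M.act_r_distr N.act_r_distr M.act_assoc N.act_assoc M.act_one N.act_one
        intro!: M.M.l_neg N.M.l_neg bexI[of _ "\<ominus>\<^bsub>M\<^esub> _"] bexI[of _ "\<ominus>\<^bsub>N\<^esub> _"])
qed

lemma lmod_iso_dsum_cong:
  assumes "left_module A M" "left_module A N" "left_module A M'" "left_module A N'"
    "lmod_iso A M M'" "lmod_iso A N N'"
  shows "lmod_iso A (dsum M N) (dsum M' N')"
proof -
  obtain f g where 1: "f \<in> lmod_hom A M M'" "g \<in> lmod_hom A M' M"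
     "\<forall>x\<in>carrier M. g (f x) = x" "\<forall>y\<in>carrier M'. f (g y) = y"
    using assms unfolding lmod_iso_def by blast
  obtain f' g' where 2: "f' \<in> lmod_hom A N N'" "g' \<in> lmod_hom A N' N"
     "\<forall>x\<in>carrier N. g' (f' x) = x" "\<forall>y\<in>carrier N'. f' (g' y) = y"
    using assms unfolding lmod_iso_def by blast
  have "(\<lambda>p\<in>carrier (dsum M N). (f (fst p), f' (snd p))) \<in> lmod_hom A (dsum M N) (dsum M' N')"
    by (rule lmod_homI) (use assms 1 2 in \<open>auto simp: left_module_dsum hom_add hom_smult\<close>)
  moreover have "(\<lambda>p\<in>carrier (dsum M' N'). (g (fst p), g' (snd p))) \<in> lmod_hom A (dsum M' N') (dsum M N)"
    by (rule lmod_homI) (use assms 1 2 in \<open>auto simp: left_module_dsum hom_add hom_smult\<close>)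
  ultimately show ?thesis
    unfolding lmod_iso_def using 1 2 by (fastforce simp: hom_closed)
qed

section \<open>Finite-dimensional vector spaces\<close>

text \<open>\<open>lspan K V xs\<close> is the span of a list of vectors and \<open>vdim K V\<close> the least length of a list that
  spans \<open>V\<close>, to be used only if \<open>V\<close> is spanned by some list. The span depends on the operations of
  \<open>V\<close> but not on its carrier, so it is the same in \<open>V\<close> and in a subspace.\<close>

fun lspan :: "'k ring \<Rightarrow> ('k, 'v) module \<Rightarrow> 'v list \<Rightarrow> 'v set" where
  "lspan K V [] = {\<zero>\<^bsub>V\<^esub>}"
| "lspan K V (x # xs) = {c \<odot>\<^bsub>V\<^esub> x \<oplus>\<^bsub>V\<^esub> y | c y. c \<in> carrier K \<and> y \<in> lspan K V xs}"

definition fin_gen :: "'k ring \<Rightarrow> ('k, 'v) module \<Rightarrow> bool" where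
  "fin_gen K V \<longleftrightarrow> (\<exists>xs. set xs \<subseteq> carrier V \<and> lspan K V xs = carrier V)"

definition vdim :: "'k ring \<Rightarrow> ('k, 'v) module \<Rightarrow> nat" where
  "vdim K V = (LEAST n. \<exists>xs. set xs \<subseteq> carrier V \<and> lspan K V xs = carrier V \<and> length xs = n)"

lemma lspan_sub [simp]: "lspan K (V\<lparr>carrier := S\<rparr>) xs = lspan K V xs"
  by (induction xs) auto

lemma vdim_le: "set xs \<subseteq> carrier V \<Longrightarrow> lspan K V xs = carrier V \<Longrightarrow> vdim K V \<le> length xs"
  unfolding vdim_def by (rule Least_le) blast

lemma fin_gen_basis:
  assumes "fin_gen K V"
  obtains xs where "set xs \<subseteq> carrier V" "lspan K V xs = carrier V" "length xs = vdim K V"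
proof -
  have "\<exists>n xs. set xs \<subseteq> carrier V \<and> lspan K V xs = carrier V \<and> length xs = n"
    using assms by (auto simp: fin_gen_def)
  from LeastI_ex[OF this] show ?thesis
    using that unfolding vdim_def by blast
qed

locale vspace = field K + module K V for K :: "'k ring" and V :: "('k, 'v) module"
begin

lemma lspan_submodule: "set xs \<subseteq> carrier V \<Longrightarrow> submodule (lspan K V xs) K V"
proof (induction xs)
  case Nil
  show ?case by (rule submoduleI) auto
next
  case (Cons x xs)
  then have s: "submodule (lspan K V xs) K V" and x: "x \<in> carrier V" by auto
  note E = submoduleE[OF s]
  have c: "y \<in> carrier V" if "y \<in> lspan K V xs" for y using E(1) that by auto
  show ?case
  proof (rule submoduleI)
    show "lspan K V (x # xs) \<subseteq> carrier V" using c x by auto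
    have "\<zero>\<^bsub>V\<^esub> = \<zero>\<^bsub>K\<^esub> \<odot>\<^bsub>V\<^esub> x \<oplus>\<^bsub>V\<^esub> \<zero>\<^bsub>V\<^esub>" using x by simp
    moreover have "\<zero>\<^bsub>V\<^esub> \<in> lspan K V xs"
      using s by (simp add: submodule_def subgroup_def)
    ultimately show "\<zero>\<^bsub>V\<^esub> \<in> lspan K V (x # xs)" by force
  next
    fix a assume "a \<in> lspan K V (x # xs)"
    then obtain k y where a: "a = k \<odot>\<^bsub>V\<^esub> x \<oplus>\<^bsub>V\<^esub> y" "k \<in> carrier K" "y \<in> lspan K V xs" by auto
    then have "\<ominus>\<^bsub>V\<^esub> a = (\<ominus>\<^bsub>K\<^esub> k) \<odot>\<^bsub>V\<^esub> x \<oplus>\<^bsub>V\<^esub> \<ominus>\<^bsub>V\<^esub> y"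
      using x c by (simp add: M.minus_add smult_l_minus M.a_comm)
    then show "\<ominus>\<^bsub>V\<^esub> a \<in> lspan K V (x # xs)" using a E(3) by auto
  next
    fix a b assume "a \<in> lspan K V (x # xs)" "b \<in> lspan K V (x # xs)"
    then obtain k y k' y' where a: "a = k \<odot>\<^bsub>V\<^esub> x \<oplus>\<^bsub>V\<^esub> y" "k \<in> carrier K" "y \<in> lspan K V xs"
      and b: "b = k' \<odot>\<^bsub>V\<^esub> x \<oplus>\<^bsub>V\<^esub> y'" "k' \<in> carrier K" "y' \<in> lspan K V xs" by auto
    then have "a \<oplus>\<^bsub>V\<^esub> b = (k \<oplus>\<^bsub>K\<^esub> k') \<odot>\<^bsub>V\<^esub> x \<oplus>\<^bsub>V\<^esub> (y \<oplus>\<^bsub>V\<^esub> y')"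
      using x c by (simp add: smult_l_distr M.a_ac)
    then show "a \<oplus>\<^bsub>V\<^esub> b \<in> lspan K V (x # xs)" using a b E(5) by auto
  next
    fix k' a assume k': "k' \<in> carrier K" and "a \<in> lspan K V (x # xs)"
    then obtain k y where a: "a = k \<odot>\<^bsub>V\<^esub> x \<oplus>\<^bsub>V\<^esub> y" "k \<in> carrier K" "y \<in> lspan K V xs" by auto
    then have "k' \<odot>\<^bsub>V\<^esub> a = (k' \<otimes>\<^bsub>K\<^esub> k) \<odot>\<^bsub>V\<^esub> x \<oplus>\<^bsub>V\<^esub> k' \<odot>\<^bsub>V\<^esub> y"
      using x c k' by (simp add: smult_r_distr smult_assoc1)
    then show "k' \<odot>\<^bsub>V\<^esub> a \<in> lspan K V (x # xs)" using a E(4) k' by auto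
  qed
qed

lemma zero_in_submodule: "submodule S K V \<Longrightarrow> \<zero>\<^bsub>V\<^esub> \<in> S"
  by (simp add: submodule_def subgroup_def)

lemma diff_in_submodule:
  "submodule S K V \<Longrightarrow> x \<in> S \<Longrightarrow> y \<in> S \<Longrightarrow> x \<ominus>\<^bsub>V\<^esub> y \<in> S"
  using submoduleE(3,5)[of S] by (simp add: a_minus_def)

lemma lspan_least: "submodule S K V \<Longrightarrow> set xs \<subseteq> S \<Longrightarrow> lspan K V xs \<subseteq> S"
proof (induction xs)
  case Nil
  then show ?case by (simp add: zero_in_submodule)
next
  case (Cons x xs)
  then show ?case using submoduleE(4,5)[OF Cons.prems(1)] by auto
qed

lemma set_subset_lspan: "set xs \<subseteq> carrier V \<Longrightarrow> set xs \<subseteq> lspan K V xs"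
proof (induction xs)
  case (Cons x xs)
  then have s: "submodule (lspan K V xs) K V" by (intro lspan_submodule) auto
  have "x = \<one>\<^bsub>K\<^esub> \<odot>\<^bsub>V\<^esub> x \<oplus>\<^bsub>V\<^esub> \<zero>\<^bsub>V\<^esub>" using Cons by simp
  then have "x \<in> lspan K V (x # xs)" using zero_in_submodule[OF s] by force
  moreover have "y \<in> lspan K V (x # xs)" if "y \<in> set xs" for y
  proof -
    have "y = \<zero>\<^bsub>K\<^esub> \<odot>\<^bsub>V\<^esub> x \<oplus>\<^bsub>V\<^esub> y" using Cons that by (auto simp: subset_iff)
    then show ?thesis using Cons that by force
  qed
  ultimately show ?case by auto
qed simp

lemma lspan_eqI:
  assumes "set xs \<subseteq> carrier V" "set ys \<subseteq> carrier V" "set xs \<subseteq> lspan K V ys" "set ys \<subseteq> lspan K V xs"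
  shows "lspan K V xs = lspan K V ys"
  using assms by (meson lspan_least lspan_submodule subset_antisym)

lemma lspan_exchange_head:
  assumes "x \<in> carrier V" "set xs \<subseteq> carrier V" "c \<in> carrier K" "c \<noteq> \<zero>\<^bsub>K\<^esub>" "y \<in> lspan K V xs"
  shows "lspan K V ((c \<odot>\<^bsub>V\<^esub> x \<oplus>\<^bsub>V\<^esub> y) # xs) = lspan K V (x # xs)" (is "lspan K V (?s # xs) = _")
proof (rule lspan_eqI)
  have y: "y \<in> carrier V" using assms(2,5) lspan_submodule submoduleE(1) by blast
  then have s: "?s \<in> carrier V" using assms by simp
  show "set (?s # xs) \<subseteq> carrier V" "set (x # xs) \<subseteq> carrier V" using s assms by auto
  then have 1: "submodule (lspan K V (x # xs)) K V" "submodule (lspan K V (?s # xs)) K V"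
      "set (x # xs) \<subseteq> lspan K V (x # xs)" "set (?s # xs) \<subseteq> lspan K V (?s # xs)"
    using lspan_submodule set_subset_lspan by blast+
  have 2: "lspan K V xs \<subseteq> lspan K V (x # xs)" "lspan K V xs \<subseteq> lspan K V (?s # xs)"
    using lspan_least[OF 1(1), of xs] lspan_least[OF 1(2), of xs] 1(3,4) by auto
  show "set (?s # xs) \<subseteq> lspan K V (x # xs)" using assms 1(3) by auto
  have inv: "inv\<^bsub>K\<^esub> c \<in> carrier K" "inv\<^bsub>K\<^esub> c \<otimes>\<^bsub>K\<^esub> c = \<one>\<^bsub>K\<^esub>"
    using assms(3,4) field_Units by auto
  have "?s \<ominus>\<^bsub>V\<^esub> y = c \<odot>\<^bsub>V\<^esub> x" using y assms by (simp add: M.add_diff_cancel)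
  then have "x = inv\<^bsub>K\<^esub> c \<odot>\<^bsub>V\<^esub> (?s \<ominus>\<^bsub>V\<^esub> y)"
    using inv assms by (simp add: smult_assoc1[symmetric])
  moreover have "\<dots> \<in> lspan K V (?s # xs)"
    using diff_in_submodule[OF 1(2)] submoduleE(4)[OF 1(2)] inv 1(4) 2(2) assms(5) by (metis list.set_intros(1) subsetD)
  ultimately show "set (x # xs) \<subseteq> lspan K V (?s # xs)" using 1(4) by auto
qed

lemma inter_submodule: "submodule S K V \<Longrightarrow> submodule T K V \<Longrightarrow> submodule (S \<inter> T) K V"
  using submoduleE[of S] submoduleE[of T] zero_in_submodule by (intro submoduleI) auto

text \<open>A subspace of a space spanned by \<open>n\<close> vectors is spanned by at most \<open>n\<close> vectors, and by fewer
  if it is proper.\<close>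

lemma subspace_lspan:
  "set xs \<subseteq> carrier V \<Longrightarrow> submodule S K V \<Longrightarrow> S \<subseteq> lspan K V xs \<Longrightarrow>
   \<exists>ys. set ys \<subseteq> S \<and> lspan K V ys = S \<and> length ys \<le> length xs \<and>
     (S \<noteq> lspan K V xs \<longrightarrow> length ys < length xs)"
proof (induction xs arbitrary: S)
  case Nil
  then have "S = {\<zero>\<^bsub>V\<^esub>}" using zero_in_submodule by auto
  then show ?case by (intro exI[of _ "[]"]) auto
next
  case (Cons x xs)
  then have xs: "set xs \<subseteq> carrier V" and x: "x \<in> carrier V" by auto
  have sub: "submodule (lspan K V xs) K V" by (rule lspan_submodule[OF xs])
  let ?S' = "S \<inter> lspan K V xs"
  obtain ys where ys: "set ys \<subseteq> ?S'" "lspan K V ys = ?S'" "length ys \<le> length xs"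
    "?S' \<noteq> lspan K V xs \<longrightarrow> length ys < length xs"
    using Cons.IH[OF xs inter_submodule[OF Cons.prems(2) sub]] by auto
  show ?case
  proof (cases "S \<subseteq> lspan K V xs")
    case True
    then show ?thesis using ys by (intro exI[of _ ys]) auto
  next
    case False
    then obtain s where s: "s \<in> S" "s \<notin> lspan K V xs" by auto
    with Cons.prems(3) obtain c y where
      cy: "s = c \<odot>\<^bsub>V\<^esub> x \<oplus>\<^bsub>V\<^esub> y" "c \<in> carrier K" "y \<in> lspan K V xs" by auto
    have y: "y \<in> carrier V" using cy(3) submoduleE(1)[OF sub] by auto
    have c0: "c \<noteq> \<zero>\<^bsub>K\<^esub>" using s(2) cy y x by auto
    have sV: "s \<in> carrier V" using s submoduleE(1)[OF Cons.prems(2)] by auto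
    have ysS: "set (s # ys) \<subseteq> S" using ys s by auto
    then have ysV: "set (s # ys) \<subseteq> carrier V" using submoduleE(1)[OF Cons.prems(2)] by blast
    have "S \<subseteq> lspan K V (s # ys)"
    proof
      fix t assume t: "t \<in> S"
      have "lspan K V (x # xs) = lspan K V (s # xs)"
        using lspan_exchange_head[OF x xs cy(2) c0 cy(3)] cy(1) by simp
      then obtain d z where dz: "t = d \<odot>\<^bsub>V\<^esub> s \<oplus>\<^bsub>V\<^esub> z" "d \<in> carrier K" "z \<in> lspan K V xs"
        using Cons.prems(3) t by auto
      have zV: "z \<in> carrier V" using dz(3) submoduleE(1)[OF sub] by auto
      have "z = t \<ominus>\<^bsub>V\<^esub> d \<odot>\<^bsub>V\<^esub> s" using dz sV zV by (simp add: M.add_diff_cancel2)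
      moreover have "t \<ominus>\<^bsub>V\<^esub> d \<odot>\<^bsub>V\<^esub> s \<in> S"
        by (intro diff_in_submodule[OF Cons.prems(2)] t submoduleE(4)[OF Cons.prems(2)] dz s)
      ultimately have "z \<in> S" by simp
      then show "t \<in> lspan K V (s # ys)" using dz ys by auto
    qed
    moreover have "lspan K V (s # ys) \<subseteq> S" by (rule lspan_least[OF Cons.prems(2) ysS])
    moreover have "length ys < length xs" if "S \<noteq> lspan K V (x # xs)"
    proof (rule ccontr)
      assume "\<not> length ys < length xs"
      then have "lspan K V xs \<subseteq> S" using ys by blast
      then have "set (s # xs) \<subseteq> S" using s set_subset_lspan[OF xs] by auto
      then have "lspan K V (s # xs) \<subseteq> S" using lspan_least Cons.prems(2) by blast
      then show False
        using that Cons.prems(3) lspan_exchange_head[OF x xs cy(2) c0 cy(3)] cy(1) by auto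
    qed
    ultimately show ?thesis using ysS ys by (intro exI[of _ "s # ys"]) auto
  qed
qed

lemma fin_gen_sub:
  assumes "fin_gen K V" "submodule S K V"
  shows "fin_gen K (V\<lparr>carrier := S\<rparr>)"
    and "S \<noteq> carrier V \<Longrightarrow> vdim K (V\<lparr>carrier := S\<rparr>) < vdim K V"
proof -
  obtain xs where xs: "set xs \<subseteq> carrier V" "lspan K V xs = carrier V" "length xs = vdim K V"
    using fin_gen_basis[OF assms(1)] .
  obtain ys where ys: "set ys \<subseteq> S" "lspan K V ys = S" "S \<noteq> carrier V \<longrightarrow> length ys < length xs"
    using subspace_lspan[OF xs(1) assms(2)] submoduleE(1)[OF assms(2)] xs(2) by auto
  show "fin_gen K (V\<lparr>carrier := S\<rparr>)" using ys by (auto simp: fin_gen_def)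
  show "S \<noteq> carrier V \<Longrightarrow> vdim K (V\<lparr>carrier := S\<rparr>) < vdim K V"
    using vdim_le[of ys "V\<lparr>carrier := S\<rparr>" K] ys xs by auto
qed

text \<open>A nonzero vector can replace some member of a spanning list, in the first position.\<close>

lemma lspan_replace:
  "set xs \<subseteq> carrier V \<Longrightarrow> x \<in> lspan K V xs \<Longrightarrow> x \<noteq> \<zero>\<^bsub>V\<^esub> \<Longrightarrow>
   \<exists>ys. set ys \<subseteq> carrier V \<and> lspan K V (x # ys) = lspan K V xs \<and> length ys < length xs"
proof (induction xs)
  case Nil
  then show ?case by simp
next
  case (Cons z zs)
  then have zs: "set zs \<subseteq> carrier V" and z: "z \<in> carrier V" by auto
  obtain c y where cy: "x = c \<odot>\<^bsub>V\<^esub> z \<oplus>\<^bsub>V\<^esub> y" "c \<in> carrier K" "y \<in> lspan K V zs"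
    using Cons.prems(2) by auto
  show ?case
  proof (cases "c = \<zero>\<^bsub>K\<^esub>")
    case False
    then show ?thesis
      using lspan_exchange_head[OF z zs cy(2) _ cy(3)] zs cy(1) by auto
  next
    case True
    have yV: "y \<in> carrier V" using cy(3) submoduleE(1)[OF lspan_submodule[OF zs]] by auto
    with True have "x = y" using cy z by simp
    then obtain ys where ys: "set ys \<subseteq> carrier V" "lspan K V (x # ys) = lspan K V zs" "length ys < length zs"
      using Cons.IH[OF zs _ Cons.prems(3)] cy by auto
    have xV: "x \<in> carrier V" using \<open>x = y\<close> yV by simp
    have c: "set (x # z # ys) \<subseteq> carrier V" "set (z # x # ys) \<subseteq> carrier V" using ys xV z by auto
    have "lspan K V (x # z # ys) = lspan K V (z # x # ys)"
      by (rule lspan_eqI[OF c]) (use set_subset_lspan[OF c(1)] set_subset_lspan[OF c(2)] in auto)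
    also have "\<dots> = lspan K V (z # zs)" using ys(2) by simp
    finally show ?thesis using ys z by (intro exI[of _ "z # ys"]) auto
  qed
qed

lemma lspan_image:
  assumes "f \<zero>\<^bsub>V\<^esub> = \<zero>\<^bsub>W\<^esub>"
    and "\<And>x y. x \<in> carrier V \<Longrightarrow> y \<in> carrier V \<Longrightarrow> f (x \<oplus>\<^bsub>V\<^esub> y) = f x \<oplus>\<^bsub>W\<^esub> f y"
    and "\<And>c x. c \<in> carrier K \<Longrightarrow> x \<in> carrier V \<Longrightarrow> f (c \<odot>\<^bsub>V\<^esub> x) = c \<odot>\<^bsub>W\<^esub> f x"
  shows "set xs \<subseteq> carrier V \<Longrightarrow> f ` lspan K V xs = lspan K W (map f xs)"
proof (induction xs)
  case (Cons x xs)
  then have IH: "f ` lspan K V xs = lspan K W (map f xs)" and x: "x \<in> carrier V"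
    and sub: "lspan K V xs \<subseteq> carrier V"
    using submoduleE(1)[OF lspan_submodule] by auto
  have e: "f (c \<odot>\<^bsub>V\<^esub> x \<oplus>\<^bsub>V\<^esub> y) = c \<odot>\<^bsub>W\<^esub> f x \<oplus>\<^bsub>W\<^esub> f y" if "c \<in> carrier K" "y \<in> lspan K V xs" for c y
    using assms(2,3) that x sub by auto
  show ?case
  proof (intro equalityI subsetI)
    fix t assume "t \<in> f ` lspan K V (x # xs)"
    then obtain c y where "c \<in> carrier K" "y \<in> lspan K V xs" "t = f (c \<odot>\<^bsub>V\<^esub> x \<oplus>\<^bsub>V\<^esub> y)" by auto
    moreover from this have "f y \<in> lspan K W (map f xs)" using IH by blast
    ultimately show "t \<in> lspan K W (map f (x # xs))" using e by auto
  next
    fix t assume "t \<in> lspan K W (map f (x # xs))"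
    then obtain c w where 1: "c \<in> carrier K" "w \<in> lspan K W (map f xs)" "t = c \<odot>\<^bsub>W\<^esub> f x \<oplus>\<^bsub>W\<^esub> w" by auto
    then obtain y where "y \<in> lspan K V xs" "w = f y" using IH by blast
    then have "t = f (c \<odot>\<^bsub>V\<^esub> x \<oplus>\<^bsub>V\<^esub> y)" "c \<odot>\<^bsub>V\<^esub> x \<oplus>\<^bsub>V\<^esub> y \<in> lspan K V (x # xs)" using 1 e by auto
    then show "t \<in> f ` lspan K V (x # xs)" by blast
  qed
qed (simp add: assms)

text \<open>Replace a member of a shortest spanning list by a vector of the kernel: the images of the other
  members still span, which contradicts minimality.\<close>

lemma surj_imp_inj:
  assumes f: "\<And>x. x \<in> carrier V \<Longrightarrow> f x \<in> carrier V"
    and add: "\<And>x y. x \<in> carrier V \<Longrightarrow> y \<in> carrier V \<Longrightarrow> f (x \<oplus>\<^bsub>V\<^esub> y) = f x \<oplus>\<^bsub>V\<^esub> f y"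
    and smult: "\<And>c x. c \<in> carrier K \<Longrightarrow> x \<in> carrier V \<Longrightarrow> f (c \<odot>\<^bsub>V\<^esub> x) = c \<odot>\<^bsub>V\<^esub> f x"
    and fg: "fin_gen K V" and surj: "f ` carrier V = carrier V"
  shows "inj_on f (carrier V)"
proof -
  have "f \<zero>\<^bsub>V\<^esub> = \<zero>\<^bsub>V\<^esub>" using smult[of "\<zero>\<^bsub>K\<^esub>" "\<zero>\<^bsub>V\<^esub>"] f[of "\<zero>\<^bsub>V\<^esub>"] by simp
  note im = lspan_image[of f V, OF this add smult]
  have ker: "x = \<zero>\<^bsub>V\<^esub>" if x: "x \<in> carrier V" "f x = \<zero>\<^bsub>V\<^esub>" for x
  proof (rule ccontr)
    assume nz: "x \<noteq> \<zero>\<^bsub>V\<^esub>"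
    obtain xs where xs: "set xs \<subseteq> carrier V" "lspan K V xs = carrier V" "length xs = vdim K V"
      using fin_gen_basis[OF fg] .
    obtain ys where ys: "set ys \<subseteq> carrier V" "lspan K V (x # ys) = carrier V" "length ys < vdim K V"
      using lspan_replace[OF xs(1) _ nz] x(1) xs(2,3) by auto
    have mys: "set (map f ys) \<subseteq> carrier V" using f ys(1) by auto
    have sub: "lspan K V (map f ys) \<subseteq> carrier V" using submoduleE(1)[OF lspan_submodule[OF mys]] .
    have "carrier V = f ` lspan K V (x # ys)" using surj ys(2) by simp
    also have "\<dots> = lspan K V (map f (x # ys))" using im[of "x # ys"] x ys by simp
    also have "\<dots> \<subseteq> lspan K V (map f ys)" using x sub by auto
    finally have "lspan K V (map f ys) = carrier V" using sub by auto
    then show False using vdim_le[OF mys, of K] ys(3) by simp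
  qed
  show ?thesis
  proof (rule inj_onI)
    fix x y assume xy: "x \<in> carrier V" "y \<in> carrier V" "f x = f y"
    have "f (x \<ominus>\<^bsub>V\<^esub> y) \<oplus>\<^bsub>V\<^esub> f y = f x"
      using add[of "x \<ominus>\<^bsub>V\<^esub> y" y] xy by (simp add: M.diff_add_cancel)
    then have "f (x \<ominus>\<^bsub>V\<^esub> y) = \<zero>\<^bsub>V\<^esub>" using xy f M.add.r_cancel_one[of "f y" "f (x \<ominus>\<^bsub>V\<^esub> y)"] by simp
    then show "x = y" using ker[of "x \<ominus>\<^bsub>V\<^esub> y"] xy by (simp add: M.diff_eq_zero_iff)
  qed
qed


lemma finsum_in_submodule:
  assumes "submodule S K V"
  shows "finite B \<Longrightarrow> (\<And>b. b \<in> B \<Longrightarrow> g b \<in> S) \<Longrightarrow> (\<Oplus>\<^bsub>V\<^esub>b\<in>B. g b) \<in> S"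
proof (induction B rule: finite_induct)
  case empty
  then show ?case by (simp add: zero_in_submodule[OF assms])
next
  case (insert b B)
  then have "g \<in> B \<rightarrow> carrier V" "g b \<in> carrier V" using submoduleE(1)[OF assms] by auto
  with insert show ?case using submoduleE(5)[OF assms] by (simp add: M.finsum_insert)
qed

lemma lspan_finsum:
  "set xs \<subseteq> carrier V \<Longrightarrow> t \<in> lspan K V xs \<Longrightarrow>
   \<exists>c\<in>set xs \<rightarrow> carrier K. t = (\<Oplus>\<^bsub>V\<^esub>b\<in>set xs. c b \<odot>\<^bsub>V\<^esub> b)"
proof (induction xs arbitrary: t)
  case (Cons x xs)
  then obtain d y where t: "t = d \<odot>\<^bsub>V\<^esub> x \<oplus>\<^bsub>V\<^esub> y" "d \<in> carrier K" "y \<in> lspan K V xs" by auto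
  then obtain c where c: "c \<in> set xs \<rightarrow> carrier K" "y = (\<Oplus>\<^bsub>V\<^esub>b\<in>set xs. c b \<odot>\<^bsub>V\<^esub> b)"
    using Cons by auto
  have x: "x \<in> carrier V" and xs: "set xs \<subseteq> carrier V" using Cons.prems by auto
  define B where "B = set xs - {x}"
  define c0 where "c0 = (if x \<in> set xs then c x else \<zero>\<^bsub>K\<^esub>)"
  define c' where "c' = (\<lambda>b. if b = x then d \<oplus>\<^bsub>K\<^esub> c0 else c b)"
  have c0: "c0 \<in> carrier K" using c(1) by (auto simp: c0_def)
  have B: "finite B" "x \<notin> B" "insert x (set xs) = insert x B" by (auto simp: B_def)
  have cl: "(\<lambda>b. c b \<odot>\<^bsub>V\<^esub> b) \<in> B \<rightarrow> carrier V" using c(1) xs by (auto simp: B_def)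
  let ?s = "\<Oplus>\<^bsub>V\<^esub>b\<in>B. c b \<odot>\<^bsub>V\<^esub> b"
  have sV: "?s \<in> carrier V" using cl by simp
  have y: "y = c0 \<odot>\<^bsub>V\<^esub> x \<oplus>\<^bsub>V\<^esub> ?s"
  proof (cases "x \<in> set xs")
    case True
    then have "set xs = insert x B" by (auto simp: B_def)
    then show ?thesis using c(2) B cl True x c(1) by (simp add: M.finsum_insert c0_def Pi_iff)
  next
    case False
    then show ?thesis using c(2) x sV by (simp add: B_def c0_def)
  qed
  have eq: "(\<Oplus>\<^bsub>V\<^esub>b\<in>B. c' b \<odot>\<^bsub>V\<^esub> b) = ?s"
    by (rule M.finsum_cong') (use cl B(2) in \<open>auto simp: c'_def\<close>)
  have "(\<Oplus>\<^bsub>V\<^esub>b\<in>insert x B. c' b \<odot>\<^bsub>V\<^esub> b) = c' x \<odot>\<^bsub>V\<^esub> x \<oplus>\<^bsub>V\<^esub> ?s"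
  proof -
    have "(\<lambda>b. c' b \<odot>\<^bsub>V\<^esub> b) \<in> B \<rightarrow> carrier V" using cl B(2) by (auto simp: c'_def)
    moreover have "c' x \<odot>\<^bsub>V\<^esub> x \<in> carrier V" using x t c0 by (simp add: c'_def)
    ultimately show ?thesis using B eq by (simp add: M.finsum_insert)
  qed
  also have "\<dots> = d \<odot>\<^bsub>V\<^esub> x \<oplus>\<^bsub>V\<^esub> (c0 \<odot>\<^bsub>V\<^esub> x \<oplus>\<^bsub>V\<^esub> ?s)"
    using x t c0 sV by (simp add: c'_def smult_l_distr M.a_assoc)
  finally have "t = (\<Oplus>\<^bsub>V\<^esub>b\<in>set (x # xs). c' b \<odot>\<^bsub>V\<^esub> b)" using t y B(3) by simp
  moreover have "c' \<in> set (x # xs) \<rightarrow> carrier K" using c(1) t c0 by (auto simp: c'_def)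
  ultimately show ?case by blast
qed simp

lemma fin_gen_iff_finsum:
  "fin_gen K V \<longleftrightarrow> (\<exists>B. finite B \<and> B \<subseteq> carrier V \<and>
     (\<forall>x \<in> carrier V. \<exists>c \<in> B \<rightarrow> carrier K. x = (\<Oplus>\<^bsub>V\<^esub>b\<in>B. c b \<odot>\<^bsub>V\<^esub> b)))"
proof
  assume "fin_gen K V"
  then obtain xs where xs: "set xs \<subseteq> carrier V" "lspan K V xs = carrier V" by (auto simp: fin_gen_def)
  then show "\<exists>B. finite B \<and> B \<subseteq> carrier V \<and>
     (\<forall>x \<in> carrier V. \<exists>c \<in> B \<rightarrow> carrier K. x = (\<Oplus>\<^bsub>V\<^esub>b\<in>B. c b \<odot>\<^bsub>V\<^esub> b))"
    using lspan_finsum[OF xs(1)] by (intro exI[of _ "set xs"]) auto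
next
  assume "\<exists>B. finite B \<and> B \<subseteq> carrier V \<and>
     (\<forall>x \<in> carrier V. \<exists>c \<in> B \<rightarrow> carrier K. x = (\<Oplus>\<^bsub>V\<^esub>b\<in>B. c b \<odot>\<^bsub>V\<^esub> b))"
  then obtain B where B: "finite B" "B \<subseteq> carrier V"
     "\<And>x. x \<in> carrier V \<Longrightarrow> \<exists>c \<in> B \<rightarrow> carrier K. x = (\<Oplus>\<^bsub>V\<^esub>b\<in>B. c b \<odot>\<^bsub>V\<^esub> b)" by blast
  obtain xs where xs: "set xs = B" using finite_list[OF B(1)] by blast
  have s: "submodule (lspan K V xs) K V" by (rule lspan_submodule) (use xs B in simp)
  have "x \<in> lspan K V xs" if x: "x \<in> carrier V" for x
  proof -
    obtain c where c: "c \<in> B \<rightarrow> carrier K" "x = (\<Oplus>\<^bsub>V\<^esub>b\<in>B. c b \<odot>\<^bsub>V\<^esub> b)" using B(3)[OF x] by blast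
    have "c b \<odot>\<^bsub>V\<^esub> b \<in> lspan K V xs" if "b \<in> B" for b
      using that c submoduleE(4)[OF s] set_subset_lspan[of xs] xs B(2) by auto
    then show ?thesis using finsum_in_submodule[OF s B(1)] c(2) by auto
  qed
  then have "lspan K V xs = carrier V" using submoduleE(1)[OF s] by auto
  then show "fin_gen K V" using xs B(2) by (auto simp: fin_gen_def)
qed

text \<open>Coordinates with respect to a spanning list encode vectors as lists of scalars.\<close>

lemma lspan_code:
  "set xs \<subseteq> carrier V \<Longrightarrow>
   \<exists>code. inj_on code (lspan K V xs) \<and> code ` lspan K V xs \<subseteq> lists (carrier K)"
proof (induction xs)
  case Nil
  then show ?case by (intro exI[of _ "\<lambda>_. []"]) auto
next
  case (Cons x xs)
  then obtain code where code: "inj_on code (lspan K V xs)" "code ` lspan K V xs \<subseteq> lists (carrier K)" by auto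
  have "\<forall>t\<in>lspan K V (x # xs). \<exists>c y. c \<in> carrier K \<and> y \<in> lspan K V xs \<and> t = c \<odot>\<^bsub>V\<^esub> x \<oplus>\<^bsub>V\<^esub> y" by auto
  then obtain c y where cy: "\<And>t. t \<in> lspan K V (x # xs) \<Longrightarrow>
      c t \<in> carrier K \<and> y t \<in> lspan K V xs \<and> t = c t \<odot>\<^bsub>V\<^esub> x \<oplus>\<^bsub>V\<^esub> y t" by metis
  let ?code = "\<lambda>t. c t # code (y t)"
  have "inj_on ?code (lspan K V (x # xs))"
  proof (rule inj_onI)
    fix s t assume s: "s \<in> lspan K V (x # xs)" and t: "t \<in> lspan K V (x # xs)" and eq: "?code s = ?code t"
    then have "c s = c t" "y s = y t" using cy[OF s] cy[OF t] inj_onD[OF code(1)] by auto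
    then show "s = t" using cy[OF s] cy[OF t] by metis
  qed
  moreover have "?code ` lspan K V (x # xs) \<subseteq> lists (carrier K)"
  proof
    fix l assume "l \<in> ?code ` lspan K V (x # xs)"
    then obtain t where t: "t \<in> lspan K V (x # xs)" "l = ?code t" by (rule imageE)
    moreover have "code (y t) \<in> lists (carrier K)" using cy[OF t(1)] code(2) by (meson imageI subsetD)
    ultimately show "l \<in> lists (carrier K)" using cy[OF t(1)] by simp
  qed
  ultimately show ?case by blast
qed

end

section \<open>Finite-dimensional modules over a finite-dimensional algebra\<close>

text \<open>The vector space underlying an \<open>A\<close>-module.\<close>

definition kmod :: "('k, 'a) module \<Rightarrow> ('a, 'v) module \<Rightarrow> ('k, 'v) module" where
  "kmod A M = \<lparr>carrier = carrier M, mult = mult M, one = one M, zero = zero M, add = add M,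
     smult = (\<lambda>c x. (c \<odot>\<^bsub>A\<^esub> \<one>\<^bsub>A\<^esub>) \<odot>\<^bsub>M\<^esub> x)\<rparr>"

lemma kmod_simps [simp]:
  "carrier (kmod A M) = carrier M" "zero (kmod A M) = zero M" "add (kmod A M) = add M"
  "smult (kmod A M) c x = (c \<odot>\<^bsub>A\<^esub> \<one>\<^bsub>A\<^esub>) \<odot>\<^bsub>M\<^esub> x"
  by (simp_all add: kmod_def)

lemma kmod_sub: "kmod A (M\<lparr>carrier := N\<rparr>) = (kmod A M)\<lparr>carrier := N\<rparr>"
  by (simp add: kmod_def)

lemma finsum_kmod: "finsum (kmod A M) f B = finsum M f B"
  by (simp add: finsum_def finprod_def)

text \<open>The regular module.\<close>

definition reg :: "('k, 'a) module \<Rightarrow> ('a, 'a) module" where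
  "reg A = \<lparr>carrier = carrier A, mult = mult A, one = one A, zero = zero A, add = add A, smult = mult A\<rparr>"

text \<open>Transport of structure along \<open>\<phi>\<close>, meant for \<open>\<phi>\<close> injective on the carrier of \<open>M\<close>.\<close>

definition copy :: "('v \<Rightarrow> 'u) \<Rightarrow> ('a, 'v) module \<Rightarrow> ('a, 'u) module" where
  "copy \<phi> M = \<lparr>carrier = \<phi> ` carrier M, mult = undefined, one = undefined, zero = \<phi> \<zero>\<^bsub>M\<^esub>,
     add = (\<lambda>u v. \<phi> (inv_into (carrier M) \<phi> u \<oplus>\<^bsub>M\<^esub> inv_into (carrier M) \<phi> v)),
     smult = (\<lambda>a u. \<phi> (a \<odot>\<^bsub>M\<^esub> inv_into (carrier M) \<phi> u))\<rparr>"

lemma copy_module_iso: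
  assumes "left_module A M" "inj_on \<phi> (carrier M)"
  shows "left_module A (copy \<phi> M)" "lmod_iso A M (copy \<phi> M)"
proof -
  interpret M: left_module A M by fact
  have i: "inv_into (carrier M) \<phi> (\<phi> x) = x" if "x \<in> carrier M" for x
    using that assms(2) by simp
  have inv: "\<exists>z\<in>carrier M. z \<oplus>\<^bsub>M\<^esub> x = \<zero>\<^bsub>M\<^esub>" if "x \<in> carrier M" for x
    using that M.M.l_neg by blast
  show c: "left_module A (copy \<phi> M)"
  proof (rule left_moduleI)
    fix x assume "x \<in> carrier (copy \<phi> M)"
    then obtain x' where x': "x' \<in> carrier M" "x = \<phi> x'" by (auto simp: copy_def)
    then have "\<phi> (\<ominus>\<^bsub>M\<^esub> x') \<oplus>\<^bsub>copy \<phi> M\<^esub> x = \<zero>\<^bsub>copy \<phi> M\<^esub>" by (simp add: copy_def i M.M.l_neg)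
    moreover have "\<phi> (\<ominus>\<^bsub>M\<^esub> x') \<in> carrier (copy \<phi> M)" using x' by (simp add: copy_def)
    ultimately show "\<exists>y\<in>carrier (copy \<phi> M). y \<oplus>\<^bsub>copy \<phi> M\<^esub> x = \<zero>\<^bsub>copy \<phi> M\<^esub>" by blast
  qed (auto simp: copy_def i M.A.ring_axioms M.M.a_ac M.act_closed M.act_l_distr
        M.act_r_distr M.act_assoc M.act_one)
  have h: "restrict \<phi> (carrier M) \<in> lmod_hom A M (copy \<phi> M)"
    by (rule lmod_homI[OF assms(1)]) (auto simp: copy_def i)
  show "lmod_iso A M (copy \<phi> M)"
    by (rule lmod_isoI_bij[OF assms(1) c h]) (use assms(2) in \<open>auto simp: bij_betw_def copy_def\<close>)
qed

context fd_algebra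
begin

lemma scal_closed: "c \<in> carrier K \<Longrightarrow> c \<odot>\<^bsub>A\<^esub> \<one>\<^bsub>A\<^esub> \<in> carrier A" by simp

lemma vspace_kmod: "left_module A M \<Longrightarrow> vspace K (kmod A M)"
proof -
  assume "left_module A M"
  then interpret M: left_module A M .
  have "abelian_group (kmod A M)"
    by (rule abelian_groupI) (auto simp: M.M.a_ac intro!: M.M.l_neg bexI[of _ "\<ominus>\<^bsub>M\<^esub> _"])
  moreover have "((c \<otimes>\<^bsub>K\<^esub> d) \<odot>\<^bsub>A\<^esub> \<one>\<^bsub>A\<^esub>) = (c \<odot>\<^bsub>A\<^esub> \<one>\<^bsub>A\<^esub>) \<otimes>\<^bsub>A\<^esub> (d \<odot>\<^bsub>A\<^esub> \<one>\<^bsub>A\<^esub>)"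
    if "c \<in> carrier K" "d \<in> carrier K" for c d
    using that by (simp add: smult_mult_left smult_assoc1)
  ultimately show ?thesis
    by (auto intro!: vspace.intro moduleI K.field_axioms K.is_cring
      simp: M.act_closed M.act_r_distr smult_l_distr M.act_l_distr M.act_one M.act_assoc)
qed

lemma fd_iff: "M \<in> fd_modules K A \<longleftrightarrow> left_module A M \<and> fin_gen K (kmod A M)"
proof (cases "left_module A M")
  case True
  then interpret V: vspace K "kmod A M" by (rule vspace_kmod)
  show ?thesis using True by (simp add: fd_modules_def V.fin_gen_iff_finsum finsum_kmod)
qed (simp add: fd_modules_def)

lemma fdD: "M \<in> fd_modules K A \<Longrightarrow> left_module A M"
  by (simp add: fd_iff)

lemma submodule_kmod:
  fixes M :: "('a, 'v) module"
  assumes "left_module A M" "submodule N A M"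
  shows "submodule N K (kmod A M)"
proof -
  interpret V: vspace K "kmod A M" by (rule vspace_kmod) fact
  interpret M: left_module A M by fact
  have c: "N \<subseteq> carrier M" "\<zero>\<^bsub>M\<^esub> \<in> N" "\<And>x y. x \<in> N \<Longrightarrow> y \<in> N \<Longrightarrow> x \<oplus>\<^bsub>M\<^esub> y \<in> N"
    "\<And>a x. a \<in> carrier A \<Longrightarrow> x \<in> N \<Longrightarrow> a \<odot>\<^bsub>M\<^esub> x \<in> N"
    using assms(2)[unfolded submodule_iff[OF assms(1)]] by auto
  have neg: "\<ominus>\<^bsub>kmod A M\<^esub> x \<in> N" if "x \<in> N" for x
  proof -
    have "\<ominus>\<^bsub>kmod A M\<^esub> x = (\<ominus>\<^bsub>K\<^esub> \<one>\<^bsub>K\<^esub>) \<odot>\<^bsub>kmod A M\<^esub> x"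
      using that c(1) V.smult_l_minus[of "\<one>\<^bsub>K\<^esub>" x] V.smult_one[of x] by auto
    then show ?thesis using that c(4) scal_closed by simp
  qed
  show ?thesis
    by (rule V.submoduleI) (use c scal_closed neg in auto)
qed

lemma fd_sub:
  fixes M :: "('a, 'v) module"
  assumes "M \<in> fd_modules K A" "submodule N A M"
  shows "M\<lparr>carrier := N\<rparr> \<in> fd_modules K A"
proof -
  interpret V: vspace K "kmod A M" using assms by (simp add: vspace_kmod fd_iff)
  show ?thesis
    using assms left_module_sub[OF _ assms(2)] V.fin_gen_sub(1)[OF _ submodule_kmod[OF _ assms(2)]]
    by (simp add: fd_iff kmod_sub)
qed

lemma fd_iso:
  fixes M :: "('a, 'v) module" and N :: "('a, 'w) module"
  assumes "M \<in> fd_modules K A" "left_module A N" "lmod_iso A M N"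
  shows "N \<in> fd_modules K A"
proof -
  interpret V: vspace K "kmod A M" using assms by (simp add: vspace_kmod fd_iff)
  obtain f g where f: "f \<in> lmod_hom A M N" "g \<in> lmod_hom A N M" "\<forall>x\<in>carrier N. f (g x) = x"
    using assms(3) by (auto simp: lmod_iso_def)
  obtain xs where xs: "set xs \<subseteq> carrier M" "lspan K (kmod A M) xs = carrier M"
    using assms(1) by (auto simp: fd_iff fin_gen_def)
  have "f ` lspan K (kmod A M) xs = lspan K (kmod A N) (map f xs)"
    by (rule V.lspan_image)
      (use xs f(1) hom_zero[OF fdD[OF assms(1)] assms(2) f(1)] in \<open>auto simp: hom_add hom_smult\<close>)
  moreover have "f ` carrier M = carrier N" using f by (auto simp: image_iff) (metis hom_closed)
  ultimately have "set (map f xs) \<subseteq> carrier N \<and> lspan K (kmod A N) (map f xs) = carrier N"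
    using xs by auto
  then show ?thesis using assms(2) by (auto simp: fd_iff fin_gen_def simp del: set_map)
qed

lemma fd_dsum:
  fixes M :: "('a, 'v) module" and N :: "('a, 'w) module"
  assumes "M \<in> fd_modules K A" "N \<in> fd_modules K A"
  shows "dsum M N \<in> fd_modules K A"
proof -
  have lm: "left_module A M" "left_module A N" using assms by (auto simp: fdD)
  interpret M: left_module A M by fact
  interpret N: left_module A N by fact
  have l: "left_module A (dsum M N)" using assms by (simp add: fdD left_module_dsum)
  interpret V: vspace K "kmod A M" using assms by (simp add: vspace_kmod fd_iff)
  interpret W: vspace K "kmod A N" using assms by (simp add: vspace_kmod fd_iff)
  interpret D: vspace K "kmod A (dsum M N)" using l by (rule vspace_kmod)
  obtain xs where xs: "set xs \<subseteq> carrier M" "lspan K (kmod A M) xs = carrier M"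
    using assms(1) by (auto simp: fd_iff fin_gen_def)
  obtain ys where ys: "set ys \<subseteq> carrier N" "lspan K (kmod A N) ys = carrier N"
    using assms(2) by (auto simp: fd_iff fin_gen_def)
  let ?i = "\<lambda>x. (x, \<zero>\<^bsub>N\<^esub>)" and ?j = "\<lambda>y. (\<zero>\<^bsub>M\<^esub>, y)"
  let ?zs = "map ?i xs @ map ?j ys"
  have 1: "?i ` lspan K (kmod A M) xs = lspan K (kmod A (dsum M N)) (map ?i xs)"
    using W.smult_r_null xs by (intro V.lspan_image) auto
  have 2: "?j ` lspan K (kmod A N) ys = lspan K (kmod A (dsum M N)) (map ?j ys)"
    using V.smult_r_null ys by (intro W.lspan_image) auto
  have zs: "set ?zs \<subseteq> carrier (kmod A (dsum M N))" using xs ys by auto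
  note s = D.lspan_submodule[OF zs]
  have c: "lspan K (kmod A (dsum M N)) (map ?i xs) \<subseteq> lspan K (kmod A (dsum M N)) ?zs"
     "lspan K (kmod A (dsum M N)) (map ?j ys) \<subseteq> lspan K (kmod A (dsum M N)) ?zs"
    using D.lspan_least[OF s] D.set_subset_lspan[OF zs] by auto
  have "(x, y) \<in> lspan K (kmod A (dsum M N)) ?zs" if "x \<in> carrier M" "y \<in> carrier N" for x y
  proof -
    have "(x, y) = ?i x \<oplus>\<^bsub>kmod A (dsum M N)\<^esub> ?j y" using that by simp
    moreover have "?i x \<in> lspan K (kmod A (dsum M N)) ?zs" using 1 c xs(2) that by blast
    moreover have "?j y \<in> lspan K (kmod A (dsum M N)) ?zs" using 2 c ys(2) that by blast
    ultimately show ?thesis using D.submoduleE(5)[OF s] by metis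
  qed
  then have "lspan K (kmod A (dsum M N)) ?zs = carrier (kmod A (dsum M N))"
    using D.submoduleE(1)[OF s] by auto
  then show ?thesis using l zs unfolding fd_iff fin_gen_def by blast
qed

lemma reg_simps [simp]: "carrier (reg A) = carrier A" "zero (reg A) = zero A" "add (reg A) = add A"
   "smult (reg A) = mult A"
  by (simp_all add: reg_def)

lemma fd_reg: "reg A \<in> fd_modules K A"
proof -
  have l: "left_module A (reg A)"
    by (rule left_moduleI)
      (auto simp: A.ring_axioms A.a_ac A.m_assoc A.l_distr A.r_distr intro!: A.l_neg bexI[of _ "\<ominus>\<^bsub>A\<^esub> _"])
  interpret V: vspace K "kmod A (reg A)" by (rule vspace_kmod[OF l])
  have e: "(c \<odot>\<^bsub>A\<^esub> \<one>\<^bsub>A\<^esub>) \<otimes>\<^bsub>A\<^esub> x = c \<odot>\<^bsub>A\<^esub> x" if "c \<in> carrier K" "x \<in> carrier A" for c x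
    using that by (simp add: smult_mult_left)
  obtain B where B: "finite B" "B \<subseteq> carrier A"
      "\<And>x. x \<in> carrier A \<Longrightarrow> \<exists>c \<in> B \<rightarrow> carrier K. x = (\<Oplus>\<^bsub>A\<^esub>b\<in>B. c b \<odot>\<^bsub>A\<^esub> b)"
    using finite_dim by blast
  have "\<exists>c \<in> B \<rightarrow> carrier K. x = (\<Oplus>\<^bsub>kmod A (reg A)\<^esub>b\<in>B. c b \<odot>\<^bsub>kmod A (reg A)\<^esub> b)"
    if x: "x \<in> carrier A" for x
  proof -
    obtain c where c: "c \<in> B \<rightarrow> carrier K" "x = (\<Oplus>\<^bsub>A\<^esub>b\<in>B. c b \<odot>\<^bsub>A\<^esub> b)" by (rule bexE[OF B(3)[OF x]])
    have "(\<Oplus>\<^bsub>kmod A (reg A)\<^esub>b\<in>B. c b \<odot>\<^bsub>kmod A (reg A)\<^esub> b) = (\<Oplus>\<^bsub>A\<^esub>b\<in>B. (c b \<odot>\<^bsub>A\<^esub> \<one>\<^bsub>A\<^esub>) \<otimes>\<^bsub>A\<^esub> b)"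
      by (simp add: finsum_def finprod_def)
    also have "\<dots> = (\<Oplus>\<^bsub>A\<^esub>b\<in>B. c b \<odot>\<^bsub>A\<^esub> b)"
      by (rule A.finsum_cong') (use c(1) B(1,2) e in \<open>auto simp: Pi_iff subset_iff\<close>)
    finally show ?thesis using c(2) by (intro bexI[OF _ c(1)]) simp
  qed
  then have "fin_gen K (kmod A (reg A))" using B(1,2) by (auto simp: V.fin_gen_iff_finsum)
  then show ?thesis using l by (simp add: fd_iff)
qed

end

text \<open>The type \<open>'u\<close> has room for a copy of every finite-dimensional module (\<open>ex_copy\<close>).\<close>

locale fd_universe = fd_algebra K A for K :: "'k ring" and A :: "('k, 'a) module" +
  fixes e :: "'k list \<Rightarrow> 'u"
  assumes inj_e: "inj_on e (lists (carrier K))"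
begin

abbreviation FD :: "('a, 'u) module set" where "FD \<equiv> fd_modules K A"
abbreviation Proj :: "('a, 'u) module \<Rightarrow> bool" where "Proj \<equiv> projective K A"
abbreviation Hom :: "('a, 'v) module \<Rightarrow> ('a, 'w) module \<Rightarrow> ('v \<Rightarrow> 'w) set" where "Hom \<equiv> lmod_hom A"
abbreviation lm :: "('a, 'v) module \<Rightarrow> bool" where "lm \<equiv> left_module A"

lemma ex_copy:
  fixes M :: "('a, 'v) module"
  assumes "M \<in> fd_modules K A"
  obtains M' where "M' \<in> FD" "lmod_iso A M M'"
proof -
  interpret V: vspace K "kmod A M" using assms by (simp add: vspace_kmod fd_iff)
  obtain xs where xs: "set xs \<subseteq> carrier M" "lspan K (kmod A M) xs = carrier M"
    using assms(1) by (auto simp: fd_iff fin_gen_def)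
  obtain code where code: "inj_on code (carrier M)" "code ` carrier M \<subseteq> lists (carrier K)"
    using V.lspan_code[of xs] xs by auto
  have inj: "inj_on (e \<circ> code) (carrier M)"
    using code inj_e by (meson comp_inj_on inj_on_subset)
  note c = copy_module_iso[OF fdD[OF assms] inj]
  show ?thesis by (rule that[OF fd_iso[OF assms c] c(2)])
qed

text \<open>Direct sums inside the universe: \<open>E\<close> with the injections and projections of a direct sum of
  \<open>M\<close> and \<open>N\<close>. The sum \<^const>\<open>dsum\<close> lives in a product type and is used
  only up to isomorphism.\<close>

definition biprod where
  "biprod M N E i1 i2 p1 p2 \<longleftrightarrow>
     i1 \<in> Hom M E \<and> i2 \<in> Hom N E \<and> p1 \<in> Hom E M \<and> p2 \<in> Hom E N \<and>
     (\<forall>x\<in>carrier M. p1 (i1 x) = x \<and> p2 (i1 x) = \<zero>\<^bsub>N\<^esub>) \<and>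
     (\<forall>y\<in>carrier N. p2 (i2 y) = y \<and> p1 (i2 y) = \<zero>\<^bsub>M\<^esub>) \<and>
     (\<forall>z\<in>carrier E. i1 (p1 z) \<oplus>\<^bsub>E\<^esub> i2 (p2 z) = z)"

lemma biprodD:
  assumes "biprod M N E i1 i2 p1 p2"
  shows "i1 \<in> Hom M E" "i2 \<in> Hom N E" "p1 \<in> Hom E M" "p2 \<in> Hom E N"
    "\<And>x. x \<in> carrier M \<Longrightarrow> p1 (i1 x) = x" "\<And>x. x \<in> carrier M \<Longrightarrow> p2 (i1 x) = \<zero>\<^bsub>N\<^esub>"
    "\<And>y. y \<in> carrier N \<Longrightarrow> p2 (i2 y) = y" "\<And>y. y \<in> carrier N \<Longrightarrow> p1 (i2 y) = \<zero>\<^bsub>M\<^esub>"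
    "\<And>z. z \<in> carrier E \<Longrightarrow> i1 (p1 z) \<oplus>\<^bsub>E\<^esub> i2 (p2 z) = z"
  using assms by (auto simp: biprod_def)

lemma biprod_iso:
  assumes "lm M" "lm N" "lm E" "biprod M N E i1 i2 p1 p2"
  shows "lmod_iso A E (dsum M N)"
proof -
  interpret M: left_module A M by fact
  interpret N: left_module A N by fact
  interpret E: left_module A E by fact
  note b = biprodD[OF assms(4)]
  have 1: "(\<lambda>z\<in>carrier E. (p1 z, p2 z)) \<in> Hom E (dsum M N)"
    by (rule lmod_homI[OF assms(3)])
      (use b(3,4) in \<open>auto simp: hom_add[OF b(3)] hom_add[OF b(4)] hom_smult[OF b(3)] hom_smult[OF b(4)]\<close>)
  have 2: "(\<lambda>w\<in>carrier (dsum M N). i1 (fst w) \<oplus>\<^bsub>E\<^esub> i2 (snd w)) \<in> Hom (dsum M N) E"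
    by (rule lmod_homI[OF left_module_dsum[OF assms(1,2)]])
      (use b(1,2) in \<open>auto simp: hom_add[OF b(1)] hom_add[OF b(2)] hom_smult[OF b(1)] hom_smult[OF b(2)]
         E.M.a_ac E.act_r_distr\<close>)
  show ?thesis unfolding lmod_iso_def
    by (rule exI, rule exI, intro conjI, rule 1, rule 2)
      (use b in \<open>auto simp: hom_add[OF b(3)] hom_add[OF b(4)]\<close>)
qed

lemma ex_biprod:
  assumes "M \<in> FD" "N \<in> FD"
  obtains E i1 i2 p1 p2 where "E \<in> FD" "biprod M N E i1 i2 p1 p2"
proof -
  have l: "lm M" "lm N" using assms by (auto simp: fdD)
  interpret M: left_module A M by fact
  interpret N: left_module A N by fact
  obtain E where E: "E \<in> FD" "lmod_iso A (dsum M N) E" using ex_copy[OF fd_dsum[OF assms]] .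
  obtain f g where f: "f \<in> Hom (dsum M N) E" "g \<in> Hom E (dsum M N)"
     "\<And>w. w \<in> carrier (dsum M N) \<Longrightarrow> g (f w) = w" "\<And>z. z \<in> carrier E \<Longrightarrow> f (g z) = z"
    using E(2) by (auto simp: lmod_iso_def)
  have lE: "lm E" using E by (simp add: fdD)
  define i1 where "i1 = (\<lambda>x\<in>carrier M. f (x, \<zero>\<^bsub>N\<^esub>))"
  define i2 where "i2 = (\<lambda>y\<in>carrier N. f (\<zero>\<^bsub>M\<^esub>, y))"
  define p1 where "p1 = (\<lambda>z\<in>carrier E. fst (g z))"
  define p2 where "p2 = (\<lambda>z\<in>carrier E. snd (g z))"
  have gm: "fst (g z) \<in> carrier M" "snd (g z) \<in> carrier N" if "z \<in> carrier E" for z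
    using hom_closed[OF f(2) that] by auto
  have g': "g z = (fst (g z), snd (g z))" for z by simp
  have ga: "fst (g (x \<oplus>\<^bsub>E\<^esub> y)) = fst (g x) \<oplus>\<^bsub>M\<^esub> fst (g y)" "snd (g (x \<oplus>\<^bsub>E\<^esub> y)) = snd (g x) \<oplus>\<^bsub>N\<^esub> snd (g y)"
    if "x \<in> carrier E" "y \<in> carrier E" for x y
    using hom_add[OF f(2) that] g'[of x] g'[of y] by (metis dsum_simps(3) fst_conv, metis dsum_simps(3) snd_conv)
  have gs: "fst (g (a \<odot>\<^bsub>E\<^esub> y)) = a \<odot>\<^bsub>M\<^esub> fst (g y)" "snd (g (a \<odot>\<^bsub>E\<^esub> y)) = a \<odot>\<^bsub>N\<^esub> snd (g y)"
    if "a \<in> carrier A" "y \<in> carrier E" for a y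
    using hom_smult[OF f(2) that] g'[of y] by (metis dsum_simps(4) fst_conv, metis dsum_simps(4) snd_conv)
  have "i1 \<in> Hom M E" unfolding i1_def
    by (rule lmod_homI[OF l(1)]) (use f(1) in \<open>auto simp: hom_add[OF f(1), symmetric] hom_smult[OF f(1), symmetric]\<close>)
  moreover have "i2 \<in> Hom N E" unfolding i2_def
    by (rule lmod_homI[OF l(2)]) (use f(1) in \<open>auto simp: hom_add[OF f(1), symmetric] hom_smult[OF f(1), symmetric]\<close>)
  moreover have "p1 \<in> Hom E M" unfolding p1_def
    by (rule lmod_homI[OF lE]) (auto simp: ga gs gm)
  moreover have "p2 \<in> Hom E N" unfolding p2_def
    by (rule lmod_homI[OF lE]) (auto simp: ga gs gm)
  moreover have "i1 (p1 z) \<oplus>\<^bsub>E\<^esub> i2 (p2 z) = z" if z: "z \<in> carrier E" for z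
  proof -
    have "f (fst (g z), \<zero>\<^bsub>N\<^esub>) \<oplus>\<^bsub>E\<^esub> f (\<zero>\<^bsub>M\<^esub>, snd (g z)) = f (fst (g z), snd (g z))"
      using gm[OF z] by (subst hom_add[OF f(1), symmetric]) auto
    then show ?thesis using z gm[OF z] f(4)[OF z] by (simp add: i1_def i2_def p1_def p2_def)
  qed
  ultimately have "biprod M N E i1 i2 p1 p2"
    unfolding biprod_def using f(1,3) by (auto simp: i1_def i2_def p1_def p2_def)
  then show ?thesis using that E(1) by blast
qed


lemma hom_copair:
  assumes "lm M" "lm N" "lm E" "lm L" "biprod M N E i1 i2 p1 p2" "f \<in> Hom M L" "g \<in> Hom N L"
  shows "(\<lambda>z\<in>carrier E. f (p1 z) \<oplus>\<^bsub>L\<^esub> g (p2 z)) \<in> Hom E L"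
    and "x \<in> carrier M \<Longrightarrow> f (p1 (i1 x)) \<oplus>\<^bsub>L\<^esub> g (p2 (i1 x)) = f x"
    and "y \<in> carrier N \<Longrightarrow> f (p1 (i2 y)) \<oplus>\<^bsub>L\<^esub> g (p2 (i2 y)) = g y"
proof -
  interpret L: left_module A L by fact
  note b = biprodD[OF assms(5)]
  have eq: "(\<lambda>z\<in>carrier E. f (p1 z) \<oplus>\<^bsub>L\<^esub> g (p2 z))
      = (\<lambda>z\<in>carrier E. compose (carrier E) f p1 z \<oplus>\<^bsub>L\<^esub> compose (carrier E) g p2 z)"
    by (auto simp: compose_pt)
  show "(\<lambda>z\<in>carrier E. f (p1 z) \<oplus>\<^bsub>L\<^esub> g (p2 z)) \<in> Hom E L"
    unfolding eq by (intro hom_sum assms hom_compose[OF assms(3) b(3) assms(6)] hom_compose[OF assms(3) b(4) assms(7)])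
  show "x \<in> carrier M \<Longrightarrow> f (p1 (i1 x)) \<oplus>\<^bsub>L\<^esub> g (p2 (i1 x)) = f x"
    using b(5,6)[of x] hom_zero[OF assms(2,4,7)] hom_closed[OF assms(6)] by simp
  show "y \<in> carrier N \<Longrightarrow> f (p1 (i2 y)) \<oplus>\<^bsub>L\<^esub> g (p2 (i2 y)) = g y"
    using b(7,8)[of y] hom_zero[OF assms(1,4,6)] hom_closed[OF assms(7)] by simp
qed

lemma hom_pair:
  assumes "lm M" "lm N" "lm E" "lm L" "biprod M N E i1 i2 p1 p2" "f \<in> Hom L M" "g \<in> Hom L N"
  shows "(\<lambda>x\<in>carrier L. i1 (f x) \<oplus>\<^bsub>E\<^esub> i2 (g x)) \<in> Hom L E"
    and "x \<in> carrier L \<Longrightarrow> p1 (i1 (f x) \<oplus>\<^bsub>E\<^esub> i2 (g x)) = f x"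
    and "x \<in> carrier L \<Longrightarrow> p2 (i1 (f x) \<oplus>\<^bsub>E\<^esub> i2 (g x)) = g x"
proof -
  interpret E: left_module A E by fact
  interpret M: left_module A M by fact
  interpret N: left_module A N by fact
  note b = biprodD[OF assms(5)]
  have eq: "(\<lambda>x\<in>carrier L. i1 (f x) \<oplus>\<^bsub>E\<^esub> i2 (g x))
      = (\<lambda>x\<in>carrier L. compose (carrier L) i1 f x \<oplus>\<^bsub>E\<^esub> compose (carrier L) i2 g x)"
    by (auto simp: compose_pt)
  show "(\<lambda>x\<in>carrier L. i1 (f x) \<oplus>\<^bsub>E\<^esub> i2 (g x)) \<in> Hom L E"
    unfolding eq by (intro hom_sum assms hom_compose[OF assms(4) assms(6) b(1)] hom_compose[OF assms(4) assms(7) b(2)])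
  show "x \<in> carrier L \<Longrightarrow> p1 (i1 (f x) \<oplus>\<^bsub>E\<^esub> i2 (g x)) = f x"
    using assms(6,7) b(1,2) b(5)[of "f x"] b(8)[of "g x"] by (simp add: hom_add[OF b(3)])
  show "x \<in> carrier L \<Longrightarrow> p2 (i1 (f x) \<oplus>\<^bsub>E\<^esub> i2 (g x)) = g x"
    using assms(6,7) b(1,2) b(6)[of "f x"] b(7)[of "g x"] by (simp add: hom_add[OF b(4)])
qed

section \<open>Projective modules and projective covers\<close>

lemma proj_FD: "Proj P \<Longrightarrow> P \<in> FD"
  by (simp add: projective_def)

lemma proj_lm: "Proj P \<Longrightarrow> lm P"
  by (simp add: projective_def fdD)

lemma proj_lift:
  assumes "Proj P" "M \<in> FD" "N \<in> FD" "g \<in> Hom M N" "f \<in> Hom P N" "g ` carrier M = carrier N"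
  obtains h where "h \<in> Hom P M" "\<forall>x\<in>carrier P. g (h x) = f x"
proof -
  obtain h where h: "h \<in> Hom P M" "compose (carrier P) g h = f"
    using assms unfolding projective_def by blast
  show ?thesis by (rule that[OF h(1)]) (use h(2) in \<open>auto simp: compose_pt\<close>)
qed

lemma projI:
  assumes "P \<in> FD"
    and "\<And>M N g f. M \<in> FD \<Longrightarrow> N \<in> FD \<Longrightarrow> g \<in> Hom M N \<Longrightarrow> f \<in> Hom P N \<Longrightarrow> g ` carrier M = carrier N \<Longrightarrow>
      \<exists>h\<in>Hom P M. \<forall>x\<in>carrier P. g (h x) = f x"
  shows "Proj P"
  unfolding projective_def
proof (intro conjI assms(1) ballI impI)
  fix M N :: "('a, 'u) module" and g f
  assume a: "M \<in> FD" "N \<in> FD" "g \<in> Hom M N" "f \<in> Hom P N" "g ` carrier M = carrier N"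
  obtain h where h: "h \<in> Hom P M" "\<And>x. x \<in> carrier P \<Longrightarrow> g (h x) = f x" using assms(2)[OF a] by blast
  have "compose (carrier P) g h = f"
    by (rule hom_ext[OF hom_compose[OF _ h(1) a(3)] a(4)]) (use assms(1) h(2) in \<open>auto simp: fdD compose_pt\<close>)
  then show "\<exists>h\<in>Hom P M. compose (carrier P) g h = f" using h(1) by blast
qed

lemma proj_retract:
  assumes "Proj P" "L \<in> FD" "a \<in> Hom L P" "b \<in> Hom P L" "\<And>x. x \<in> carrier L \<Longrightarrow> b (a x) = x"
  shows "Proj L"
proof (rule projI[OF assms(2)])
  fix M N :: "('a, 'u) module" and g f
  assume g: "M \<in> FD" "N \<in> FD" "g \<in> Hom M N" "f \<in> Hom L N" "g ` carrier M = carrier N"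
  obtain h where h: "h \<in> Hom P M" "\<forall>x\<in>carrier P. g (h x) = compose (carrier P) f b x"
    using proj_lift[OF assms(1) g(1-3) hom_compose[OF proj_lm[OF assms(1)] assms(4) g(4)] g(5)] .
  show "\<exists>h\<in>Hom L M. \<forall>x\<in>carrier L. g (h x) = f x"
    by (rule bexI[OF _ hom_compose[OF fdD[OF assms(2)] assms(3) h(1)]])
      (use h(2) assms(3,5) in \<open>auto simp: compose_pt\<close>)
qed

lemma proj_sum:
  assumes "Proj P" "Proj Q" "E \<in> FD" "biprod P Q E i1 i2 p1 p2"
  shows "Proj E"
proof (rule projI[OF assms(3)])
  fix M N :: "('a, 'u) module" and g f
  assume g: "M \<in> FD" "N \<in> FD" "g \<in> Hom M N" "f \<in> Hom E N" "g ` carrier M = carrier N"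
  note b = biprodD[OF assms(4)]
  note l = proj_lm[OF assms(1)] proj_lm[OF assms(2)] fdD[OF assms(3)] fdD[OF g(1)]
  interpret P: left_module A P by fact
  interpret E: left_module A E by fact
  interpret M: left_module A M by fact
  obtain h1 where h1: "h1 \<in> Hom P M" "\<forall>x\<in>carrier P. g (h1 x) = compose (carrier P) f i1 x"
    using proj_lift[OF assms(1) g(1-3) hom_compose[OF l(1) b(1) g(4)] g(5)] .
  obtain h2 where h2: "h2 \<in> Hom Q M" "\<forall>x\<in>carrier Q. g (h2 x) = compose (carrier Q) f i2 x"
    using proj_lift[OF assms(2) g(1-3) hom_compose[OF l(2) b(2) g(4)] g(5)] .
  have "g (h1 (p1 z) \<oplus>\<^bsub>M\<^esub> h2 (p2 z)) = f z" if z: "z \<in> carrier E" for z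
  proof -
    have "g (h1 (p1 z) \<oplus>\<^bsub>M\<^esub> h2 (p2 z)) = f (i1 (p1 z)) \<oplus>\<^bsub>N\<^esub> f (i2 (p2 z))"
      using z b(1-4) h1 h2 g(3) by (simp add: hom_add[OF g(3)] compose_pt)
    also have "\<dots> = f z" using z b(1-4) b(9)[OF z] by (simp add: hom_add[OF g(4), symmetric])
    finally show ?thesis .
  qed
  then show "\<exists>h\<in>Hom E M. \<forall>x\<in>carrier E. g (h x) = f x"
    by (intro bexI[OF _ hom_copair(1)[OF l assms(4) h1(1) h2(1)]]) auto
qed

text \<open>A copy of the regular module: free of rank one on the generator \<open>r\<close>.\<close>

lemma ex_free:
  obtains R r where "Proj R" "r \<in> carrier R" "\<And>M m. lm M \<Longrightarrow> m \<in> carrier M \<Longrightarrow> \<exists>h\<in>Hom R (M :: ('a, 'u) module). h r = m"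
proof -
  obtain R where R: "R \<in> FD" "lmod_iso A (reg A) R" using ex_copy[OF fd_reg] .
  then obtain \<phi> \<psi> where f: "\<phi> \<in> Hom (reg A) R" "\<psi> \<in> Hom R (reg A)"
     "\<And>x. x \<in> carrier A \<Longrightarrow> \<psi> (\<phi> x) = x" "\<And>y. y \<in> carrier R \<Longrightarrow> \<phi> (\<psi> y) = y"
    by (auto simp: lmod_iso_def)
  define r where "r = \<phi> \<one>\<^bsub>A\<^esub>"
  have r: "r \<in> carrier R" using f(1) by (simp add: r_def hom_closed[OF f(1)])
  have c: "\<psi> x \<in> carrier A" if "x \<in> carrier R" for x using hom_closed[OF f(2) that] by simp
  have gen: "x = \<psi> x \<odot>\<^bsub>R\<^esub> r" if "x \<in> carrier R" for x
    using hom_smult[OF f(1), of "\<psi> x" "\<one>\<^bsub>A\<^esub>"] c[OF that] f(4)[OF that] by (simp add: r_def)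
  have ex: "\<exists>h\<in>Hom R M. h r = m" if M: "lm M" "m \<in> carrier M" for M :: "('a, 'u) module" and m
  proof -
    interpret M: left_module A M by fact
    have "(\<lambda>x\<in>carrier R. \<psi> x \<odot>\<^bsub>M\<^esub> m) \<in> Hom R M"
      by (rule lmod_homI[OF fdD[OF R(1)]])
        (use M c in \<open>auto simp: hom_add[OF f(2)] hom_smult[OF f(2)] M.act_closed M.act_l_distr M.act_assoc\<close>)
    moreover have "\<psi> r \<odot>\<^bsub>M\<^esub> m = m" using M f(3) by (simp add: r_def M.act_one)
    ultimately show ?thesis using r by (intro bexI) auto
  qed
  have "Proj R"
  proof (rule projI[OF R(1)])
    fix M N :: "('a, 'u) module" and g f
    assume g: "M \<in> FD" "N \<in> FD" "g \<in> Hom M N" "f \<in> Hom R N" "g ` carrier M = carrier N"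
    have "f r \<in> g ` carrier M" using g(4,5) r by simp
    then obtain m where m: "m \<in> carrier M" "f r = g m" by blast
    then obtain h where h: "h \<in> Hom R M" "h r = m" using ex g(1) fdD by blast
    have "g (h x) = f x" if x: "x \<in> carrier R" for x
    proof -
      have "g (h (\<psi> x \<odot>\<^bsub>R\<^esub> r)) = f (\<psi> x \<odot>\<^bsub>R\<^esub> r)"
        using x c r h m by (simp add: hom_smult[OF h(1)] hom_smult[OF g(3)] hom_smult[OF g(4)])
      then show ?thesis using gen[OF x] by simp
    qed
    then show "\<exists>h\<in>Hom R M. \<forall>x\<in>carrier R. g (h x) = f x" using h(1) by blast
  qed
  then show ?thesis using that r ex by blast
qed

lemma enough_proj:
  assumes "M \<in> FD"
  obtains P p where "Proj P" "p \<in> Hom P M" "p ` carrier P = carrier M"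
proof -
  have lM: "lm M" using assms by (simp add: fdD)
  interpret V: vspace K "kmod A M" by (rule vspace_kmod[OF lM])
  interpret M: left_module A M by (rule lM)
  obtain R r where R: "Proj R" "r \<in> carrier R"
      "\<And>m. m \<in> carrier M \<Longrightarrow> \<exists>h\<in>Hom R M. h r = m"
    using ex_free lM by metis
  have lR: "lm R" using R by (simp add: proj_lm)
  have *: "set xs \<subseteq> carrier M \<Longrightarrow> \<exists>P p. Proj P \<and> p \<in> Hom P M \<and> set xs \<subseteq> p ` carrier P" for xs
  proof (induction xs)
    case Nil
    show ?case using R(1) hom_zeromap[OF lR lM] by auto
  next
    case (Cons x xs)
    then obtain P p where P: "Proj P" "p \<in> Hom P M" "set xs \<subseteq> p ` carrier P" and x: "x \<in> carrier M" by auto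
    obtain h where h: "h \<in> Hom R M" "h r = x" using R(3)[OF x] by blast
    obtain E i1 i2 p1 p2 where E: "E \<in> FD" "biprod P R E i1 i2 p1 p2"
      using ex_biprod[OF proj_FD[OF P(1)] proj_FD[OF R(1)]] .
    note c = hom_copair[OF proj_lm[OF P(1)] lR fdD[OF E(1)] lM E(2) P(2) h(1)]
    let ?q = "\<lambda>z\<in>carrier E. p (p1 z) \<oplus>\<^bsub>M\<^esub> h (p2 z)"
    note b = biprodD[OF E(2)]
    have "x = ?q (i2 r)" using c(3)[OF R(2)] h R(2) b(2) by simp
    then have "x \<in> ?q ` carrier E" by (rule image_eqI[OF _ hom_closed[OF b(2) R(2)]])
    moreover have "t \<in> ?q ` carrier E" if t: "t \<in> set xs" for t
    proof -
      obtain u where u: "u \<in> carrier P" "t = p u" using P(3) t by auto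
      then have "t = ?q (i1 u)" using c(2)[OF u(1)] b(1) by simp
      then show ?thesis by (rule image_eqI[OF _ hom_closed[OF b(1) u(1)]])
    qed
    ultimately have "set (x # xs) \<subseteq> ?q ` carrier E" by (simp only: list.set insert_subset) blast
    then show ?case using c(1) proj_sum[OF P(1) R(1) E] by blast
  qed
  obtain xs where xs: "set xs \<subseteq> carrier M" "lspan K (kmod A M) xs = carrier M"
    using assms(1) by (auto simp: fd_iff fin_gen_def)
  obtain P p where P: "Proj P" "p \<in> Hom P M" "set xs \<subseteq> p ` carrier P" using *[OF xs(1)] by blast
  have "submodule (p ` carrier P) K (kmod A M)"
    by (rule submodule_kmod[OF lM image_submodule[OF proj_lm[OF P(1)] lM P(2)]])
  from V.lspan_least[OF this P(3)] have "carrier M \<subseteq> p ` carrier P" using xs(2) by simp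
  moreover have "p ` carrier P \<subseteq> carrier M" using P(2) by auto
  ultimately show ?thesis using that P by blast
qed

lemma submodule_trans:
  fixes M :: "('a, 'v) module"
  assumes "lm M" "submodule N A M" "submodule S A (M\<lparr>carrier := N\<rparr>)"
  shows "submodule S A M"
  using assms submodule_subset[OF assms(2)]
  by (auto simp: submodule_iff[OF assms(1)] submodule_iff[OF left_module_sub[OF assms(1,2)]])

lemma vdim_sub_less:
  fixes M :: "('a, 'v) module"
  assumes "M \<in> fd_modules K A" "submodule N A M" "N \<noteq> carrier M"
  shows "vdim K (kmod A (M\<lparr>carrier := N\<rparr>)) < vdim K (kmod A M)"
proof -
  interpret V: vspace K "kmod A M" using assms by (simp add: vspace_kmod fd_iff)
  show ?thesis
    using V.fin_gen_sub(2)[OF _ submodule_kmod[OF _ assms(2)]] assms by (simp add: fd_iff kmod_sub)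
qed

lemma surj_endo_iso:
  fixes M :: "('a, 'v) module"
  assumes "M \<in> fd_modules K A" "f \<in> Hom M M" "f ` carrier M = carrier M"
  obtains g where "g \<in> Hom M M" "\<And>x. x \<in> carrier M \<Longrightarrow> g (f x) = x"
proof -
  have lM: "lm M" using assms by (simp add: fdD)
  interpret V: vspace K "kmod A M" by (rule vspace_kmod[OF lM])
  have "inj_on f (carrier (kmod A M))"
    by (rule V.surj_imp_inj) (use assms in \<open>auto simp: fd_iff hom_add hom_smult\<close>)
  then have bij: "bij_betw f (carrier M) (carrier M)" using assms(3) by (simp add: bij_betw_def)
  show ?thesis by (rule bij_hom_inverse[OF lM lM assms(2) bij]) (use that in blast)
qed

text \<open>A surjection onto \<open>M\<close> from a projective of least dimension is a projective cover.\<close>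

lemma ex_proj_cover:
  assumes M: "M \<in> FD"
  shows "\<exists>P p. is_proj_cover K A M P p"
proof -
  have lM: "lm M" using M by (simp add: fdD)
  define D where "D n \<longleftrightarrow> (\<exists>P p. Proj P \<and> p \<in> Hom P M \<and> p ` carrier P = carrier M \<and> vdim K (kmod A P) = n)" for n
  have "\<exists>n. D n" using enough_proj[OF M] unfolding D_def by metis
  then have "D (LEAST n. D n)" by (rule LeastI_ex)
  then obtain P p where P: "Proj P" and p: "p \<in> Hom P M" "p ` carrier P = carrier M"
    and dP: "vdim K (kmod A P) = (LEAST n. D n)" unfolding D_def by blast
  have min: "vdim K (kmod A P) \<le> vdim K (kmod A P')"
    if "Proj P'" "p' \<in> Hom P' M" "p' ` carrier P' = carrier M" for P' p'
    unfolding dP by (rule Least_le) (use that in \<open>auto simp: D_def\<close>)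
  have FP: "P \<in> FD" and lP: "lm P" using P by (auto simp: proj_FD proj_lm)
  interpret P: left_module A P by (rule lP)
  interpret M: left_module A M by (rule lM)
  have "N = carrier P" if N: "submodule N A P" "N <+>\<^bsub>P\<^esub> a_kernel P M p = carrier P" for N
  proof (rule ccontr)
    assume ne: "N \<noteq> carrier P"
    have Nc: "N \<subseteq> carrier P" by (rule submodule_subset[OF N(1)])
    have pN: "p ` N = carrier M"
    proof (intro equalityI subsetI)
      fix y assume "y \<in> carrier M"
      then obtain x where x: "x \<in> carrier P" "y = p x" using p(2) by auto
      then obtain n k where "n \<in> N" "k \<in> a_kernel P M p" "x = n \<oplus>\<^bsub>P\<^esub> k"
        using N(2) unfolding set_add_def' by blast
      then have "y = p n" "n \<in> N" using x Nc p(1) by (auto simp: a_kernel_eq hom_add[OF p(1)] subset_iff)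
      then show "y \<in> p ` N" by simp
    qed (use p Nc in auto)
    \<comment> \<open>A minimal submodule \<open>S\<close> of \<open>N\<close> that still maps onto \<open>M\<close> is a retract of \<open>P\<close>: lift \<open>p\<close> to
      \<open>h\<close> from \<open>P\<close> to \<open>S\<close>; then \<open>h S\<close> maps onto \<open>M\<close> too, so \<open>h S = S\<close> and \<open>h\<close> is bijective on \<open>S\<close>.\<close>
    define D' where "D' n \<longleftrightarrow> (\<exists>S. submodule S A P \<and> S \<subseteq> N \<and> p ` S = carrier M \<and>
       vdim K (kmod A (P\<lparr>carrier := S\<rparr>)) = n)" for n
    have "\<exists>n. D' n" using N(1) pN unfolding D'_def by blast
    then have "D' (LEAST n. D' n)" by (rule LeastI_ex)
    then obtain S where S: "submodule S A P" "S \<subseteq> N" "p ` S = carrier M"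
      and dS: "vdim K (kmod A (P\<lparr>carrier := S\<rparr>)) = (LEAST n. D' n)" unfolding D'_def by blast
    let ?S = "P\<lparr>carrier := S\<rparr>"
    have FS: "?S \<in> FD" by (rule fd_sub[OF FP S(1)])
    have Sc: "S \<subseteq> carrier P" by (rule submodule_subset[OF S(1)])
    have pS: "restrict p S \<in> Hom ?S M" by (rule hom_restrict[OF lP S(1) p(1)])
    obtain h where h: "h \<in> Hom P ?S" "\<forall>x\<in>carrier P. restrict p S (h x) = p x"
    proof (rule proj_lift[OF P FS M pS p(1)])
      show "restrict p S ` carrier ?S = carrier M" using S(3) by simp
    qed blast
    have hS: "h x \<in> S" if "x \<in> carrier P" for x using hom_closed[OF h(1) that] by simp
    have iS: "(\<lambda>x\<in>S. x) \<in> Hom ?S P" by (rule hom_incl[OF lP S(1)])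
    let ?h = "compose S h (\<lambda>x\<in>S. x)"
    have h': "?h \<in> Hom ?S ?S" using hom_compose[OF fdD[OF FS] iS h(1)] by simp
    have im: "submodule (?h ` S) A ?S" using image_submodule[OF fdD[OF FS] fdD[OF FS] h'] by simp
    have imP: "submodule (?h ` S) A P" by (rule submodule_trans[OF lP S(1) im])
    have sub: "?h ` S \<subseteq> S" using submodule_subset[OF im] by simp
    have "p (?h x) = p x" if "x \<in> S" for x
      using bspec[OF h(2), of x] hS[of x] that Sc by (auto simp: compose_def subset_iff)
    then have "p ` ?h ` S = p ` S" by (simp add: image_image cong: image_cong)
    then have "D' (vdim K (kmod A (P\<lparr>carrier := ?h ` S\<rparr>)))"
      unfolding D'_def using imP sub S by (intro exI[of _ "?h ` S"]) auto
    then have "vdim K (kmod A ?S) \<le> vdim K (kmod A (P\<lparr>carrier := ?h ` S\<rparr>))"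
      unfolding dS by (rule Least_le)
    then have "?h ` carrier ?S = carrier ?S"
      using vdim_sub_less[OF FS im] by auto
    then obtain g where g: "g \<in> Hom ?S ?S" "\<And>x. x \<in> carrier ?S \<Longrightarrow> g (?h x) = x"
      using surj_endo_iso[OF FS h'] by metis
    have "Proj ?S"
      by (rule proj_retract[OF P FS iS hom_compose[OF lP h(1) g(1)]])
        (use g(2) Sc in \<open>auto simp: compose_def subset_iff\<close>)
    then have "vdim K (kmod A P) \<le> vdim K (kmod A ?S)"
      by (rule min[OF _ pS]) (use S(3) in simp)
    moreover have "vdim K (kmod A ?S) < vdim K (kmod A P)"
      by (rule vdim_sub_less[OF FP S(1)]) (use S(2) Nc ne in auto)
    ultimately show False by simp
  qed
  then show ?thesis unfolding is_proj_cover_def using P p by blast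
qed

abbreviation PC :: "('a, 'u) module \<Rightarrow> ('a, 'u) module" where "PC \<equiv> cover_mod K A"
abbreviation pc :: "('a, 'u) module \<Rightarrow> 'u \<Rightarrow> 'u" where "pc \<equiv> cover_map K A"
abbreviation Syz :: "('a, 'u) module \<Rightarrow> ('a, 'u) module" where "Syz \<equiv> syz K A"

lemma proj_cover:
  assumes "M \<in> FD"
  shows "Proj (PC M)" "pc M \<in> Hom (PC M) M" "pc M ` carrier (PC M) = carrier M"
proof -
  have "\<exists>z. case z of (P, p) \<Rightarrow> is_proj_cover K A M P p" using ex_proj_cover[OF assms] by auto
  from someI_ex[OF this] have "is_proj_cover K A M (PC M) (pc M)"
    unfolding proj_cover_def split_def .
  then show "Proj (PC M)" "pc M \<in> Hom (PC M) M" "pc M ` carrier (PC M) = carrier M"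
    by (auto simp: is_proj_cover_def)
qed

lemma syz_carrier: "carrier (Syz M) = {x \<in> carrier (PC M). pc M x = \<zero>\<^bsub>M\<^esub>}"
  by (simp add: syz_def a_kernel_eq)

lemma syz_submodule:
  assumes "M \<in> FD"
  shows "submodule (carrier (Syz M)) A (PC M)" "Syz M = (PC M)\<lparr>carrier := carrier (Syz M)\<rparr>"
  using kernel_submodule[OF proj_lm[OF proj_cover(1)[OF assms]] fdD[OF assms] proj_cover(2)[OF assms]]
  by (simp_all add: syz_def)

lemma syz_FD: "M \<in> FD \<Longrightarrow> Syz M \<in> FD"
  using fd_sub[OF proj_FD[OF proj_cover(1)] syz_submodule(1)] syz_submodule(2) by metis

end

section \<open>Calculus of stable equality\<close>

context fd_universe
begin

abbreviation st :: "('a, 'u) module \<Rightarrow> ('a, 'u) module \<Rightarrow> ('u \<Rightarrow> 'u) \<Rightarrow> ('u \<Rightarrow> 'u) \<Rightarrow> bool" where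
  "st M N f g \<equiv> (f, g) \<in> stab_rel K A M N"

text \<open>Composition, identity, sum and zero for homomorphisms, as extensional functions. In
  \<open>cc L g f\<close> the module \<open>L\<close> is the domain of \<open>f\<close>.\<close>

definition cc :: "('a, 'u) module \<Rightarrow> ('u \<Rightarrow> 'u) \<Rightarrow> ('u \<Rightarrow> 'u) \<Rightarrow> 'u \<Rightarrow> 'u" where
  "cc L g f = compose (carrier L) g f"

definition hid :: "('a, 'u) module \<Rightarrow> 'u \<Rightarrow> 'u" where "hid M = (\<lambda>x\<in>carrier M. x)"

definition hadd :: "('a, 'u) module \<Rightarrow> ('a, 'u) module \<Rightarrow> ('u \<Rightarrow> 'u) \<Rightarrow> ('u \<Rightarrow> 'u) \<Rightarrow> 'u \<Rightarrow> 'u" where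
  "hadd M N f g = (\<lambda>x\<in>carrier M. f x \<oplus>\<^bsub>N\<^esub> g x)"

definition hzero :: "('a, 'u) module \<Rightarrow> ('a, 'u) module \<Rightarrow> 'u \<Rightarrow> 'u" where
  "hzero M N = (\<lambda>x\<in>carrier M. \<zero>\<^bsub>N\<^esub>)"

lemma h_pt [simp]:
  "x \<in> carrier M \<Longrightarrow> cc M g f x = g (f x)"
  "x \<in> carrier M \<Longrightarrow> hid M x = x"
  "x \<in> carrier M \<Longrightarrow> hadd M N f g x = f x \<oplus>\<^bsub>N\<^esub> g x"
  "x \<in> carrier M \<Longrightarrow> hzero M N x = \<zero>\<^bsub>N\<^esub>"
  by (simp_all add: cc_def hid_def hadd_def hzero_def compose_def)

lemma h_ext [simp]:
  "cc M g f \<in> extensional (carrier M)" "hid M \<in> extensional (carrier M)"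
  "hadd M N f g \<in> extensional (carrier M)" "hzero M N \<in> extensional (carrier M)"
  by (simp_all add: cc_def hid_def hadd_def hzero_def compose_def)

lemma cc_hom: "L \<in> FD \<Longrightarrow> f \<in> Hom L M \<Longrightarrow> g \<in> Hom M N \<Longrightarrow> cc L g f \<in> Hom L N"
  unfolding cc_def by (rule hom_compose) (simp add: fdD)

lemma hid_hom: "M \<in> FD \<Longrightarrow> hid M \<in> Hom M M"
  unfolding hid_def by (rule hom_id) (simp add: fdD)

lemma hadd_hom: "M \<in> FD \<Longrightarrow> N \<in> FD \<Longrightarrow> f \<in> Hom M N \<Longrightarrow> g \<in> Hom M N \<Longrightarrow> hadd M N f g \<in> Hom M N"
  unfolding hadd_def by (rule hom_sum) (simp_all add: fdD)

lemma hzero_hom: "M \<in> FD \<Longrightarrow> N \<in> FD \<Longrightarrow> hzero M N \<in> Hom M N"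
  unfolding hzero_def by (rule hom_zeromap) (simp_all add: fdD)

lemma cc_assoc:
  "f \<in> Hom L M \<Longrightarrow> cc L h (cc L g f) = cc L (cc M h g) f"
  by (rule extensionalityI[OF h_ext(1) h_ext(1)]) simp

lemma cc_hid: "f \<in> Hom M N \<Longrightarrow> cc M (hid N) f = f" "f \<in> Hom M N \<Longrightarrow> cc M f (hid M) = f"
  by (rule extensionalityI[of _ "carrier M"]; simp add: hom_extensional)+

text \<open>\<open>fac M N u\<close>: on \<open>M\<close> the function \<open>u\<close> agrees with a homomorphism to \<open>N\<close> that factors through a
  projective. Stable equality \<open>st M N f g\<close> is \<open>fac\<close> of the difference; only the values of \<open>u\<close> on
  \<open>M\<close> matter, so that differences need not be made extensional.\<close>

definition fac :: "('a, 'u) module \<Rightarrow> ('a, 'u) module \<Rightarrow> ('u \<Rightarrow> 'u) \<Rightarrow> bool" where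
  "fac M N u \<longleftrightarrow> (\<exists>P. Proj P \<and> (\<exists>a\<in>Hom M P. \<exists>b\<in>Hom P N. \<forall>x\<in>carrier M. u x = b (a x)))"

lemma st_iff: "st M N f g \<longleftrightarrow> f \<in> Hom M N \<and> g \<in> Hom M N \<and> fac M N (\<lambda>x. f x \<ominus>\<^bsub>N\<^esub> g x)"
  by (simp add: stab_rel_def fac_def)

lemma fac_cong: "fac M N u \<Longrightarrow> (\<And>x. x \<in> carrier M \<Longrightarrow> u x = v x) \<Longrightarrow> fac M N v"
  by (simp add: fac_def)

lemma facI: "Proj P \<Longrightarrow> a \<in> Hom M P \<Longrightarrow> b \<in> Hom P N \<Longrightarrow> (\<And>x. x \<in> carrier M \<Longrightarrow> u x = b (a x)) \<Longrightarrow> fac M N u"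
  by (auto simp: fac_def)

lemma fac_zero:
  assumes "M \<in> FD" "N \<in> FD" shows "fac M N (\<lambda>x. \<zero>\<^bsub>N\<^esub>)"
proof -
  obtain P where P: "Proj P" using enough_proj[OF assms(1)] by blast
  show ?thesis
    by (rule facI[OF P hzero_hom[OF assms(1) proj_FD[OF P]] hzero_hom[OF proj_FD[OF P] assms(2)]])
      (use hom_closed[OF hzero_hom[OF assms(1) proj_FD[OF P]]] in auto)
qed

lemma fac_add:
  assumes "M \<in> FD" "N \<in> FD" "fac M N u" "fac M N v"
  shows "fac M N (\<lambda>x. u x \<oplus>\<^bsub>N\<^esub> v x)"
proof -
  obtain P a b where P: "Proj P" "a \<in> Hom M P" "b \<in> Hom P N" "\<forall>x\<in>carrier M. u x = b (a x)"
    using assms(3) by (auto simp: fac_def)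
  obtain Q c d where Q: "Proj Q" "c \<in> Hom M Q" "d \<in> Hom Q N" "\<forall>x\<in>carrier M. v x = d (c x)"
    using assms(4) by (auto simp: fac_def)
  obtain E i1 i2 p1 p2 where E: "E \<in> FD" "biprod P Q E i1 i2 p1 p2"
    using ex_biprod[OF proj_FD[OF P(1)] proj_FD[OF Q(1)]] .
  note l = proj_lm[OF P(1)] proj_lm[OF Q(1)] fdD[OF E(1)]
  note pr = hom_pair[OF l fdD[OF assms(1)] E(2) P(2) Q(2)]
  note co = hom_copair[OF l fdD[OF assms(2)] E(2) P(3) Q(3)]
  show ?thesis
    by (rule facI[OF proj_sum[OF P(1) Q(1) E] pr(1) co(1)])
      (use hom_closed[OF pr(1)] P(4) Q(4) in \<open>auto simp: pr(2,3)\<close>)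
qed

lemma fac_neg:
  assumes "M \<in> FD" "N \<in> FD" "fac M N u" shows "fac M N (\<lambda>x. \<ominus>\<^bsub>N\<^esub> u x)"
proof -
  obtain P a b where P: "Proj P" "a \<in> Hom M P" "b \<in> Hom P N" "\<forall>x\<in>carrier M. u x = b (a x)"
    using assms(3) by (auto simp: fac_def)
  show ?thesis
    by (rule facI[OF P(1,2) hom_negmap[OF proj_lm[OF P(1)] fdD[OF assms(2)] P(3)]]) (use P in auto)
qed

lemma fac_comp_left:
  assumes "fac M N u" "g \<in> Hom N L" "N \<in> FD" shows "fac M L (\<lambda>x. g (u x))"
proof -
  obtain P a b where P: "Proj P" "a \<in> Hom M P" "b \<in> Hom P N" "\<forall>x\<in>carrier M. u x = b (a x)"
    using assms(1) by (auto simp: fac_def)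
  show ?thesis
    by (rule facI[OF P(1,2) cc_hom[OF proj_FD[OF P(1)] P(3) assms(2)]]) (use P in auto)
qed

lemma fac_comp_right:
  assumes "fac M N u" "g \<in> Hom L M" "L \<in> FD" shows "fac L N (\<lambda>x. u (g x))"
proof -
  obtain P a b where P: "Proj P" "a \<in> Hom M P" "b \<in> Hom P N" "\<forall>x\<in>carrier M. u x = b (a x)"
    using assms(1) by (auto simp: fac_def)
  show ?thesis
    by (rule facI[OF P(1) cc_hom[OF assms(3,2) P(2)] P(3)]) (use P assms in auto)
qed

lemma st_hom: "st M N f g \<Longrightarrow> f \<in> Hom M N" "st M N f g \<Longrightarrow> g \<in> Hom M N"
  by (auto simp: st_iff)

lemma st_refl:
  assumes "M \<in> FD" "N \<in> FD" "f \<in> Hom M N" shows "st M N f f"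
proof -
  interpret N: left_module A N using assms(2) by (rule fdD)
  show ?thesis unfolding st_iff
    using assms(3) by (auto intro: fac_cong[OF fac_zero[OF assms(1,2)]])
qed

lemma st_sym:
  assumes "M \<in> FD" "N \<in> FD" "st M N f g" shows "st M N g f"
proof -
  interpret N: left_module A N using assms(2) by (rule fdD)
  show ?thesis using assms(3) unfolding st_iff
    by (auto intro: fac_cong[OF fac_neg[OF assms(1,2)]] simp: N.M.diff_flip)
qed

lemma st_trans:
  assumes "M \<in> FD" "N \<in> FD" "st M N f g" "st M N g h" shows "st M N f h"
proof -
  interpret N: left_module A N using assms(2) by (rule fdD)
  have h: "f \<in> Hom M N" "g \<in> Hom M N" "h \<in> Hom M N" using assms by (auto simp: st_iff)
  have "fac M N (\<lambda>x. (f x \<ominus>\<^bsub>N\<^esub> g x) \<oplus>\<^bsub>N\<^esub> (g x \<ominus>\<^bsub>N\<^esub> h x))"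
    by (rule fac_add[OF assms(1,2)]) (use assms in \<open>auto simp: st_iff\<close>)
  then have "fac M N (\<lambda>x. f x \<ominus>\<^bsub>N\<^esub> h x)"
    by (rule fac_cong) (use h in \<open>simp add: N.M.diff_trans\<close>)
  then show ?thesis using h by (simp add: st_iff)
qed

lemma equiv_stab_rel: "M \<in> FD \<Longrightarrow> N \<in> FD \<Longrightarrow> equiv (Hom M N) (stab_rel K A M N)"
  by (rule equivI) (auto intro!: refl_onI symI transI intro: st_refl st_sym st_trans dest: st_hom)

lemma st_add:
  assumes "M \<in> FD" "N \<in> FD" "st M N f f'" "st M N g g'" shows "st M N (hadd M N f g) (hadd M N f' g')"
proof -
  interpret N: left_module A N using assms(2) by (rule fdD)
  have h: "f \<in> Hom M N" "g \<in> Hom M N" "f' \<in> Hom M N" "g' \<in> Hom M N" using assms by (auto simp: st_iff)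
  have "fac M N (\<lambda>x. (f x \<ominus>\<^bsub>N\<^esub> f' x) \<oplus>\<^bsub>N\<^esub> (g x \<ominus>\<^bsub>N\<^esub> g' x))"
    by (rule fac_add[OF assms(1,2)]) (use assms in \<open>auto simp: st_iff\<close>)
  then have "fac M N (\<lambda>x. hadd M N f g x \<ominus>\<^bsub>N\<^esub> hadd M N f' g' x)"
    by (rule fac_cong) (use h in \<open>simp add: N.M.diff_add_diff\<close>)
  then show ?thesis using h assms by (simp add: st_iff hadd_hom)
qed

lemma st_comp:
  assumes F: "L \<in> FD" "M \<in> FD" "N \<in> FD" and f: "st L M f f'" and g: "st M N g g'"
  shows "st L N (cc L g f) (cc L g' f')"
proof -
  interpret N: left_module A N using F(3) by (rule fdD)
  note h = st_hom[OF f] st_hom[OF g]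
  have "fac L N (\<lambda>x. g (f x \<ominus>\<^bsub>M\<^esub> f' x))"
    by (rule fac_comp_left[OF _ h(3) F(2)]) (use f in \<open>simp add: st_iff\<close>)
  then have 1: "fac L N (\<lambda>x. g (f x) \<ominus>\<^bsub>N\<^esub> g (f' x))"
    by (rule fac_cong) (use h F in \<open>simp add: hom_diff[OF fdD[OF F(2)] fdD[OF F(3)] h(3)]\<close>)
  have 2: "fac L N (\<lambda>x. g (f' x) \<ominus>\<^bsub>N\<^esub> g' (f' x))"
    by (rule fac_comp_right[OF _ h(2) F(1)]) (use g in \<open>simp add: st_iff\<close>)
  have "fac L N (\<lambda>x. cc L g f x \<ominus>\<^bsub>N\<^esub> cc L g' f' x)"
    by (rule fac_cong[OF fac_add[OF F(1,3) 1 2]]) (use h in \<open>simp add: N.M.diff_trans\<close>)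
  then show ?thesis using h F by (simp add: st_iff cc_hom)
qed

lemma st_comp_left:
  assumes "L \<in> FD" "M \<in> FD" "N \<in> FD" "st L M f f'" "g \<in> Hom M N"
  shows "st L N (cc L g f) (cc L g f')"
  using st_comp[OF assms(1-4) st_refl[OF assms(2,3,5)]] .

lemma st_comp_right:
  assumes "L \<in> FD" "M \<in> FD" "N \<in> FD" "f \<in> Hom L M" "st M N g g'"
  shows "st L N (cc L g f) (cc L g' f)"
  using st_comp[OF assms(1-3) st_refl[OF assms(1,2,4)] assms(5)] .

lemma st_diff_factor:
  assumes "M \<in> FD" "N \<in> FD" "f \<in> Hom M N" "g \<in> Hom M N" "Proj P" "a \<in> Hom M P" "b \<in> Hom P N"
    and "\<And>x. x \<in> carrier M \<Longrightarrow> f x = g x \<oplus>\<^bsub>N\<^esub> b (a x)"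
  shows "st M N f g"
proof -
  interpret N: left_module A N using assms(2) by (rule fdD)
  show ?thesis unfolding st_iff
    by (intro conjI assms(3,4) facI[OF assms(5-7)])
      (use assms(3-8) in \<open>simp add: N.M.add_diff_cancel2\<close>)
qed

lemma st_double_zero:
  assumes "M \<in> FD" "N \<in> FD" "st M N f (hadd M N f f)"
  shows "st M N f (hzero M N)"
proof -
  interpret N: left_module A N using assms(2) by (rule fdD)
  note f = st_hom(1)[OF assms(3)]
  have "fac M N (\<lambda>x. \<ominus>\<^bsub>N\<^esub> (f x \<ominus>\<^bsub>N\<^esub> hadd M N f f x))"
    by (rule fac_neg[OF assms(1,2)]) (use assms(3) in \<open>simp add: st_iff\<close>)
  then have "fac M N (\<lambda>x. f x \<ominus>\<^bsub>N\<^esub> hzero M N x)"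
    by (rule fac_cong) (use f in \<open>simp add: N.M.diff_flip N.M.add_diff_cancel\<close>)
  then show ?thesis using f assms by (simp add: st_iff hzero_hom)
qed

subsection \<open>Stably isomorphic modules\<close>

text \<open>\<open>f\<close> and \<open>g\<close> are inverse to each other in the stable category.\<close>

definition st_inv where
  "st_inv M N f g \<longleftrightarrow> f \<in> Hom M N \<and> g \<in> Hom N M \<and> st M M (cc M g f) (hid M) \<and> st N N (cc N f g) (hid N)"

text \<open>A surjective stable isomorphism splits, and its kernel is projective. If \<open>f g - id\<close> factors as
  \<open>b a\<close> through a projective, lift \<open>b\<close> to \<open>c\<close> with \<open>f c = b\<close>; then \<open>s = g - c a\<close> is a section.
  On the kernel of \<open>f\<close> the identity is the restriction of \<open>id - s f\<close>, which factors through a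
  projective because \<open>s\<close> is stably inverse to \<open>f\<close>.\<close>

lemma surj_st_inv_iso:
  assumes F: "M \<in> FD" "N \<in> FD" and inv: "st_inv M N f g" and surj: "f ` carrier M = carrier N"
  obtains L where "Proj L" "lmod_iso A M (dsum N L)"
proof -
  have lM: "lm M" and lN: "lm N" using F by (auto simp: fdD)
  interpret M: left_module A M by (rule lM)
  interpret N: left_module A N by (rule lN)
  have f: "f \<in> Hom M N" and g: "g \<in> Hom N M" and gf: "st M M (cc M g f) (hid M)"
    and fg: "st N N (cc N f g) (hid N)" using inv by (auto simp: st_inv_def)
  obtain P a b where P: "Proj P" "a \<in> Hom N P" "b \<in> Hom P N"
      "\<forall>y\<in>carrier N. cc N f g y \<ominus>\<^bsub>N\<^esub> hid N y = b (a y)"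
    using fg unfolding st_iff fac_def by blast
  obtain c where c: "c \<in> Hom P M" "\<forall>x\<in>carrier P. f (c x) = b x"
    using proj_lift[OF P(1) F f P(3) surj] .
  define s where "s = (\<lambda>y\<in>carrier N. g y \<ominus>\<^bsub>M\<^esub> cc N c a y)"
  have s: "s \<in> Hom N M"
    unfolding s_def by (rule hom_diffmap[OF lN lM g cc_hom[OF F(2) P(2) c(1)]])
  have fs: "f (s y) = y" if y: "y \<in> carrier N" for y
  proof -
    have 1: "b (a y) = f (g y) \<ominus>\<^bsub>N\<^esub> y" using P(4) y by simp
    have "f (s y) = f (g y) \<ominus>\<^bsub>N\<^esub> b (a y)"
      using y c P g f by (simp add: s_def hom_diff[OF lM lN f])
    moreover have "y \<oplus>\<^bsub>N\<^esub> b (a y) = f (g y)"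
      using y f g unfolding 1 by (simp add: N.M.a_comm[of y] N.M.diff_add_cancel)
    then have "y = f (g y) \<ominus>\<^bsub>N\<^esub> b (a y)"
      by (rule N.M.eq_diff_iff[THEN iffD2, rotated -1]) (use y P(2,3) f g in simp_all)
    ultimately show ?thesis by simp
  qed
  have "st N M g s"
    by (rule st_diff_factor[OF F(2,1) g s P(1,2) c(1)])
      (use g P c in \<open>simp add: s_def M.M.diff_add_cancel\<close>)
  then have "st M M (cc M s f) (hid M)"
    using st_trans[OF F(1) F(1) st_sym[OF F(1) F(1) st_comp_right[OF F F(1) f]] gf] by blast
  then have "st M M (hid M) (cc M s f)" by (rule st_sym[OF F(1) F(1)])
  then obtain P' a' b' where P': "Proj P'" "a' \<in> Hom M P'" "b' \<in> Hom P' M"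
      "\<forall>x\<in>carrier M. hid M x \<ominus>\<^bsub>M\<^esub> cc M s f x = b' (a' x)"
    unfolding st_iff fac_def by blast
  let ?L = "M\<lparr>carrier := a_kernel M N f\<rparr>"
  have ker: "submodule (a_kernel M N f) A M" by (rule kernel_submodule[OF lM lN f])
  have FL: "?L \<in> FD" by (rule fd_sub[OF F(1) ker])
  have incl: "(\<lambda>x\<in>a_kernel M N f. x) \<in> Hom ?L M" by (rule hom_incl[OF lM ker])
  define \<pi> where "\<pi> = (\<lambda>x\<in>carrier M. hid M x \<ominus>\<^bsub>M\<^esub> cc M s f x)"
  have \<pi>M: "\<pi> \<in> Hom M M"
    unfolding \<pi>_def by (rule hom_diffmap[OF lM lM hid_hom[OF F(1)] cc_hom[OF F(1) f s]])
  have \<pi>: "\<pi> \<in> Hom M ?L"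
    by (rule hom_corestrict[OF \<pi>M])
      (use f s fs hom_closed[OF \<pi>M] in \<open>auto simp: a_kernel_eq \<pi>_def hom_diff[OF lM lN f]\<close>)
  have \<pi>k: "\<pi> x = x" if "x \<in> a_kernel M N f" for x
    using that hom_zero[OF lN lM s] by (simp add: a_kernel_eq \<pi>_def)
  have "Proj ?L"
  proof (rule proj_retract[OF P'(1) FL cc_hom[OF FL incl P'(2)] cc_hom[OF proj_FD[OF P'(1)] P'(3) \<pi>]])
    fix x assume "x \<in> carrier ?L"
    then have x: "x \<in> a_kernel M N f" "x \<in> carrier M" by (auto simp: a_kernel_eq)
    have "b' (a' x) = \<pi> x" using P'(4) x by (simp add: \<pi>_def)
    then show "cc P' \<pi> b' (cc ?L a' (\<lambda>x\<in>a_kernel M N f. x) x) = x"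
      using x P'(2) \<pi>k by simp
  qed
  moreover have "biprod N ?L M s (\<lambda>x\<in>a_kernel M N f. x) f \<pi>"
    unfolding biprod_def
  proof (intro conjI ballI)
    fix y assume y: "y \<in> carrier N"
    show "f (s y) = y" by (rule fs[OF y])
    show "\<pi> (s y) = \<zero>\<^bsub>?L\<^esub>" using y s fs by (simp add: \<pi>_def)
  next
    fix y assume "y \<in> carrier ?L"
    then show "\<pi> ((\<lambda>x\<in>a_kernel M N f. x) y) = y" "f ((\<lambda>x\<in>a_kernel M N f. x) y) = \<zero>\<^bsub>N\<^esub>"
      using \<pi>k by (auto simp: a_kernel_eq)
  next
    fix z assume z: "z \<in> carrier M"
    have "\<pi> z \<in> a_kernel M N f" using hom_closed[OF \<pi> z] by simp
    moreover have "s (f z) \<oplus>\<^bsub>M\<^esub> (z \<ominus>\<^bsub>M\<^esub> s (f z)) = z"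
      using z f s by (simp add: M.M.a_comm[of "s (f z)"] M.M.diff_add_cancel)
    ultimately show "s (f z) \<oplus>\<^bsub>M\<^esub> (\<lambda>x\<in>a_kernel M N f. x) (\<pi> z) = z"
      using z by (simp add: \<pi>_def)
  qed (use s f incl \<pi> in auto)
  then have "lmod_iso A M (dsum N ?L)" by (rule biprod_iso[OF lN fdD[OF FL] lM])
  ultimately show ?thesis by (rule that)
qed

text \<open>The general case reduces to a surjective one by adding to \<open>f\<close> a surjection from a projective.\<close>

lemma st_inv_iso:
  assumes F: "M \<in> FD" "N \<in> FD" and inv: "st_inv M N f g"
  obtains P Q where "Proj P" "Proj Q" "lmod_iso A (dsum M P) (dsum N Q)"
proof -
  have f: "f \<in> Hom M N" and g: "g \<in> Hom N M" and gf: "st M M (cc M g f) (hid M)"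
    and fg: "st N N (cc N f g) (hid N)" using inv by (auto simp: st_inv_def)
  obtain Q q where Q: "Proj Q" "q \<in> Hom Q N" "q ` carrier Q = carrier N" using enough_proj[OF F(2)] .
  obtain E i1 i2 p1 p2 where E: "E \<in> FD" "biprod M Q E i1 i2 p1 p2" using ex_biprod[OF F(1) proj_FD[OF Q(1)]] .
  note b = biprodD[OF E(2)]
  note l = fdD[OF F(1)] proj_lm[OF Q(1)] fdD[OF E(1)]
  interpret M: left_module A M by (rule l)
  interpret E: left_module A E by (rule l)
  interpret N: left_module A N by (rule fdD[OF F(2)])
  define h where "h = (\<lambda>z\<in>carrier E. f (p1 z) \<oplus>\<^bsub>N\<^esub> q (p2 z))"
  note co = hom_copair[OF l fdD[OF F(2)] E(2) f Q(2)]
  have h: "h \<in> Hom E N" unfolding h_def by (rule co(1))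
  have k: "cc N i1 g \<in> Hom N E" by (rule cc_hom[OF F(2) g b(1)])
  have surj: "h ` carrier E = carrier N"
  proof (intro equalityI subsetI)
    fix y assume "y \<in> carrier N"
    then obtain x where x: "x \<in> carrier Q" "y = q x" using Q(3) by auto
    then have "y = h (i2 x)" using co(3)[OF x(1)] hom_closed[OF b(2) x(1)] by (simp add: h_def)
    then show "y \<in> h ` carrier E" by (rule image_eqI[OF _ hom_closed[OF b(2) x(1)]])
  qed (use h in auto)
  have "st_inv E N h (cc N i1 g)"
    unfolding st_inv_def
  proof (intro conjI h k)
    have "st E N h (cc E f p1)"
      by (rule st_diff_factor[OF E(1) F(2) h cc_hom[OF E(1) b(3) f] Q(1) b(4) Q(2)]) (simp add: h_def)
    then have "st E E (cc E (cc N i1 g) h) (cc E (cc N i1 g) (cc E f p1))"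
      by (rule st_comp_left[OF E(1) F(2) E(1) _ k])
    also have "cc E (cc N i1 g) (cc E f p1) = cc E i1 (cc E (cc M g f) p1)"
      by (rule extensionalityI[OF h_ext(1) h_ext(1)]) (use b f g in simp)
    finally have 1: "st E E (cc E (cc N i1 g) h) (cc E i1 (cc E (cc M g f) p1))" .
    have 2: "st E E (cc E i1 (cc E (cc M g f) p1)) (cc E i1 (cc E (hid M) p1))"
      by (intro st_comp_left[OF E(1) F(1) E(1) _ b(1)] st_comp_right[OF E(1) F(1) F(1) b(3)] gf)
    have 3: "st E E (hid E) (cc E i1 (cc E (hid M) p1))"
      by (rule st_diff_factor[OF E(1) E(1) hid_hom[OF E(1)] _ Q(1) b(4) b(2)])
        (use b E(1) F(1) in \<open>auto intro!: cc_hom hid_hom\<close>)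
    show "st E E (cc E (cc N i1 g) h) (hid E)"
      by (rule st_trans[OF E(1) E(1) 1 st_trans[OF E(1) E(1) 2 st_sym[OF E(1) E(1) 3]]])
    have "cc N h (cc N i1 g) = cc N f g"
      by (rule extensionalityI[OF h_ext(1) h_ext(1)])
        (use b f g co(2) hom_closed[OF b(1)] in \<open>simp add: h_def\<close>)
    then show "st N N (cc N h (cc N i1 g)) (hid N)" using fg by simp
  qed
  then obtain L where L: "Proj L" "lmod_iso A E (dsum N L)"
    using surj_st_inv_iso[OF E(1) F(2) _ surj] by blast
  have "lmod_iso A (dsum M Q) E" by (rule lmod_iso_sym[OF biprod_iso[OF l E(2)]])
  then have "lmod_iso A (dsum M Q) (dsum N L)"
    using lmod_iso_trans[OF left_module_dsum[OF l(1,2)] left_module_dsum[OF fdD[OF F(2)] proj_lm[OF L(1)]] _ L(2)]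
    by blast
  then show ?thesis by (rule that[OF Q(1) L(1)])
qed

text \<open>The equation \<open>p\<^sub>1 i\<^sub>2 = 0\<close> of a stable biproduct: the map \<open>u = p\<^sub>1 i\<^sub>2\<close> satisfies
  \<open>u = p\<^sub>1 (i\<^sub>1 p\<^sub>1 + i\<^sub>2 p\<^sub>2) i\<^sub>2 = u + u\<close>.\<close>

lemma st_biproduct_cross:
  assumes F: "X \<in> FD" "Z \<in> FD" "E \<in> FD"
    and i1: "i1 \<in> Hom X E" and i2: "i2 \<in> Hom Z E" and p1: "p1 \<in> Hom E X" and p2: "p2 \<in> Hom E Z"
    and e1: "st X X (cc X p1 i1) (hid X)" and e2: "st Z Z (cc Z p2 i2) (hid Z)"
    and s: "st E E (hadd E E (cc E i1 p1) (cc E i2 p2)) (hid E)"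
  shows "st Z X (cc Z p1 i2) (hzero Z X)"
proof -
  interpret X: left_module A X by (rule fdD[OF F(1)])
  interpret E: left_module A E by (rule fdD[OF F(3)])
  let ?u = "cc Z p1 i2"
  have u: "?u \<in> Hom Z X" by (rule cc_hom[OF F(2) i2 p1])
  have "st Z X (cc Z p1 (cc Z (hadd E E (cc E i1 p1) (cc E i2 p2)) i2)) (cc Z p1 (cc Z (hid E) i2))"
    by (intro st_comp_left[OF F(2,3,1) _ p1] st_comp_right[OF F(2) F(3) F(3) i2] s)
  also have "cc Z p1 (cc Z (hid E) i2) = ?u"
    by (rule extensionalityI[OF h_ext(1) h_ext(1)]) (use i2 in simp)
  also have "cc Z p1 (cc Z (hadd E E (cc E i1 p1) (cc E i2 p2)) i2)
      = hadd Z X (cc Z (cc X p1 i1) ?u) (cc Z ?u (cc Z p2 i2))"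
    by (rule extensionalityI[OF h_ext(1) h_ext(3)]) (use i1 i2 p1 p2 in \<open>simp add: hom_add[OF p1]\<close>)
  finally have 1: "st Z X ?u (hadd Z X (cc Z (cc X p1 i1) ?u) (cc Z ?u (cc Z p2 i2)))"
    by (rule st_sym[OF F(2,1)])
  have 2: "st Z X (hadd Z X (cc Z (cc X p1 i1) ?u) (cc Z ?u (cc Z p2 i2)))
      (hadd Z X (cc Z (hid X) ?u) (cc Z ?u (hid Z)))"
    by (intro st_add[OF F(2,1)] st_comp_right[OF F(2,1,1) u] st_comp_left[OF F(2,2,1) _ u] e1 e2)
  have "st Z X ?u (hadd Z X ?u ?u)"
    using st_trans[OF F(2,1) 1 2] u by (simp add: cc_hid)
  then show ?thesis by (rule st_double_zero[OF F(2,1)])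
qed

text \<open>A biproduct in the stable category is stably isomorphic to the direct sum.\<close>

lemma st_biproduct_iso:
  assumes F: "X \<in> FD" "Z \<in> FD" "E \<in> FD" and D: "D \<in> FD" "biprod X Z D j1 j2 q1 q2"
    and i1: "i1 \<in> Hom X E" and i2: "i2 \<in> Hom Z E" and p1: "p1 \<in> Hom E X" and p2: "p2 \<in> Hom E Z"
    and e1: "st X X (cc X p1 i1) (hid X)" and e2: "st Z Z (cc Z p2 i2) (hid Z)"
    and s: "st E E (hadd E E (cc E i1 p1) (cc E i2 p2)) (hid E)"
  shows "\<exists>f g. st_inv E D f g"
proof -
  note l = fdD[OF F(1)] fdD[OF F(2)] fdD[OF F(3)] fdD[OF D(1)]
  interpret X: left_module A X by (rule l)
  interpret Z: left_module A Z by (rule l)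
  interpret E: left_module A E by (rule l)
  interpret D: left_module A D by (rule l)
  note b = biprodD[OF D(2)]
  note cross = st_biproduct_cross[OF F i1 i2 p1 p2 e1 e2 s]
  have s': "st E E (hadd E E (cc E i2 p2) (cc E i1 p1)) (hid E)"
  proof -
    have "hadd E E (cc E i2 p2) (cc E i1 p1) = hadd E E (cc E i1 p1) (cc E i2 p2)"
      by (rule extensionalityI[OF h_ext(3) h_ext(3)]) (use i1 i2 p1 p2 in \<open>simp add: E.M.a_comm\<close>)
    then show ?thesis using s by simp
  qed
  note cross' = st_biproduct_cross[OF F(2,1,3) i2 i1 p2 p1 e2 e1 s']
  let ?f = "hadd E D (cc E j1 p1) (cc E j2 p2)" and ?g = "hadd D E (cc D i1 q1) (cc D i2 q2)"
  note hh = cc_hom hadd_hom hid_hom hzero_hom F D(1) b(1-4) i1 i2 p1 p2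
  have f: "?f \<in> Hom E D" by (rule hh hh(1)[where M = X] hh(1)[where M = Z])+
  have g: "?g \<in> Hom D E" by (rule hh hh(1)[where M = X] hh(1)[where M = Z])+
  have gf: "cc E ?g ?f = hadd E E (cc E i1 p1) (cc E i2 p2)"
    by (rule extensionalityI[OF h_ext(1) h_ext(3)])
      (use i1 i2 p1 p2 b(1-8) hom_closed[OF f] in \<open>simp add: hom_add[OF b(3)] hom_add[OF b(4)]\<close>)
  have eq: "cc D ?f ?g = hadd D D
      (hadd D D (cc D j1 (cc D (cc X p1 i1) q1)) (cc D j1 (cc D (cc Z p1 i2) q2)))
      (hadd D D (cc D j2 (cc D (cc X p2 i1) q1)) (cc D j2 (cc D (cc Z p2 i2) q2)))"
    by (rule extensionalityI[OF h_ext(1) h_ext(3)])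
      (use i1 i2 p1 p2 b(1-4) hom_closed[OF g] in
        \<open>simp add: hom_add[OF p1] hom_add[OF p2] hom_add[OF b(1)] hom_add[OF b(2)]\<close>)
  have "st D D (cc D ?f ?g) (hadd D D
      (hadd D D (cc D j1 (cc D (hid X) q1)) (cc D j1 (cc D (hzero Z X) q2)))
      (hadd D D (cc D j2 (cc D (hzero X Z) q1)) (cc D j2 (cc D (hid Z) q2))))"
    unfolding eq
    by (intro st_add[OF D(1) D(1)] st_comp_left[OF D(1) F(1) D(1) _ b(1)] st_comp_left[OF D(1) F(2) D(1) _ b(2)]
      st_comp_right[OF D(1) F(1) _ b(3)] st_comp_right[OF D(1) F(2) _ b(4)] F e1 e2 cross cross')
  also have "(hadd D D
      (hadd D D (cc D j1 (cc D (hid X) q1)) (cc D j1 (cc D (hzero Z X) q2)))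
      (hadd D D (cc D j2 (cc D (hzero X Z) q1)) (cc D j2 (cc D (hid Z) q2)))) = hid D"
    by (rule extensionalityI[OF h_ext(3) h_ext(2)])
      (use b(1-4) b(9) hom_zero[OF l(1,4) b(1)] hom_zero[OF l(2,4) b(2)] in simp)
  finally have "st D D (cc D ?f ?g) (hid D)" .
  then have "st_inv E D ?f ?g" unfolding st_inv_def gf using f g s by blast
  then show ?thesis by blast
qed

end

section \<open>Additive categories with an additive endofunctor\<close>

text \<open>Only what the stabilization needs is required: no zero morphisms, inverses or laws of addition,
  apart from its compatibility with the endofunctor.\<close>

locale endo_cat =
  fixes C :: "('o, 'm) precat_endo"
  assumes idm_Mor: "X \<in> Ob C \<Longrightarrow> idm C X \<in> Mor C X X"
    and cmp_Mor: "\<lbrakk>X \<in> Ob C; Y \<in> Ob C; Z \<in> Ob C; f \<in> Mor C X Y; g \<in> Mor C Y Z\<rbrakk> \<Longrightarrow>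
      cmp C X Y Z g f \<in> Mor C X Z"
    and plus_Mor: "\<lbrakk>X \<in> Ob C; Y \<in> Ob C; f \<in> Mor C X Y; g \<in> Mor C X Y\<rbrakk> \<Longrightarrow>
      plus_mor C X Y f g \<in> Mor C X Y"
    and cmp_assoc: "\<lbrakk>W \<in> Ob C; X \<in> Ob C; Y \<in> Ob C; Z \<in> Ob C;
        f \<in> Mor C W X; g \<in> Mor C X Y; h \<in> Mor C Y Z\<rbrakk> \<Longrightarrow>
      cmp C W X Z (cmp C X Y Z h g) f = cmp C W Y Z h (cmp C W X Y g f)"
    and cmp_idl: "\<lbrakk>X \<in> Ob C; Y \<in> Ob C; f \<in> Mor C X Y\<rbrakk> \<Longrightarrow> cmp C X Y Y (idm C Y) f = f"
    and cmp_idr: "\<lbrakk>X \<in> Ob C; Y \<in> Ob C; f \<in> Mor C X Y\<rbrakk> \<Longrightarrow> cmp C X X Y f (idm C X) = f"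
    and Om_Ob: "X \<in> Ob C \<Longrightarrow> Om C X \<in> Ob C"
    and Om_Mor: "\<lbrakk>X \<in> Ob C; Y \<in> Ob C; f \<in> Mor C X Y\<rbrakk> \<Longrightarrow> Om_mor C X Y f \<in> Mor C (Om C X) (Om C Y)"
    and Om_id: "X \<in> Ob C \<Longrightarrow> Om_mor C X X (idm C X) = idm C (Om C X)"
    and Om_cmp: "\<lbrakk>X \<in> Ob C; Y \<in> Ob C; Z \<in> Ob C; f \<in> Mor C X Y; g \<in> Mor C Y Z\<rbrakk> \<Longrightarrow>
      Om_mor C X Z (cmp C X Y Z g f) =
        cmp C (Om C X) (Om C Y) (Om C Z) (Om_mor C Y Z g) (Om_mor C X Y f)"
    and Om_plus: "\<lbrakk>X \<in> Ob C; Y \<in> Ob C; f \<in> Mor C X Y; g \<in> Mor C X Y\<rbrakk> \<Longrightarrow>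
      Om_mor C X Y (plus_mor C X Y f g) =
        plus_mor C (Om C X) (Om C Y) (Om_mor C X Y f) (Om_mor C X Y g)"

section \<open>The stable module category\<close>

context fd_universe
begin

abbreviation SC where "SC \<equiv> (stmod K A :: (('a, 'u) module, ('u \<Rightarrow> 'u) set) precat_endo)"
abbreviation cls :: "('a, 'u) module \<Rightarrow> ('a, 'u) module \<Rightarrow> ('u \<Rightarrow> 'u) \<Rightarrow> ('u \<Rightarrow> 'u) set" where
  "cls \<equiv> stab_class K A"

lemma SC_simps [simp]: "Ob SC = FD" "idm SC M = cls M M (hid M)" "Om SC = Syz" "Om_mor SC = syz_mor K A"
  by (simp_all add: stmod_def hid_def)

lemma SC_Mor: "\<phi> \<in> Mor SC M N \<longleftrightarrow> (\<exists>f\<in>Hom M N. \<phi> = cls M N f)"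
  by (auto simp: stmod_def quotient_def stab_class_def)

lemma cls_Mor: "f \<in> Hom M N \<Longrightarrow> cls M N f \<in> Mor SC M N"
  by (auto simp: SC_Mor)

lemma in_cls: "g \<in> cls M N f \<longleftrightarrow> st M N f g"
  by (simp add: stab_class_def)

lemma cls_eq:
  assumes "M \<in> FD" "N \<in> FD" "f \<in> Hom M N" "g \<in> Hom M N"
  shows "cls M N f = cls M N g \<longleftrightarrow> st M N f g"
  unfolding stab_class_def using eq_equiv_class_iff[OF equiv_stab_rel[OF assms(1,2)] assms(3,4)] .

lemma cls_eqI: "M \<in> FD \<Longrightarrow> N \<in> FD \<Longrightarrow> st M N f g \<Longrightarrow> cls M N f = cls M N g"
  using cls_eq st_hom by blast

lemma cls_self: "M \<in> FD \<Longrightarrow> N \<in> FD \<Longrightarrow> f \<in> Hom M N \<Longrightarrow> f \<in> cls M N f"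
  by (simp add: in_cls st_refl)

lemma SC_cmp:
  assumes F: "L \<in> FD" "M \<in> FD" "N \<in> FD" and f: "f \<in> Hom L M" and g: "g \<in> Hom M N"
  shows "cmp SC L M N (cls M N g) (cls L M f) = cls L N (cc L g f)"
proof -
  have "cls L N (cc L g' f') = cls L N (cc L g f)" if "f' \<in> cls L M f" "g' \<in> cls M N g" for f' g'
    using cls_eqI[OF F(1,3) st_comp[OF F]] that by (simp add: in_cls)
  then have "(\<Union>f' \<in> cls L M f. \<Union>g' \<in> cls M N g. cls L N (cc L g' f')) = cls L N (cc L g f)"
    using cls_self[OF F(1,2) f] cls_self[OF F(2,3) g] by blast
  then show ?thesis by (simp add: stmod_def cc_def)
qed

lemma SC_plus:
  assumes F: "M \<in> FD" "N \<in> FD" and f: "f \<in> Hom M N" and g: "g \<in> Hom M N"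
  shows "plus_mor SC M N (cls M N f) (cls M N g) = cls M N (hadd M N f g)"
proof -
  have "cls M N (hadd M N f' g') = cls M N (hadd M N f g)" if "f' \<in> cls M N f" "g' \<in> cls M N g" for f' g'
    using cls_eqI[OF F st_add[OF F]] that by (simp add: in_cls)
  then have "(\<Union>f' \<in> cls M N f. \<Union>g' \<in> cls M N g. cls M N (hadd M N f' g')) = cls M N (hadd M N f g)"
    using cls_self[OF F f] cls_self[OF F g] by blast
  then show ?thesis by (simp add: stmod_def hadd_def)
qed

text \<open>\<open>h\<close> lifts \<open>f\<close> to the projective covers; \<open>rs M h\<close> below is the map that it induces on syzygies.\<close>

definition is_lift where
  "is_lift M N f h \<longleftrightarrow> h \<in> Hom (PC M) (PC N) \<and> (\<forall>x\<in>carrier (PC M). pc N (h x) = f (pc M x))"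

abbreviation rs where "rs M h \<equiv> restrict h (carrier (Syz M))"

lemma ex_lift:
  assumes "M \<in> FD" "N \<in> FD" "f \<in> Hom M N" obtains h where "is_lift M N f h"
proof -
  note p = proj_cover[OF assms(1)] and q = proj_cover[OF assms(2)]
  obtain h where "h \<in> Hom (PC M) (PC N)" "\<forall>x\<in>carrier (PC M). pc N (h x) = cc (PC M) f (pc M) x"
    using proj_lift[OF p(1) proj_FD[OF q(1)] assms(2) q(2) cc_hom[OF proj_FD[OF p(1)] p(2) assms(3)] q(3)] .
  then show ?thesis using that by (simp add: is_lift_def)
qed

lemma syz_sub: "x \<in> carrier (Syz M) \<Longrightarrow> x \<in> carrier (PC M)"
  by (simp add: syz_carrier)

lemma syz_add: "x \<oplus>\<^bsub>Syz M\<^esub> y = x \<oplus>\<^bsub>PC M\<^esub> y" "zero (Syz M) = zero (PC M)"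
  by (simp_all add: syz_def)

lemma syz_diff:
  assumes "M \<in> FD" "x \<in> carrier (Syz M)" "y \<in> carrier (Syz M)"
  shows "x \<ominus>\<^bsub>Syz M\<^esub> y = x \<ominus>\<^bsub>PC M\<^esub> y"
  using sub_diff[OF proj_lm[OF proj_cover(1)] syz_submodule(1), OF assms(1,1) assms(2,3)]
    syz_submodule(2)[OF assms(1)] by simp

lemma syz_incl: "M \<in> FD \<Longrightarrow> (\<lambda>x\<in>carrier (Syz M). x) \<in> Hom (Syz M) (PC M)"
  using hom_incl[OF proj_lm[OF proj_cover(1)] syz_submodule(1)] syz_submodule(2) by metis

lemma syz_corestrict:
  assumes "N \<in> FD" "f \<in> Hom M (PC N)" "\<And>x. x \<in> carrier M \<Longrightarrow> pc N (f x) = \<zero>\<^bsub>N\<^esub>"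
  shows "f \<in> Hom M (Syz N)"
proof -
  have "f ` carrier M \<subseteq> carrier (Syz N)" using assms by (auto simp: syz_carrier)
  from hom_corestrict[OF assms(2) this] show ?thesis using syz_submodule(2)[OF assms(1)] by simp
qed

lemma rs_hom:
  assumes F: "M \<in> FD" "N \<in> FD" and f: "f \<in> Hom M N" and h: "is_lift M N f h"
  shows "rs M h \<in> Hom (Syz M) (Syz N)"
proof -
  have "rs M h = cc (Syz M) h (\<lambda>x\<in>carrier (Syz M). x)"
    by (rule extensionalityI[OF _ h_ext(1)]) auto
  then have "rs M h \<in> Hom (Syz M) (PC N)"
    using cc_hom[OF syz_FD[OF F(1)] syz_incl[OF F(1)]] h by (simp add: is_lift_def)
  then show ?thesis
    by (rule syz_corestrict[OF F(2)])
      (use h hom_zero[OF fdD[OF F(1)] fdD[OF F(2)] f] in \<open>auto simp: is_lift_def syz_carrier\<close>)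
qed

text \<open>Lifts of stably equal maps induce stably equal maps on syzygies. If \<open>f - f'\<close> factors as \<open>b a\<close>
  through a projective, lift \<open>b\<close> to \<open>c\<close> along the cover of \<open>N\<close>; then \<open>h - h' - c a pc\<close> maps the cover
  of \<open>M\<close> into the syzygy of \<open>N\<close> and agrees with \<open>h - h'\<close> on the syzygy of \<open>M\<close>.\<close>

lemma rs_st:
  assumes F: "M \<in> FD" "N \<in> FD" and s: "st M N f f'" and h: "is_lift M N f h" and h': "is_lift M N f' h'"
  shows "st (Syz M) (Syz N) (rs M h) (rs M h')"
proof -
  note p = proj_cover[OF F(1)] and q = proj_cover[OF F(2)]
  note l = fdD[OF F(1)] fdD[OF F(2)] proj_lm[OF p(1)] proj_lm[OF q(1)]
  note Fp = proj_FD[OF p(1)] proj_FD[OF q(1)]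
  note f = st_hom[OF s]
  interpret M: left_module A M by (rule l)
  interpret N: left_module A N by (rule l)
  interpret Q: left_module A "PC N" by (rule l)
  interpret P': left_module A "PC M" by (rule l)
  have hh: "h \<in> Hom (PC M) (PC N)" "h' \<in> Hom (PC M) (PC N)"
    "\<And>x. x \<in> carrier (PC M) \<Longrightarrow> pc N (h x) = f (pc M x)"
    "\<And>x. x \<in> carrier (PC M) \<Longrightarrow> pc N (h' x) = f' (pc M x)" using h h' by (auto simp: is_lift_def)
  obtain P a b where P: "Proj P" "a \<in> Hom M P" "b \<in> Hom P N"
      "\<forall>x\<in>carrier M. f x \<ominus>\<^bsub>N\<^esub> f' x = b (a x)"
    using s unfolding st_iff fac_def by blast
  obtain c where c: "c \<in> Hom P (PC N)" "\<forall>x\<in>carrier P. pc N (c x) = b x"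
    using proj_lift[OF P(1) Fp(2) F(2) q(2) P(3) q(3)] .
  let ?d = "\<lambda>x\<in>carrier (PC M). h x \<ominus>\<^bsub>PC N\<^esub> h' x"
  let ?ca = "cc (PC M) (cc M c a) (pc M)"
  let ?k = "\<lambda>x\<in>carrier (PC M). ?d x \<ominus>\<^bsub>PC N\<^esub> ?ca x"
  have d: "?d \<in> Hom (PC M) (PC N)" by (rule hom_diffmap[OF l(3,4) hh(1,2)])
  have ca: "?ca \<in> Hom (PC M) (PC N)" by (rule cc_hom[OF Fp(1) p(2) cc_hom[OF F(1) P(2) c(1)]])
  have k: "?k \<in> Hom (PC M) (PC N)" by (rule hom_diffmap[OF l(3,4) d ca])
  have k': "?k \<in> Hom (PC M) (Syz N)"
  proof (rule syz_corestrict[OF F(2) k])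
    fix x assume x: "x \<in> carrier (PC M)"
    have px: "pc M x \<in> carrier M" using p(2) x by simp
    have "pc N (?k x) = (f (pc M x) \<ominus>\<^bsub>N\<^esub> f' (pc M x)) \<ominus>\<^bsub>N\<^esub> b (a (pc M x))"
      using x px hh hom_closed[OF d x] hom_closed[OF ca x] c P(2)
      by (simp add: hom_diff[OF l(4,2) q(2)])
    also have "\<dots> = \<zero>\<^bsub>N\<^esub>" using P(2,3,4) px by simp
    finally show "pc N (?k x) = \<zero>\<^bsub>N\<^esub>" .
  qed
  note r = rs_hom[OF F f(1) h] rs_hom[OF F f(2) h']
  have *: "rs M h x \<ominus>\<^bsub>Syz N\<^esub> rs M h' x = ?k ((\<lambda>x\<in>carrier (Syz M). x) x)" if x: "x \<in> carrier (Syz M)" for x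
  proof -
    have z: "pc M x = \<zero>\<^bsub>M\<^esub>" and xP: "x \<in> carrier (PC M)" using x by (auto simp: syz_carrier)
    have "?ca x = \<zero>\<^bsub>PC N\<^esub>"
      using xP z hom_zero[OF l(1,4) cc_hom[OF F(1) P(2) c(1)]] by simp
    moreover have "rs M h x \<ominus>\<^bsub>Syz N\<^esub> rs M h' x = h x \<ominus>\<^bsub>PC N\<^esub> h' x"
      using syz_diff[OF F(2) hom_closed[OF r(1) x] hom_closed[OF r(2) x]] x by simp
    ultimately show ?thesis using x xP hh(1,2) by simp
  qed
  show ?thesis unfolding st_iff
    by (intro conjI r, rule facI[OF p(1) syz_incl[OF F(1)] k'], rule *)
qed

lemma syz_mor_cls:
  assumes F: "M \<in> FD" "N \<in> FD" and f: "f \<in> Hom M N" and h: "is_lift M N f h"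
  shows "syz_mor K A M N (cls M N f) = cls (Syz M) (Syz N) (rs M h)"
proof -
  note p = proj_cover[OF F(1)] and q = proj_cover[OF F(2)]
  have lift: "{h \<in> Hom (PC M) (PC N). compose (carrier (PC M)) (pc N) h = compose (carrier (PC M)) f' (pc M)}
      = {h. is_lift M N f' h}" if "f' \<in> Hom M N" for f'
  proof -
    have "compose (carrier (PC M)) (pc N) h = compose (carrier (PC M)) f' (pc M) \<longleftrightarrow>
        (\<forall>x\<in>carrier (PC M). pc N (h x) = f' (pc M x))" for h
      by (auto simp: compose_def fun_eq_iff restrict_def)
    then show ?thesis by (auto simp: is_lift_def)
  qed
  have "syz_mor K A M N (cls M N f) = (\<Union>f'\<in>cls M N f. \<Union>h'\<in>{h. is_lift M N f' h}. cls (Syz M) (Syz N) (rs M h'))"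
    unfolding syz_mor_def
  proof (rule SUP_cong[OF refl])
    fix f' assume "f' \<in> cls M N f"
    then have "f' \<in> Hom M N" using st_hom(2) by (simp add: in_cls)
    from lift[OF this] show "(\<Union>h\<in>{h \<in> Hom (PC M) (PC N).
        compose (carrier (PC M)) (pc N) h = compose (carrier (PC M)) f' (pc M)}.
        cls (Syz M) (Syz N) (rs M h)) = (\<Union>h'\<in>{h. is_lift M N f' h}. cls (Syz M) (Syz N) (rs M h'))"
      by simp
  qed
  also have "\<dots> = cls (Syz M) (Syz N) (rs M h)"
  proof -
    have "cls (Syz M) (Syz N) (rs M h') = cls (Syz M) (Syz N) (rs M h)"
      if "f' \<in> cls M N f" "is_lift M N f' h'" for f' h'
      by (rule cls_eqI[OF syz_FD[OF F(1)] syz_FD[OF F(2)]], rule rs_st[OF F _ that(2) h])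
        (use that(1) st_sym[OF F] in \<open>simp add: in_cls\<close>)
    then show ?thesis using cls_self[OF F f] h by blast
  qed
  finally show ?thesis .
qed

lemma lift_id: "M \<in> FD \<Longrightarrow> is_lift M M (hid M) (hid (PC M))"
  using proj_cover(1,2)[of M] by (simp add: is_lift_def hid_hom proj_FD)

lemma lift_cc:
  assumes "L \<in> FD" "is_lift L M f h" "is_lift M N g k"
  shows "is_lift L N (cc L g f) (cc (PC L) k h)"
  using assms proj_cover(1,2)[OF assms(1)] by (auto simp: is_lift_def proj_FD intro!: cc_hom)

lemma lift_add:
  assumes "M \<in> FD" "N \<in> FD" "is_lift M N f h" "is_lift M N g k"
  shows "is_lift M N (hadd M N f g) (hadd (PC M) (PC N) h k)"
proof -
  note p = proj_cover[OF assms(1)] and q = proj_cover[OF assms(2)]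
  show ?thesis
    using assms p(2) hadd_hom[OF proj_FD[OF p(1)] proj_FD[OF q(1)]]
    by (auto simp: is_lift_def hom_add[OF q(2)])
qed

lemma stmod_endo_cat: "endo_cat SC"
proof
  fix X assume "X \<in> Ob SC" then show "idm SC X \<in> Mor SC X X" by (simp add: cls_Mor hid_hom)
next
  fix X Y Z f g assume "X \<in> Ob SC" "Y \<in> Ob SC" "Z \<in> Ob SC" "f \<in> Mor SC X Y" "g \<in> Mor SC Y Z"
  then obtain f' g' where *: "X \<in> FD" "Y \<in> FD" "Z \<in> FD" "f' \<in> Hom X Y" "g' \<in> Hom Y Z"
    "f = cls X Y f'" "g = cls Y Z g'" by (auto simp: SC_Mor)
  then show "cmp SC X Y Z g f \<in> Mor SC X Z" by (simp add: SC_cmp cls_Mor cc_hom)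
  obtain h k where hk: "is_lift X Y f' h" "is_lift Y Z g' k" using * ex_lift by metis
  have "rs X (cc (PC X) k h) = cc (Syz X) (rs Y k) (rs X h)"
    by (rule extensionalityI[OF _ h_ext(1)])
      (use hom_closed[OF rs_hom[OF *(1,2,4) hk(1)]] in \<open>auto simp: syz_sub\<close>)
  then show "Om_mor SC X Z (cmp SC X Y Z g f) =
        cmp SC (Om SC X) (Om SC Y) (Om SC Z) (Om_mor SC Y Z g) (Om_mor SC X Y f)"
    using * hk syz_mor_cls[OF *(1,3) cc_hom[OF *(1,4,5)] lift_cc[OF *(1) hk]]
      syz_mor_cls[OF *(1,2,4) hk(1)] syz_mor_cls[OF *(2,3,5) hk(2)]
      SC_cmp[OF syz_FD syz_FD syz_FD rs_hom[OF *(1,2,4) hk(1)] rs_hom[OF *(2,3,5) hk(2)]]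
    by (simp add: SC_cmp)
next
  fix X Y f g assume "X \<in> Ob SC" "Y \<in> Ob SC" "f \<in> Mor SC X Y" "g \<in> Mor SC X Y"
  then obtain f' g' where *: "X \<in> FD" "Y \<in> FD" "f' \<in> Hom X Y" "g' \<in> Hom X Y"
    "f = cls X Y f'" "g = cls X Y g'" by (auto simp: SC_Mor)
  then show "plus_mor SC X Y f g \<in> Mor SC X Y" by (simp add: SC_plus cls_Mor hadd_hom)
  obtain h k where hk: "is_lift X Y f' h" "is_lift X Y g' k" using * ex_lift by metis
  have "rs X (hadd (PC X) (PC Y) h k) = hadd (Syz X) (Syz Y) (rs X h) (rs X k)"
    by (rule extensionalityI[OF _ h_ext(3)]) (auto simp: syz_sub syz_add)
  then show "Om_mor SC X Y (plus_mor SC X Y f g) =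
        plus_mor SC (Om SC X) (Om SC Y) (Om_mor SC X Y f) (Om_mor SC X Y g)"
    using * hk syz_mor_cls[OF *(1,2) hadd_hom[OF *(1-4)] lift_add[OF *(1,2) hk]]
      syz_mor_cls[OF *(1,2,3) hk(1)] syz_mor_cls[OF *(1,2,4) hk(2)]
      SC_plus[OF syz_FD syz_FD rs_hom[OF *(1,2,3) hk(1)] rs_hom[OF *(1,2,4) hk(2)]]
    by (simp add: SC_plus)
next
  fix W X Y Z f g h
  assume "W \<in> Ob SC" "X \<in> Ob SC" "Y \<in> Ob SC" "Z \<in> Ob SC" "f \<in> Mor SC W X" "g \<in> Mor SC X Y" "h \<in> Mor SC Y Z"
  then obtain f' g' h' where *: "W \<in> FD" "X \<in> FD" "Y \<in> FD" "Z \<in> FD"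
    "f' \<in> Hom W X" "g' \<in> Hom X Y" "h' \<in> Hom Y Z"
    "f = cls W X f'" "g = cls X Y g'" "h = cls Y Z h'" by (auto simp: SC_Mor)
  then show "cmp SC W X Z (cmp SC X Y Z h g) f = cmp SC W Y Z h (cmp SC W X Y g f)"
    using cc_hom[OF *(1,5,6)] cc_hom[OF *(2,6,7)] by (simp add: SC_cmp cc_assoc[OF *(5)])
next
  fix X Y f assume "X \<in> Ob SC" "Y \<in> Ob SC" "f \<in> Mor SC X Y"
  then obtain f' where *: "X \<in> FD" "Y \<in> FD" "f' \<in> Hom X Y" "f = cls X Y f'" by (auto simp: SC_Mor)
  then show "cmp SC X Y Y (idm SC Y) f = f" "cmp SC X X Y f (idm SC X) = f"
    by (simp_all add: SC_cmp hid_hom cc_hid)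
  obtain h where h: "is_lift X Y f' h" using * ex_lift by metis
  then show "Om_mor SC X Y f \<in> Mor SC (Om SC X) (Om SC Y)"
    using * rs_hom[OF *(1-3)] by (simp add: syz_mor_cls cls_Mor)
next
  fix X assume X: "X \<in> Ob SC"
  then show "Om SC X \<in> Ob SC" by (simp add: syz_FD)
  have "rs X (hid (PC X)) = hid (Syz X)"
    by (rule extensionalityI[OF _ h_ext(2)]) (auto simp: syz_sub)
  then show "Om_mor SC X X (idm SC X) = idm SC (Om SC X)"
    using X syz_mor_cls[OF _ _ hid_hom lift_id, of X] by simp
qed

end

sublocale fd_universe \<subseteq> SC: endo_cat "stmod K A :: (('a, 'u) module, ('u \<Rightarrow> 'u) set) precat_endo"
  by (rule stmod_endo_cat)

context endo_cat
begin

section \<open>Isomorphisms and biproducts under the endofunctor\<close>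

lemma iso_id: "X \<in> Ob C \<Longrightarrow> is_iso C X X (idm C X)"
  unfolding is_iso_def by (auto simp: idm_Mor cmp_idl intro!: bexI[of _ "idm C X"])

lemma isoD:
  assumes "is_iso C X Y f"
  shows "f \<in> Mor C X Y"
  using assms by (simp add: is_iso_def)

lemma isoE:
  assumes "is_iso C X Y f"
  obtains g where "is_iso C Y X g" "cmp C X Y X g f = idm C X" "cmp C Y X Y f g = idm C Y"
  using assms unfolding is_iso_def by blast

lemma iso_trans:
  assumes O: "X \<in> Ob C" "Y \<in> Ob C" "Z \<in> Ob C" and f: "is_iso C X Y f" and g: "is_iso C Y Z g"
  shows "is_iso C X Z (cmp C X Y Z g f)"
proof -
  obtain f' where f': "f' \<in> Mor C Y X" "cmp C X Y X f' f = idm C X" "cmp C Y X Y f f' = idm C Y"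
    using f unfolding is_iso_def by blast
  obtain g' where g': "g' \<in> Mor C Z Y" "cmp C Y Z Y g' g = idm C Y" "cmp C Z Y Z g g' = idm C Z"
    using g unfolding is_iso_def by blast
  note m = isoD[OF f] isoD[OF g]
  have "cmp C X Z X (cmp C Z Y X f' g') (cmp C X Y Z g f) = cmp C X Y X f' (cmp C X Y Y (cmp C Y Z Y g' g) f)"
    using O m f'(1) g'(1) by (simp add: cmp_assoc cmp_Mor)
  moreover have "cmp C Z X Z (cmp C X Y Z g f) (cmp C Z Y X f' g') = cmp C Z Y Z g (cmp C Z Y Y (cmp C Y X Y f f') g')"
    using O m f'(1) g'(1) by (simp add: cmp_assoc cmp_Mor)
  ultimately show ?thesis
    unfolding is_iso_def using O m f' g'
    by (auto simp: cmp_Mor cmp_idl intro!: bexI[of _ "cmp C Z Y X f' g'"])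
qed

lemma iso_Om:
  assumes O: "X \<in> Ob C" "Y \<in> Ob C" and f: "is_iso C X Y f"
  shows "is_iso C (Om C X) (Om C Y) (Om_mor C X Y f)"
proof -
  obtain f' where f': "f' \<in> Mor C Y X" "cmp C X Y X f' f = idm C X" "cmp C Y X Y f f' = idm C Y"
    using f unfolding is_iso_def by blast
  note m = isoD[OF f]
  show ?thesis unfolding is_iso_def
    using O m f' Om_cmp[OF O(1,2,1) m f'(1)] Om_cmp[OF O(2,1,2) f'(1) m]
    by (auto simp: Om_Mor Om_id intro!: bexI[of _ "Om_mor C Y X f'"])
qed

lemma biproduct_Om:
  assumes O: "X \<in> Ob C" "Z \<in> Ob C" and b: "is_biproduct C X Z E"
  shows "is_biproduct C (Om C X) (Om C Z) (Om C E)"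
proof -
  obtain i1 i2 p1 p2 where *: "E \<in> Ob C" "i1 \<in> Mor C X E" "i2 \<in> Mor C Z E" "p1 \<in> Mor C E X" "p2 \<in> Mor C E Z"
    "cmp C X E X p1 i1 = idm C X" "cmp C Z E Z p2 i2 = idm C Z"
    "plus_mor C E E (cmp C E X E i1 p1) (cmp C E Z E i2 p2) = idm C E"
    using b unfolding is_biproduct_def by blast
  have "cmp C (Om C X) (Om C E) (Om C X) (Om_mor C E X p1) (Om_mor C X E i1) = idm C (Om C X)"
    using O * Om_cmp[of X E X i1 p1] by (simp add: Om_id)
  moreover have "cmp C (Om C Z) (Om C E) (Om C Z) (Om_mor C E Z p2) (Om_mor C Z E i2) = idm C (Om C Z)"
    using O * Om_cmp[of Z E Z i2 p2] by (simp add: Om_id)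
  moreover have "plus_mor C (Om C E) (Om C E)
      (cmp C (Om C E) (Om C X) (Om C E) (Om_mor C X E i1) (Om_mor C E X p1))
      (cmp C (Om C E) (Om C Z) (Om C E) (Om_mor C Z E i2) (Om_mor C E Z p2)) = idm C (Om C E)"
    using O * Om_cmp[of E X E p1 i1] Om_cmp[of E Z E p2 i2]
      Om_plus[of E E "cmp C E X E i1 p1" "cmp C E Z E i2 p2"] by (simp add: Om_id cmp_Mor)
  ultimately show ?thesis
    unfolding is_biproduct_def using O *(1-5) Om_Mor Om_Ob by blast
qed

section \<open>The stabilization\<close>

lemma pow_Ob: "X \<in> Ob C \<Longrightarrow> (Om C ^^ r) X \<in> Ob C"
  by (induction r) (auto simp: Om_Ob)

lemma pow_Mor: "X \<in> Ob C \<Longrightarrow> Y \<in> Ob C \<Longrightarrow> f \<in> Mor C X Y \<Longrightarrow>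
    Om_mor_pow C r X Y f \<in> Mor C ((Om C ^^ r) X) ((Om C ^^ r) Y)"
  by (induction r) (auto simp: Om_Mor pow_Ob)

lemma pow_id: "X \<in> Ob C \<Longrightarrow> Om_mor_pow C r X X (idm C X) = idm C ((Om C ^^ r) X)"
  by (induction r) (auto simp: Om_id pow_Ob)

lemma pow_cmp: "\<lbrakk>X \<in> Ob C; Y \<in> Ob C; Z \<in> Ob C; f \<in> Mor C X Y; g \<in> Mor C Y Z\<rbrakk> \<Longrightarrow>
    Om_mor_pow C r X Z (cmp C X Y Z g f) =
      cmp C ((Om C ^^ r) X) ((Om C ^^ r) Y) ((Om C ^^ r) Z) (Om_mor_pow C r Y Z g) (Om_mor_pow C r X Y f)"
  by (induction r) (auto simp: Om_cmp pow_Ob pow_Mor)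

lemma pow_plus: "\<lbrakk>X \<in> Ob C; Y \<in> Ob C; f \<in> Mor C X Y; g \<in> Mor C X Y\<rbrakk> \<Longrightarrow>
    Om_mor_pow C r X Y (plus_mor C X Y f g) =
      plus_mor C ((Om C ^^ r) X) ((Om C ^^ r) Y) (Om_mor_pow C r X Y f) (Om_mor_pow C r X Y g)"
  by (induction r) (auto simp: Om_plus pow_Ob pow_Mor)

lemma pow_pow: "Om_mor_pow C s ((Om C ^^ r) X) ((Om C ^^ r) Y) (Om_mor_pow C r X Y f) = Om_mor_pow C (s + r) X Y f"
  by (induction s) (auto simp: funpow_add)

abbreviation lo where "lo \<equiv> lift_ob C"

text \<open>\<open>up X m Y n i l f\<close> moves a morphism \<open>f\<close> at level \<open>i\<close>, between the lifts of \<open>(X, m)\<close> and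
  \<open>(Y, n)\<close>, to the level \<open>l\<close>.\<close>

definition up where
  "up X m Y n i l f = Om_mor_pow C (nat (l - i)) (lo X m i) (lo Y n i) f"

lemma lo_Ob: "X \<in> Ob C \<Longrightarrow> lo X m j \<in> Ob C"
  by (simp add: lift_ob_def pow_Ob)

lemma lo_self [simp]: "lo X m m = X"
  by (simp add: lift_ob_def)

lemma lo_shift: "m \<le> i \<Longrightarrow> i \<le> l \<Longrightarrow> (Om C ^^ nat (l - i)) (lo X m i) = lo X m l"
proof -
  assume "m \<le> i" "i \<le> l"
  then have "nat (l - m) = nat (l - i) + nat (i - m)" by simp
  then show ?thesis by (simp add: lift_ob_def funpow_add)
qed

lemma lo_Suc: "m \<le> i \<Longrightarrow> lo X m (i + 1) = Om C (lo X m i)"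
  using lo_shift[of m i "i + 1" X] by simp

lemma lo_prev: "m \<le> i \<Longrightarrow> lo X (m - 1) i = Om C (lo X m i)"
proof -
  assume "m \<le> i"
  then have "nat (i - (m - 1)) = Suc (nat (i - m))" by simp
  then show ?thesis by (simp add: lift_ob_def)
qed

lemma up_Mor:
  assumes "X \<in> Ob C" "Y \<in> Ob C" "m \<le> i" "n \<le> i" "i \<le> l" "f \<in> Mor C (lo X m i) (lo Y n i)"
  shows "up X m Y n i l f \<in> Mor C (lo X m l) (lo Y n l)"
  using pow_Mor[OF lo_Ob[OF assms(1)] lo_Ob[OF assms(2)] assms(6), of "nat (l - i)"] assms
  by (simp add: up_def lo_shift)

lemma up_self [simp]: "up X m Y n i i f = f"
  by (simp add: up_def)

lemma up_up:
  assumes "m \<le> i" "n \<le> i" "i \<le> l" "l \<le> k"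
  shows "up X m Y n l k (up X m Y n i l f) = up X m Y n i k f"
proof -
  have "nat (k - i) = nat (k - l) + nat (l - i)" using assms by simp
  then show ?thesis
    using pow_pow[of "nat (k - l)" "nat (l - i)" "lo X m i" "lo Y n i" f] assms
    by (simp add: up_def lo_shift)
qed

lemma up_id: "X \<in> Ob C \<Longrightarrow> m \<le> i \<Longrightarrow> i \<le> l \<Longrightarrow> up X m X m i l (idm C (lo X m i)) = idm C (lo X m l)"
  by (simp add: up_def pow_id lo_Ob lo_shift)

lemma up_cmp:
  "\<lbrakk>X \<in> Ob C; Y \<in> Ob C; Z \<in> Ob C; m \<le> i; n \<le> i; k \<le> i; i \<le> l;
    f \<in> Mor C (lo X m i) (lo Y n i); g \<in> Mor C (lo Y n i) (lo Z k i)\<rbrakk> \<Longrightarrow>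
   up X m Z k i l (cmp C (lo X m i) (lo Y n i) (lo Z k i) g f) =
     cmp C (lo X m l) (lo Y n l) (lo Z k l) (up Y n Z k i l g) (up X m Y n i l f)"
  by (simp add: up_def pow_cmp lo_Ob lo_shift)

lemma up_plus:
  "\<lbrakk>X \<in> Ob C; Y \<in> Ob C; m \<le> i; n \<le> i; i \<le> l;
    f \<in> Mor C (lo X m i) (lo Y n i); g \<in> Mor C (lo X m i) (lo Y n i)\<rbrakk> \<Longrightarrow>
   up X m Y n i l (plus_mor C (lo X m i) (lo Y n i) f g) =
     plus_mor C (lo X m l) (lo Y n l) (up X m Y n i l f) (up X m Y n i l g)"
  by (simp add: up_def pow_plus lo_Ob lo_shift)

lemma in_germs: "(j, f) \<in> germs C (X, m) (Y, n) \<longleftrightarrow> m \<le> j \<and> n \<le> j \<and> f \<in> Mor C (lo X m j) (lo Y n j)"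
  by (simp add: germs_def)

lemma in_germ_rel: "((i, f), (j, g)) \<in> germ_rel C (X, m) (Y, n) \<longleftrightarrow>
   (i, f) \<in> germs C (X, m) (Y, n) \<and> (j, g) \<in> germs C (X, m) (Y, n) \<and>
   (\<exists>l. i \<le> l \<and> j \<le> l \<and> up X m Y n i l f = up X m Y n j l g)"
  by (simp add: germ_rel_def up_def)

lemma up_eq_mono:
  assumes "(i, f) \<in> germs C (X, m) (Y, n)" "(j, g) \<in> germs C (X, m) (Y, n)" "i \<le> l" "j \<le> l" "l \<le> k"
    "up X m Y n i l f = up X m Y n j l g"
  shows "up X m Y n i k f = up X m Y n j k g"
  using assms up_up[of m i n l k X Y f] up_up[of m j n l k X Y g] by (simp add: in_germs)

lemma equiv_germ_rel: "equiv (germs C (X, m) (Y, n)) (germ_rel C (X, m) (Y, n))"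
proof (rule equivI)
  show "germ_rel C (X, m) (Y, n) \<subseteq> germs C (X, m) (Y, n) \<times> germs C (X, m) (Y, n)"
    by (auto simp: in_germ_rel)
  show "refl_on (germs C (X, m) (Y, n)) (germ_rel C (X, m) (Y, n))"
    by (rule refl_onI) (auto simp: in_germ_rel)
  show "sym (germ_rel C (X, m) (Y, n))"
    by (rule symI) (auto simp: in_germ_rel, metis)
  show "trans (germ_rel C (X, m) (Y, n))"
  proof (rule transI, clarify)
    fix i f j g k h
    assume 1: "((i, f), (j, g)) \<in> germ_rel C (X, m) (Y, n)" and 2: "((j, g), (k, h)) \<in> germ_rel C (X, m) (Y, n)"
    then obtain a b where a: "i \<le> a" "j \<le> a" "up X m Y n i a f = up X m Y n j a g"
      and b: "j \<le> b" "k \<le> b" "up X m Y n j b g = up X m Y n k b h" by (auto simp: in_germ_rel)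
    have g: "(i, f) \<in> germs C (X, m) (Y, n)" "(j, g) \<in> germs C (X, m) (Y, n)" "(k, h) \<in> germs C (X, m) (Y, n)"
      using 1 2 by (auto simp: in_germ_rel)
    let ?l = "max a b"
    have "up X m Y n i ?l f = up X m Y n k ?l h"
      using up_eq_mono[OF g(1,2) a(1,2) _ a(3), of ?l] up_eq_mono[OF g(2,3) b(1,2) _ b(3), of ?l] by simp
    then show "((i, f), (k, h)) \<in> germ_rel C (X, m) (Y, n)"
      using g a b by (auto simp: in_germ_rel intro!: exI[of _ ?l])
  qed
qed

abbreviation S where "S \<equiv> stabilization C"

text \<open>The morphism of the stabilization with germ \<open>(i, f)\<close>.\<close>

definition gc where "gc X m Y n i f = germ_rel C (X, m) (Y, n) `` {(i, f)}"

lemma gc_eq_iff: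
  assumes "(i, f) \<in> germs C (X, m) (Y, n)" "(j, g) \<in> germs C (X, m) (Y, n)"
  shows "gc X m Y n i f = gc X m Y n j g \<longleftrightarrow> (\<exists>l. i \<le> l \<and> j \<le> l \<and> up X m Y n i l f = up X m Y n j l g)"
  unfolding gc_def eq_equiv_class_iff[OF equiv_germ_rel assms] using assms by (simp add: in_germ_rel)

lemma gc_eqI:
  "((i, f), (j, g)) \<in> germ_rel C (X, m) (Y, n) \<Longrightarrow> gc X m Y n i f = gc X m Y n j g"
  unfolding gc_def by (rule equiv_class_eq[OF equiv_germ_rel])

lemma in_gc: "(j, g) \<in> gc X m Y n i f \<longleftrightarrow> ((i, f), (j, g)) \<in> germ_rel C (X, m) (Y, n)"
  by (simp add: gc_def)

lemma gc_self: "(i, f) \<in> germs C (X, m) (Y, n) \<Longrightarrow> (i, f) \<in> gc X m Y n i f"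
  by (auto simp: in_gc in_germ_rel)

lemma up_germ:
  "X \<in> Ob C \<Longrightarrow> Y \<in> Ob C \<Longrightarrow> i \<le> l \<Longrightarrow> (i, f) \<in> germs C (X, m) (Y, n) \<Longrightarrow>
   (l, up X m Y n i l f) \<in> germs C (X, m) (Y, n)"
  by (auto simp: in_germs up_Mor)

lemma gc_up:
  "X \<in> Ob C \<Longrightarrow> Y \<in> Ob C \<Longrightarrow> i \<le> l \<Longrightarrow> (i, f) \<in> germs C (X, m) (Y, n) \<Longrightarrow>
   gc X m Y n l (up X m Y n i l f) = gc X m Y n i f"
  by (subst gc_eq_iff[OF up_germ]) (auto intro!: exI[of _ l])

lemma S_Ob: "(X, m) \<in> Ob S \<longleftrightarrow> X \<in> Ob C"
  by (simp add: stabilization_def)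

lemma S_Mor: "u \<in> Mor S (X, m) (Y, n) \<longleftrightarrow> (\<exists>i f. (i, f) \<in> germs C (X, m) (Y, n) \<and> u = gc X m Y n i f)"
  by (auto simp: stabilization_def quotient_def gc_def)

lemma S_Mor_level:
  assumes "X \<in> Ob C" "Y \<in> Ob C" "u \<in> Mor S (X, m) (Y, n)"
  obtains i where "\<And>l. i \<le> l \<Longrightarrow> \<exists>f. (l, f) \<in> germs C (X, m) (Y, n) \<and> u = gc X m Y n l f"
proof -
  obtain i f where "(i, f) \<in> germs C (X, m) (Y, n)" "u = gc X m Y n i f" using assms(3) by (auto simp: S_Mor)
  then show ?thesis using that[of i] gc_up[OF assms(1,2)] up_germ[OF assms(1,2)] by metis
qed

lemma S_idm:
  assumes "X \<in> Ob C" "m \<le> i"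
  shows "idm S (X, m) = gc X m X m i (idm C (lo X m i))"
proof -
  have "idm S (X, m) = gc X m X m m (idm C (lo X m m))"
    by (simp add: stabilization_def gc_def)
  also have "\<dots> = gc X m X m i (idm C (lo X m i))"
    using gc_up[OF assms(1,1) assms(2), of "idm C (lo X m m)" m m] up_id[OF assms(1) order_refl assms(2)] assms
    by (simp add: in_germs idm_Mor)
  finally show ?thesis .
qed

lemma S_cmp:
  assumes O: "X \<in> Ob C" "Y \<in> Ob C" "Z \<in> Ob C"
    and f: "(i, f) \<in> germs C (X, m) (Y, n)" and g: "(i, g) \<in> germs C (Y, n) (Z, k)"
  shows "cmp S (X, m) (Y, n) (Z, k) (gc Y n Z k i g) (gc X m Y n i f) =
    gc X m Z k i (cmp C (lo X m i) (lo Y n i) (lo Z k i) g f)"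
proof -
  have *: "gc X m Z k j (cmp C (lo X m j) (lo Y n j) (lo Z k j) g' f') =
      gc X m Z k i (cmp C (lo X m i) (lo Y n i) (lo Z k i) g f)"
    if f': "(j, f') \<in> gc X m Y n i f" and g': "(j, g') \<in> gc Y n Z k i g" for j f' g'
  proof -
    have fg: "(j, f') \<in> germs C (X, m) (Y, n)" "(j, g') \<in> germs C (Y, n) (Z, k)"
      using f' g' by (auto simp: in_gc in_germ_rel)
    obtain a where a: "i \<le> a" "j \<le> a" "up X m Y n i a f = up X m Y n j a f'"
      using f' by (auto simp: in_gc in_germ_rel)
    obtain b where b: "i \<le> b" "j \<le> b" "up Y n Z k i b g = up Y n Z k j b g'"
      using g' by (auto simp: in_gc in_germ_rel)
    let ?l = "max a b"
    have "up X m Y n i ?l f = up X m Y n j ?l f'" "up Y n Z k i ?l g = up Y n Z k j ?l g'"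
      using up_eq_mono[OF f fg(1) a(1,2) _ a(3), of ?l] up_eq_mono[OF g fg(2) b(1,2) _ b(3), of ?l] by simp_all
    then show ?thesis
      using O f g fg a b up_cmp[OF O, of m i n k ?l f g] up_cmp[OF O, of m j n k ?l f' g']
      by (intro gc_eqI) (auto simp: in_germ_rel in_germs cmp_Mor lo_Ob intro!: exI[of _ ?l])
  qed
  have "cmp S (X, m) (Y, n) (Z, k) (gc Y n Z k i g) (gc X m Y n i f) =
    (\<Union>(j, f', g') \<in> {(j, f', g'). (j, f') \<in> gc X m Y n i f \<and> (j, g') \<in> gc Y n Z k i g}.
       gc X m Z k j (cmp C (lo X m j) (lo Y n j) (lo Z k j) g' f'))" (is "_ = ?U")
    by (simp add: stabilization_def gc_def)
  also have "?U = gc X m Z k i (cmp C (lo X m i) (lo Y n i) (lo Z k i) g f)" (is "_ = ?R")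
  proof (intro equalityI subsetI)
    fix t assume "t \<in> ?U"
    then obtain j f' g' where "(j, f') \<in> gc X m Y n i f" "(j, g') \<in> gc Y n Z k i g"
      "t \<in> gc X m Z k j (cmp C (lo X m j) (lo Y n j) (lo Z k j) g' f')" by blast
    then show "t \<in> ?R" using *[of j f' g'] by simp
  next
    fix t assume "t \<in> ?R"
    then show "t \<in> ?U" using gc_self[OF f] gc_self[OF g] by blast
  qed
  finally show ?thesis .
qed

lemma S_plus:
  assumes O: "X \<in> Ob C" "Y \<in> Ob C"
    and f: "(i, f) \<in> germs C (X, m) (Y, n)" and g: "(i, g) \<in> germs C (X, m) (Y, n)"
  shows "plus_mor S (X, m) (Y, n) (gc X m Y n i f) (gc X m Y n i g) =
    gc X m Y n i (plus_mor C (lo X m i) (lo Y n i) f g)"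
proof -
  have *: "gc X m Y n j (plus_mor C (lo X m j) (lo Y n j) f' g') =
      gc X m Y n i (plus_mor C (lo X m i) (lo Y n i) f g)"
    if f': "(j, f') \<in> gc X m Y n i f" and g': "(j, g') \<in> gc X m Y n i g" for j f' g'
  proof -
    have fg: "(j, f') \<in> germs C (X, m) (Y, n)" "(j, g') \<in> germs C (X, m) (Y, n)"
      using f' g' by (auto simp: in_gc in_germ_rel)
    obtain a where a: "i \<le> a" "j \<le> a" "up X m Y n i a f = up X m Y n j a f'"
      using f' by (auto simp: in_gc in_germ_rel)
    obtain b where b: "i \<le> b" "j \<le> b" "up X m Y n i b g = up X m Y n j b g'"
      using g' by (auto simp: in_gc in_germ_rel)
    let ?l = "max a b"
    have "up X m Y n i ?l f = up X m Y n j ?l f'" "up X m Y n i ?l g = up X m Y n j ?l g'"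
      using up_eq_mono[OF f fg(1) a(1,2) _ a(3), of ?l] up_eq_mono[OF g fg(2) b(1,2) _ b(3), of ?l] by simp_all
    then show ?thesis
      using O f g fg a b up_plus[OF O, of m i n ?l f g] up_plus[OF O, of m j n ?l f' g']
      by (intro gc_eqI) (auto simp: in_germ_rel in_germs plus_Mor lo_Ob intro!: exI[of _ ?l])
  qed
  have "plus_mor S (X, m) (Y, n) (gc X m Y n i f) (gc X m Y n i g) =
    (\<Union>(j, f', g') \<in> {(j, f', g'). (j, f') \<in> gc X m Y n i f \<and> (j, g') \<in> gc X m Y n i g}.
       gc X m Y n j (plus_mor C (lo X m j) (lo Y n j) f' g'))" (is "_ = ?U")
    by (simp add: stabilization_def gc_def)
  also have "?U = gc X m Y n i (plus_mor C (lo X m i) (lo Y n i) f g)" (is "_ = ?R")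
  proof (intro equalityI subsetI)
    fix t assume "t \<in> ?U"
    then obtain j f' g' where "(j, f') \<in> gc X m Y n i f" "(j, g') \<in> gc X m Y n i g"
      "t \<in> gc X m Y n j (plus_mor C (lo X m j) (lo Y n j) f' g')" by blast
    then show "t \<in> ?R" using *[of j f' g'] by simp
  next
    fix t assume "t \<in> ?R"
    then show "t \<in> ?U" using gc_self[OF f] gc_self[OF g] by blast
  qed
  finally show ?thesis .
qed

lemma biproduct_from_level:
  assumes O: "X \<in> Ob C" "Z \<in> Ob C" "E \<in> Ob C" and l: "m \<le> j" "k \<le> j" "n \<le> j"
    and b: "is_biproduct C (lo X m j) (lo Z k j) (lo E n j)"
  shows "is_biproduct S (X, m) (Z, k) (E, n)"
proof -
  let ?X = "lo X m j" and ?Z = "lo Z k j" and ?E = "lo E n j"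
  obtain i1 i2 p1 p2 where *: "i1 \<in> Mor C ?X ?E" "i2 \<in> Mor C ?Z ?E" "p1 \<in> Mor C ?E ?X" "p2 \<in> Mor C ?E ?Z"
    "cmp C ?X ?E ?X p1 i1 = idm C ?X" "cmp C ?Z ?E ?Z p2 i2 = idm C ?Z"
    "plus_mor C ?E ?E (cmp C ?E ?X ?E i1 p1) (cmp C ?E ?Z ?E i2 p2) = idm C ?E"
    using b unfolding is_biproduct_def by blast
  have g: "(j, i1) \<in> germs C (X, m) (E, n)" "(j, i2) \<in> germs C (Z, k) (E, n)"
    "(j, p1) \<in> germs C (E, n) (X, m)" "(j, p2) \<in> germs C (E, n) (Z, k)"
    using * l by (auto simp: in_germs)
  have c: "(j, cmp C ?E ?X ?E i1 p1) \<in> germs C (E, n) (E, n)" "(j, cmp C ?E ?Z ?E i2 p2) \<in> germs C (E, n) (E, n)"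
    using * l O by (auto simp: in_germs cmp_Mor lo_Ob)
  have "cmp S (X, m) (E, n) (X, m) (gc E n X m j p1) (gc X m E n j i1) = idm S (X, m)"
    using S_cmp[OF O(1,3,1) g(1,3)] * S_idm[OF O(1) l(1)] by simp
  moreover have "cmp S (Z, k) (E, n) (Z, k) (gc E n Z k j p2) (gc Z k E n j i2) = idm S (Z, k)"
    using S_cmp[OF O(2,3,2) g(2,4)] * S_idm[OF O(2) l(2)] by simp
  moreover have "plus_mor S (E, n) (E, n) (cmp S (E, n) (X, m) (E, n) (gc X m E n j i1) (gc E n X m j p1))
      (cmp S (E, n) (Z, k) (E, n) (gc Z k E n j i2) (gc E n Z k j p2)) = idm S (E, n)"
    using S_cmp[OF O(3,1,3) g(3,1)] S_cmp[OF O(3,2,3) g(4,2)] S_plus[OF O(3,3) c] * S_idm[OF O(3) l(3)] by simp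
  moreover have "gc X m E n j i1 \<in> Mor S (X, m) (E, n)" "gc Z k E n j i2 \<in> Mor S (Z, k) (E, n)"
    "gc E n X m j p1 \<in> Mor S (E, n) (X, m)" "gc E n Z k j p2 \<in> Mor S (E, n) (Z, k)"
    using g S_Mor by blast+
  ultimately show ?thesis unfolding is_biproduct_def using O(3) S_Ob by blast
qed

text \<open>Each of the three equations of a biproduct of germs holds from some level on. The level can be
  chosen above any bound \<open>b\<close>.\<close>

lemma biproduct_to_level:
  assumes O: "X \<in> Ob C" "Z \<in> Ob C" "E \<in> Ob C"
    and b: "is_biproduct S (X, m) (Z, k) (E, n)"
  obtains j where "b \<le> j" "m \<le> j" "k \<le> j" "n \<le> j" "is_biproduct C (lo X m j) (lo Z k j) (lo E n j)"
proof -
  obtain u1 u2 v1 v2 where *: "u1 \<in> Mor S (X, m) (E, n)" "u2 \<in> Mor S (Z, k) (E, n)"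
    "v1 \<in> Mor S (E, n) (X, m)" "v2 \<in> Mor S (E, n) (Z, k)"
    "cmp S (X, m) (E, n) (X, m) v1 u1 = idm S (X, m)" "cmp S (Z, k) (E, n) (Z, k) v2 u2 = idm S (Z, k)"
    "plus_mor S (E, n) (E, n) (cmp S (E, n) (X, m) (E, n) u1 v1) (cmp S (E, n) (Z, k) (E, n) u2 v2) = idm S (E, n)"
    using b unfolding is_biproduct_def by blast
  obtain a1 where a1: "\<And>l. a1 \<le> l \<Longrightarrow> \<exists>f. (l, f) \<in> germs C (X, m) (E, n) \<and> u1 = gc X m E n l f"
    using S_Mor_level[OF O(1,3) *(1)] by blast
  obtain a2 where a2: "\<And>l. a2 \<le> l \<Longrightarrow> \<exists>f. (l, f) \<in> germs C (Z, k) (E, n) \<and> u2 = gc Z k E n l f"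
    using S_Mor_level[OF O(2,3) *(2)] by blast
  obtain a3 where a3: "\<And>l. a3 \<le> l \<Longrightarrow> \<exists>f. (l, f) \<in> germs C (E, n) (X, m) \<and> v1 = gc E n X m l f"
    using S_Mor_level[OF O(3,1) *(3)] by blast
  obtain a4 where a4: "\<And>l. a4 \<le> l \<Longrightarrow> \<exists>f. (l, f) \<in> germs C (E, n) (Z, k) \<and> v2 = gc E n Z k l f"
    using S_Mor_level[OF O(3,2) *(4)] by blast
  define i where "i = Max {a1, a2, a3, a4, b}"
  have i: "a1 \<le> i" "a2 \<le> i" "a3 \<le> i" "a4 \<le> i" "b \<le> i" by (auto simp: i_def)
  obtain i1 where i1: "(i, i1) \<in> germs C (X, m) (E, n)" "u1 = gc X m E n i i1" using a1[OF i(1)] by blast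
  obtain i2 where i2: "(i, i2) \<in> germs C (Z, k) (E, n)" "u2 = gc Z k E n i i2" using a2[OF i(2)] by blast
  obtain p1 where p1: "(i, p1) \<in> germs C (E, n) (X, m)" "v1 = gc E n X m i p1" using a3[OF i(3)] by blast
  obtain p2 where p2: "(i, p2) \<in> germs C (E, n) (Z, k)" "v2 = gc E n Z k i p2" using a4[OF i(4)] by blast
  have le: "m \<le> i" "k \<le> i" "n \<le> i" and M: "i1 \<in> Mor C (lo X m i) (lo E n i)" "i2 \<in> Mor C (lo Z k i) (lo E n i)"
    "p1 \<in> Mor C (lo E n i) (lo X m i)" "p2 \<in> Mor C (lo E n i) (lo Z k i)"
    using i1 i2 p1 p2 by (auto simp: in_germs)
  let ?X = "lo X m" and ?Z = "lo Z k" and ?E = "lo E n"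
  let ?c1 = "cmp C (?X i) (?E i) (?X i) p1 i1" and ?c2 = "cmp C (?Z i) (?E i) (?Z i) p2 i2"
  let ?d1 = "cmp C (?E i) (?X i) (?E i) i1 p1" and ?d2 = "cmp C (?E i) (?Z i) (?E i) i2 p2"
  note cm = cmp_Mor[OF lo_Ob lo_Ob lo_Ob]
  have gm: "(i, ?c1) \<in> germs C (X, m) (X, m)" "(i, ?c2) \<in> germs C (Z, k) (Z, k)"
    "(i, ?d1) \<in> germs C (E, n) (E, n)" "(i, ?d2) \<in> germs C (E, n) (E, n)"
    "(i, plus_mor C (?E i) (?E i) ?d1 ?d2) \<in> germs C (E, n) (E, n)"
    "(i, idm C (?X i)) \<in> germs C (X, m) (X, m)" "(i, idm C (?Z i)) \<in> germs C (Z, k) (Z, k)"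
    "(i, idm C (?E i)) \<in> germs C (E, n) (E, n)"
    using O M le by (auto simp: in_germs cm idm_Mor lo_Ob plus_Mor)
  have "gc X m X m i ?c1 = gc X m X m i (idm C (?X i))"
    using *(5) i1 p1 S_cmp[OF O(1,3,1) i1(1) p1(1)] S_idm[OF O(1) le(1)] by simp
  then obtain l1 where l1: "i \<le> l1" "up X m X m i l1 ?c1 = up X m X m i l1 (idm C (?X i))"
    unfolding gc_eq_iff[OF gm(1,6)] by blast
  have "gc Z k Z k i ?c2 = gc Z k Z k i (idm C (?Z i))"
    using *(6) i2 p2 S_cmp[OF O(2,3,2) i2(1) p2(1)] S_idm[OF O(2) le(2)] by simp
  then obtain l2 where l2: "i \<le> l2" "up Z k Z k i l2 ?c2 = up Z k Z k i l2 (idm C (?Z i))"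
    unfolding gc_eq_iff[OF gm(2,7)] by blast
  have "gc E n E n i (plus_mor C (?E i) (?E i) ?d1 ?d2) = gc E n E n i (idm C (?E i))"
    using *(7) i1 i2 p1 p2 S_cmp[OF O(3,1,3) p1(1) i1(1)] S_cmp[OF O(3,2,3) p2(1) i2(1)]
      S_plus[OF O(3,3) gm(3,4)] S_idm[OF O(3) le(3)] by simp
  then obtain l3 where l3: "i \<le> l3"
      "up E n E n i l3 (plus_mor C (?E i) (?E i) ?d1 ?d2) = up E n E n i l3 (idm C (?E i))"
    unfolding gc_eq_iff[OF gm(5,8)] by blast
  define l where "l = Max {l1, l2, l3}"
  have l: "l1 \<le> l" "l2 \<le> l" "l3 \<le> l" and il: "i \<le> l" using l1(1) by (auto simp: l_def)
  note u = up_eq_mono[OF gm(1,6) l1(1,1) l(1) l1(2)] up_eq_mono[OF gm(2,7) l2(1,1) l(2) l2(2)]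
    up_eq_mono[OF gm(5,8) l3(1,1) l(3) l3(2)]
  have dM: "?d1 \<in> Mor C (?E i) (?E i)" "?d2 \<in> Mor C (?E i) (?E i)" using gm by (auto simp: in_germs)
  have "cmp C (?X l) (?E l) (?X l) (up E n X m i l p1) (up X m E n i l i1) = idm C (?X l)"
    using u(1) up_cmp[OF O(1,3,1) le(1,3,1) il M(1,3)] up_id[OF O(1) le(1) il] by simp
  moreover have "cmp C (?Z l) (?E l) (?Z l) (up E n Z k i l p2) (up Z k E n i l i2) = idm C (?Z l)"
    using u(2) up_cmp[OF O(2,3,2) le(2,3,2) il M(2,4)] up_id[OF O(2) le(2) il] by simp
  moreover have "plus_mor C (?E l) (?E l) (cmp C (?E l) (?X l) (?E l) (up X m E n i l i1) (up E n X m i l p1))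
     (cmp C (?E l) (?Z l) (?E l) (up Z k E n i l i2) (up E n Z k i l p2)) = idm C (?E l)"
    using u(3) up_plus[OF O(3,3) le(3,3) il dM] up_cmp[OF O(3,1,3) le(3,1,3) il M(3,1)]
      up_cmp[OF O(3,2,3) le(3,2,3) il M(4,2)] up_id[OF O(3) le(3) il] by simp
  ultimately have "is_biproduct C (?X l) (?Z l) (?E l)"
    unfolding is_biproduct_def
    using lo_Ob[OF O(3)] up_Mor[OF O(1,3) le(1,3) il M(1)] up_Mor[OF O(2,3) le(2,3) il M(2)]
      up_Mor[OF O(3,1) le(3,1) il M(3)] up_Mor[OF O(3,2) le(3,2) il M(4)] by blast
  then show ?thesis using that[of l] le il i(5) by simp
qed

end

section \<open>Short exact sequences\<close>

text \<open>Existence of a short exact sequence with the given terms.\<close>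

definition ses :: "('k, 'a) module \<Rightarrow> ('a, 'u) module \<Rightarrow> ('a, 'v) module \<Rightarrow> ('a, 'w) module \<Rightarrow> bool" where
  "ses A U V W \<longleftrightarrow> (\<exists>f g. short_exact A U V W f g)"

lemma short_exactD:
  assumes "short_exact A U V W f g"
  shows "f \<in> lmod_hom A U V" "g \<in> lmod_hom A V W" "inj_on f (carrier U)"
    "f ` carrier U = a_kernel V W g" "g ` carrier V = carrier W"
    "\<And>x. x \<in> carrier U \<Longrightarrow> g (f x) = \<zero>\<^bsub>W\<^esub>"
    "\<And>v. v \<in> carrier V \<Longrightarrow> g v = \<zero>\<^bsub>W\<^esub> \<Longrightarrow> \<exists>x\<in>carrier U. v = f x"
    "\<And>w. w \<in> carrier W \<Longrightarrow> \<exists>v\<in>carrier V. w = g v"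
  using assms unfolding short_exact_def a_kernel_eq by blast+

lemma short_exactI:
  assumes "f \<in> lmod_hom A U V" "g \<in> lmod_hom A V W" "inj_on f (carrier U)"
    "\<And>x. x \<in> carrier U \<Longrightarrow> g (f x) = \<zero>\<^bsub>W\<^esub>"
    "\<And>v. v \<in> carrier V \<Longrightarrow> g v = \<zero>\<^bsub>W\<^esub> \<Longrightarrow> \<exists>x\<in>carrier U. v = f x"
    "\<And>w. w \<in> carrier W \<Longrightarrow> \<exists>v\<in>carrier V. w = g v"
  shows "short_exact A U V W f g"
  unfolding short_exact_def a_kernel_eq
  using assms(1-3) hom_closed[OF assms(1)] hom_closed[OF assms(2)] assms(4-6)
  by (intro conjI) blast+

lemma ses_iso:
  assumes l: "left_module A U" "left_module A V" "left_module A W"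
      "left_module A U'" "left_module A V'" "left_module A W'"
    and s: "ses A U V W" and i: "lmod_iso A U U'" "lmod_iso A V V'" "lmod_iso A W W'"
  shows "ses A U' V' W'"
proof -
  obtain f g where "short_exact A U V W f g" using s by (auto simp: ses_def)
  note e = short_exactD[OF this]
  obtain a a' where a: "a \<in> lmod_hom A U U'" "a' \<in> lmod_hom A U' U" "\<forall>x\<in>carrier U. a' (a x) = x"
    "\<forall>x\<in>carrier U'. a (a' x) = x" using i(1) unfolding lmod_iso_def by blast
  obtain b b' where b: "b \<in> lmod_hom A V V'" "b' \<in> lmod_hom A V' V" "\<forall>x\<in>carrier V. b' (b x) = x"
    "\<forall>x\<in>carrier V'. b (b' x) = x" using i(2) unfolding lmod_iso_def by blast
  obtain c c' where c: "c \<in> lmod_hom A W W'" "c' \<in> lmod_hom A W' W" "\<forall>x\<in>carrier W. c' (c x) = x"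
    "\<forall>x\<in>carrier W'. c (c' x) = x" using i(3) unfolding lmod_iso_def by blast
  note h = hom_closed[OF a(1)] hom_closed[OF a(2)] hom_closed[OF b(1)] hom_closed[OF b(2)]
    hom_closed[OF c(1)] hom_closed[OF c(2)] hom_closed[OF e(1)] hom_closed[OF e(2)]
  let ?f = "compose (carrier U') (compose (carrier U) b f) a'"
  let ?g = "compose (carrier V') (compose (carrier V) c g) b'"
  have "short_exact A U' V' W' ?f ?g"
  proof (rule short_exactI)
    show "?f \<in> lmod_hom A U' V'" by (rule hom_compose[OF l(4) a(2) hom_compose[OF l(1) e(1) b(1)]])
    show "?g \<in> lmod_hom A V' W'" by (rule hom_compose[OF l(5) b(2) hom_compose[OF l(2) e(2) c(1)]])
    have "x = y" if "x \<in> carrier U'" "y \<in> carrier U'" "?f x = ?f y" for x y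
    proof -
      have "b (f (a' x)) = b (f (a' y))" using that h by (simp add: compose_pt)
      then have "f (a' x) = f (a' y)" using b(3) h that by metis
      then have "a' x = a' y" by (rule inj_onD[OF e(3) _ h(2)[OF that(1)] h(2)[OF that(2)]])
      then show ?thesis using a(4) that by metis
    qed
    then show "inj_on ?f (carrier U')" by (rule inj_onI)
    show "?g (?f x) = \<zero>\<^bsub>W'\<^esub>" if "x \<in> carrier U'" for x
      using that h b(3) e(6) hom_zero[OF l(3,6) c(1)] by (simp add: compose_pt)
    show "\<exists>x\<in>carrier U'. v = ?f x" if v: "v \<in> carrier V'" "?g v = \<zero>\<^bsub>W'\<^esub>" for v
    proof -
      have "c (g (b' v)) = \<zero>\<^bsub>W'\<^esub>" using v h by (simp add: compose_pt)
      then have "g (b' v) = c' \<zero>\<^bsub>W'\<^esub>" using c(3) h v by metis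
      then have "g (b' v) = \<zero>\<^bsub>W\<^esub>" using hom_zero[OF l(6,3) c(2)] by simp
      then obtain x where x: "x \<in> carrier U" "b' v = f x" using e(7)[OF h(4)[OF v(1)]] by blast
      then have "v = b (f x)" using b(4) v by metis
      then have "v = ?f (a x)" using x a(3) h by (simp add: compose_pt)
      then show ?thesis using h x by blast
    qed
    show "\<exists>v\<in>carrier V'. w = ?g v" if w: "w \<in> carrier W'" for w
    proof -
      obtain v where v: "v \<in> carrier V" "c' w = g v" using e(8)[OF h(6)[OF w]] by blast
      then have "w = c (g v)" using c(4) w by metis
      then have "w = ?g (b v)" using v b(3) h by (simp add: compose_pt)
      then show ?thesis using h v by blast
    qed
  qed
  then show ?thesis by (auto simp: ses_def)
qed

lemma ses_add_left:
  assumes l: "left_module A U" "left_module A V" "left_module A W" "left_module A P" and s: "ses A U V W"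
  shows "ses A (dsum U P) (dsum V P) W"
proof -
  obtain f g where "short_exact A U V W f g" using s by (auto simp: ses_def)
  note e = short_exactD[OF this]
  note h = hom_closed[OF e(1)] hom_closed[OF e(2)]
  let ?f = "\<lambda>p\<in>carrier (dsum U P). (f (fst p), snd p)" and ?g = "\<lambda>p\<in>carrier (dsum V P). g (fst p)"
  have "short_exact A (dsum U P) (dsum V P) W ?f ?g"
  proof (rule short_exactI)
    show "?f \<in> lmod_hom A (dsum U P) (dsum V P)"
      by (rule lmod_homI) (use l h in \<open>auto simp: left_module_dsum hom_add[OF e(1)] hom_smult[OF e(1)]\<close>)
    show "?g \<in> lmod_hom A (dsum V P) W"
      by (rule lmod_homI) (use l h in \<open>auto simp: left_module_dsum hom_add[OF e(2)] hom_smult[OF e(2)]\<close>)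
    show "inj_on ?f (carrier (dsum U P))" using inj_onD[OF e(3)] by (auto intro!: inj_onI)
    show "?g (?f x) = \<zero>\<^bsub>W\<^esub>" if "x \<in> carrier (dsum U P)" for x using that h e(6) by auto
    show "\<exists>x\<in>carrier (dsum U P). v = ?f x" if v: "v \<in> carrier (dsum V P)" "?g v = \<zero>\<^bsub>W\<^esub>" for v
    proof -
      obtain y p where y: "v = (y, p)" "y \<in> carrier V" "p \<in> carrier P" using v by auto
      then obtain x where "x \<in> carrier U" "y = f x" using e(7)[of y] v by auto
      then show ?thesis using y by (intro bexI[of _ "(x, p)"]) auto
    qed
    show "\<exists>v\<in>carrier (dsum V P). w = ?g v" if w: "w \<in> carrier W" for w
    proof -
      interpret P: left_module A P by (rule l)
      obtain v where "v \<in> carrier V" "w = g v" using e(8)[OF w] by blast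
      then show ?thesis by (intro bexI[of _ "(v, \<zero>\<^bsub>P\<^esub>)"]) auto
    qed
  qed
  then show ?thesis by (auto simp: ses_def)
qed

lemma ses_add_right:
  assumes l: "left_module A U" "left_module A V" "left_module A W" "left_module A P" and s: "ses A U V W"
  shows "ses A U (dsum V P) (dsum W P)"
proof -
  interpret P: left_module A P by (rule l)
  obtain f g where "short_exact A U V W f g" using s by (auto simp: ses_def)
  note e = short_exactD[OF this]
  note h = hom_closed[OF e(1)] hom_closed[OF e(2)]
  let ?f = "\<lambda>x\<in>carrier U. (f x, \<zero>\<^bsub>P\<^esub>)" and ?g = "\<lambda>p\<in>carrier (dsum V P). (g (fst p), snd p)"
  have "short_exact A U (dsum V P) (dsum W P) ?f ?g"
  proof (rule short_exactI)
    show "?f \<in> lmod_hom A U (dsum V P)"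
      by (rule lmod_homI) (use l h in \<open>auto simp: hom_add[OF e(1)] hom_smult[OF e(1)]\<close>)
    show "?g \<in> lmod_hom A (dsum V P) (dsum W P)"
      by (rule lmod_homI) (use l h in \<open>auto simp: left_module_dsum hom_add[OF e(2)] hom_smult[OF e(2)]\<close>)
    show "inj_on ?f (carrier U)" using inj_onD[OF e(3)] by (auto intro!: inj_onI)
    show "?g (?f x) = \<zero>\<^bsub>dsum W P\<^esub>" if "x \<in> carrier U" for x using that h e(6) by auto
    show "\<exists>x\<in>carrier U. v = ?f x" if v: "v \<in> carrier (dsum V P)" "?g v = \<zero>\<^bsub>dsum W P\<^esub>" for v
    proof -
      obtain y p where y: "v = (y, p)" "y \<in> carrier V" "p \<in> carrier P" using v by auto
      then obtain x where "x \<in> carrier U" "y = f x" "p = \<zero>\<^bsub>P\<^esub>" using e(7)[of y] v by auto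
      then show ?thesis using y by (intro bexI[of _ x]) auto
    qed
    show "\<exists>v\<in>carrier (dsum V P). w = ?g v" if w: "w \<in> carrier (dsum W P)" for w
    proof -
      obtain y p where y: "w = (y, p)" "y \<in> carrier W" "p \<in> carrier P" using w by auto
      obtain v where "v \<in> carrier V" "y = g v" using e(8)[OF y(2)] by blast
      then show ?thesis using y by (intro bexI[of _ "(v, p)"]) auto
    qed
  qed
  then show ?thesis by (auto simp: ses_def)
qed

context fd_universe
begin

subsection \<open>The connecting map and rotation\<close>

text \<open>The maps \<open>s\<close> and \<open>u\<close> that define the standard triangle of a short exact sequence.\<close>

lemma connecting:
  assumes F: "U \<in> FD" "V \<in> FD" "W \<in> FD" and ex: "short_exact A U V W f g"
  obtains s u where "s \<in> Hom (PC W) V" "\<forall>x\<in>carrier (PC W). g (s x) = pc W x"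
    "u \<in> Hom (Syz W) U" "\<forall>x\<in>carrier (Syz W). f (u x) = s x"
proof -
  note e = short_exactD[OF ex]
  note p = proj_cover[OF F(3)]
  obtain s where s: "s \<in> Hom (PC W) V" "\<forall>x\<in>carrier (PC W). g (s x) = pc W x"
    using proj_lift[OF p(1) F(2,3) e(2) p(2) e(5)] .
  interpret U: left_module A U using F(1) by (rule fdD)
  have "\<exists>y\<in>carrier U. s x = f y" if "x \<in> carrier (Syz W)" for x
    using e(7)[of "s x"] s hom_closed[OF s(1)] that by (auto simp: syz_carrier)
  then obtain v where v: "\<And>x. x \<in> carrier (Syz W) \<Longrightarrow> v x \<in> carrier U \<and> s x = f (v x)" by metis
  have inj: "y = z" if "y \<in> carrier U" "z \<in> carrier U" "f y = f z" for y z
    using inj_onD[OF e(3) that(3)] that by blast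
  have l: "lm (Syz W)" using syz_FD[OF F(3)] by (rule fdD)
  interpret S: left_module A "Syz W" by (rule l)
  have sm: "a \<odot>\<^bsub>Syz W\<^esub> x = a \<odot>\<^bsub>PC W\<^esub> x" for a x by (simp add: syz_def)
  have "restrict v (carrier (Syz W)) \<in> Hom (Syz W) U"
  proof (rule lmod_homI[OF l])
    fix x assume x: "x \<in> carrier (Syz W)"
    then show "v x \<in> carrier U" using v by blast
    show "v (x \<oplus>\<^bsub>Syz W\<^esub> y) = v x \<oplus>\<^bsub>U\<^esub> v y" if y: "y \<in> carrier (Syz W)" for y
    proof (rule inj)
      have "f (v (x \<oplus>\<^bsub>Syz W\<^esub> y)) = s (x \<oplus>\<^bsub>PC W\<^esub> y)"
        using v[OF S.M.a_closed[OF x y]] by (simp add: syz_add)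
      also have "\<dots> = f (v x) \<oplus>\<^bsub>V\<^esub> f (v y)"
        using v[OF x] v[OF y] syz_sub[OF x] syz_sub[OF y] by (simp add: hom_add[OF s(1)])
      finally show "f (v (x \<oplus>\<^bsub>Syz W\<^esub> y)) = f (v x \<oplus>\<^bsub>U\<^esub> v y)"
        using v[OF x] v[OF y] by (simp add: hom_add[OF e(1)])
    qed (use v x y S.M.a_closed[OF x y] in auto)
    show "v (a \<odot>\<^bsub>Syz W\<^esub> x) = a \<odot>\<^bsub>U\<^esub> v x" if a: "a \<in> carrier A" for a
    proof (rule inj)
      have "f (v (a \<odot>\<^bsub>Syz W\<^esub> x)) = s (a \<odot>\<^bsub>PC W\<^esub> x)"
        using v[OF S.act_closed[OF a x]] by (simp add: sm)
      also have "\<dots> = a \<odot>\<^bsub>V\<^esub> f (v x)"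
        using v[OF x] syz_sub[OF x] a by (simp add: hom_smult[OF s(1)])
      finally show "f (v (a \<odot>\<^bsub>Syz W\<^esub> x)) = f (a \<odot>\<^bsub>U\<^esub> v x)"
        using v[OF x] a by (simp add: hom_smult[OF e(1)])
    qed (use v x a S.act_closed[OF a x] U.act_closed in auto)
  qed
  then show ?thesis by (rule that[OF s]) (use v in auto)
qed

text \<open>The rotated sequence \<open>0 \<rightarrow> \<Omega> W \<rightarrow> U \<oplus> P \<rightarrow> V \<rightarrow> 0\<close>, where \<open>P\<close> is the projective cover of \<open>W\<close>, has the
  maps \<open>x \<mapsto> (u x, x)\<close> and \<open>(x, y) \<mapsto> s y - f x\<close>.\<close>

lemma ses_rotate:
  assumes F: "U \<in> FD" "V \<in> FD" "W \<in> FD" and s: "ses A U V W"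
    and E: "E \<in> FD" "biprod U (PC W) E i1 i2 p1 p2"
  shows "ses A (Syz W) E V"
proof -
  obtain f g where ex: "short_exact A U V W f g" using s by (auto simp: ses_def)
  note e = short_exactD[OF ex]
  obtain s u where s: "s \<in> Hom (PC W) V" "\<forall>x\<in>carrier (PC W). g (s x) = pc W x"
    and u: "u \<in> Hom (Syz W) U" "\<forall>x\<in>carrier (Syz W). f (u x) = s x" using connecting[OF F ex] .
  note p = proj_cover[OF F(3)]
  note l = fdD[OF F(1)] fdD[OF F(2)] fdD[OF F(3)] proj_lm[OF p(1)] fdD[OF E(1)] fdD[OF syz_FD[OF F(3)]]
  interpret U: left_module A U by (rule l)
  interpret V: left_module A V by (rule l)
  interpret W: left_module A W by (rule l)
  interpret E: left_module A E by (rule l)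
  interpret PW: left_module A "PC W" by (rule l)
  note b = biprodD[OF E(2)]
  let ?i = "\<lambda>x\<in>carrier (Syz W). x"
  have i: "?i \<in> Hom (Syz W) (PC W)" by (rule syz_incl[OF F(3)])
  note pr = hom_pair[OF l(1,4,5,6) E(2) u(1) i]
  let ?nf = "\<lambda>x\<in>carrier U. \<ominus>\<^bsub>V\<^esub> f x"
  have nf: "?nf \<in> Hom U V" by (rule hom_negmap[OF l(1,2) e(1)])
  note co = hom_copair[OF l(1,4,5,2) E(2) nf s(1)]
  let ?m = "\<lambda>x\<in>carrier (Syz W). i1 (u x) \<oplus>\<^bsub>E\<^esub> i2 (?i x)"
  let ?r = "\<lambda>z\<in>carrier E. ?nf (p1 z) \<oplus>\<^bsub>V\<^esub> s (p2 z)"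
  note h = hom_closed[OF b(1)] hom_closed[OF b(2)] hom_closed[OF b(3)] hom_closed[OF b(4)]
    hom_closed[OF e(1)] hom_closed[OF e(2)] hom_closed[OF s(1)] hom_closed[OF u(1)]
  have "short_exact A (Syz W) E V ?m ?r"
  proof (rule short_exactI[OF pr(1) co(1)])
    have p2m: "p2 (?m x) = x" if "x \<in> carrier (Syz W)" for x using pr(3)[OF that] that by simp
    show "inj_on ?m (carrier (Syz W))" by (rule inj_on_inverseI[where g = p2]) (rule p2m)
    show "?r (?m x) = \<zero>\<^bsub>V\<^esub>" if x: "x \<in> carrier (Syz W)" for x
      using hom_closed[OF pr(1) x] pr(2,3)[OF x] x u h syz_sub[OF x] by (simp add: V.M.l_neg)
    show "\<exists>x\<in>carrier (Syz W). z = ?m x" if z: "z \<in> carrier E" "?r z = \<zero>\<^bsub>V\<^esub>" for z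
    proof -
      let ?y = "p2 z"
      have y: "?y \<in> carrier (PC W)" and x: "p1 z \<in> carrier U" using z h by auto
      have "\<ominus>\<^bsub>V\<^esub> f (p1 z) \<oplus>\<^bsub>V\<^esub> s ?y = \<zero>\<^bsub>V\<^esub>" using z x by simp
      then have "s ?y \<oplus>\<^bsub>V\<^esub> \<ominus>\<^bsub>V\<^esub> f (p1 z) = \<zero>\<^bsub>V\<^esub>" using x y h by (simp add: V.M.a_comm)
      then have fs: "s ?y = f (p1 z)"
        using V.M.diff_eq_zero_iff[of "s ?y" "f (p1 z)"] x y h by (simp add: a_minus_def)
      then have "pc W ?y = \<zero>\<^bsub>W\<^esub>" using s(2) y e(6)[OF x] by metis
      then have yS: "?y \<in> carrier (Syz W)" using y by (simp add: syz_carrier)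
      then have "f (u ?y) = f (p1 z)" using u(2) fs by simp
      then have "u ?y = p1 z" by (rule inj_onD[OF e(3) _ h(8)[OF yS] x])
      then have "z = ?m ?y" using yS b(9)[OF z(1)] by simp
      then show ?thesis using yS by blast
    qed
    show "\<exists>z\<in>carrier E. v = ?r z" if v: "v \<in> carrier V" for v
    proof -
      obtain y where y: "y \<in> carrier (PC W)" "g v = pc W y" using p(3) h v by (metis imageE)
      have "g (v \<ominus>\<^bsub>V\<^esub> s y) = \<zero>\<^bsub>W\<^esub>" using v y h s(2) p(2) by (simp add: hom_diff[OF l(2,3) e(2)])
      then obtain x where x: "x \<in> carrier U" "v \<ominus>\<^bsub>V\<^esub> s y = f x" using e(7)[of "v \<ominus>\<^bsub>V\<^esub> s y"] v y h by auto
      let ?z = "i1 (\<ominus>\<^bsub>U\<^esub> x) \<oplus>\<^bsub>E\<^esub> i2 y"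
      have z: "?z \<in> carrier E" using x y h by simp
      have pz: "p1 ?z = \<ominus>\<^bsub>U\<^esub> x" "p2 ?z = y"
        using x y h b(5-8) by (auto simp: hom_add[OF b(3)] hom_add[OF b(4)])
      have "?r ?z = f x \<oplus>\<^bsub>V\<^esub> s y" using z pz x h by (simp add: hom_neg[OF l(1,2) e(1)])
      also have "\<dots> = v" using x(2)[symmetric] v y h by (simp add: V.M.diff_add_cancel)
      finally show ?thesis using z by (metis (no_types))
    qed
  qed
  then show ?thesis by (auto simp: ses_def)
qed

subsection \<open>Stable isomorphism as isomorphism in the stable category\<close>

lemma st_inv_is_iso:
  assumes F: "M \<in> FD" "N \<in> FD" and i: "st_inv M N f g"
  shows "is_iso SC M N (cls M N f)"
proof -
  have *: "f \<in> Hom M N" "g \<in> Hom N M" "st M M (cc M g f) (hid M)" "st N N (cc N f g) (hid N)"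
    using i by (auto simp: st_inv_def)
  show ?thesis unfolding is_iso_def
    using F * cls_eqI[OF F(1,1) *(3)] cls_eqI[OF F(2,2) *(4)]
    by (auto simp: SC_cmp cls_Mor intro!: bexI[of _ "cls N M g"])
qed

lemma is_iso_st_inv:
  assumes F: "M \<in> FD" "N \<in> FD" and i: "is_iso SC M N \<phi>"
  obtains f g where "st_inv M N f g"
proof -
  obtain \<psi> where *: "\<phi> \<in> Mor SC M N" "\<psi> \<in> Mor SC N M" "cmp SC M N M \<psi> \<phi> = idm SC M"
    "cmp SC N M N \<phi> \<psi> = idm SC N" using i unfolding is_iso_def by blast
  obtain f g where fg: "f \<in> Hom M N" "\<phi> = cls M N f" "g \<in> Hom N M" "\<psi> = cls N M g"
    using *(1,2)[unfolded SC_Mor] by blast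
  have "cls M M (cc M g f) = cls M M (hid M)" "cls N N (cc N f g) = cls N N (hid N)"
    using *(3,4) fg F by (simp_all add: SC_cmp)
  then have "st_inv M N f g"
    unfolding st_inv_def using fg F by (simp add: cls_eq cc_hom hid_hom)
  then show ?thesis by (rule that)
qed

text \<open>Isomorphic in the stable category.\<close>

definition isoc :: "('a, 'u) module \<Rightarrow> ('a, 'u) module \<Rightarrow> bool" where
  "isoc M N \<longleftrightarrow> (\<exists>\<phi>. is_iso SC M N \<phi>)"

lemma isoc_refl: "M \<in> FD \<Longrightarrow> isoc M M"
  using SC.iso_id[of M] by (auto simp: isoc_def)

lemma isoc_trans: "L \<in> FD \<Longrightarrow> M \<in> FD \<Longrightarrow> N \<in> FD \<Longrightarrow> isoc L M \<Longrightarrow> isoc M N \<Longrightarrow> isoc L N"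
  using SC.iso_trans[of L M N] by (auto simp: isoc_def)

lemma isoc_syz: "M \<in> FD \<Longrightarrow> N \<in> FD \<Longrightarrow> isoc M N \<Longrightarrow> isoc (Syz M) (Syz N)"
  using SC.iso_Om[of M N] by (auto simp: isoc_def)

lemma biprod_proj_st:
  assumes "M \<in> FD" "Proj P" "E \<in> FD" "biprod M P E i1 i2 p1 p2"
  shows "st E E (cc E i1 p1) (hid E)"
proof -
  note b = biprodD[OF assms(4)]
  have "st E E (hid E) (cc E i1 p1)"
    by (rule st_diff_factor[OF assms(3,3) hid_hom[OF assms(3)] cc_hom[OF assms(3) b(3,1)] assms(2) b(4,2)])
      (use b(9) in simp)
  then show ?thesis by (rule st_sym[OF assms(3,3)])
qed

lemma biprod_proj_isoc:
  assumes "M \<in> FD" "Proj P" "E \<in> FD" "biprod M P E i1 i2 p1 p2"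
  shows "isoc E M"
proof -
  note b = biprodD[OF assms(4)]
  have "cc M p1 i1 = hid M" by (rule extensionalityI[OF h_ext(1,2)]) (use b in simp)
  then have "st_inv E M p1 i1"
    unfolding st_inv_def using b biprod_proj_st[OF assms] assms st_refl hid_hom by auto
  then show ?thesis using st_inv_is_iso[OF assms(3,1)] by (auto simp: isoc_def)
qed

section \<open>Exact triangles up to isomorphism\<close>

text \<open>There is a short exact sequence with terms stably isomorphic to \<open>U\<close>, \<open>V\<close> and \<open>W\<close>; equivalently,
  \<open>\<Omega> W \<rightarrow> U \<rightarrow> V \<rightarrow> W\<close> with suitable maps is an exact triangle (\<open>exact_triangle_sxt\<close>,
  \<open>sxt_exact_triangle\<close>).\<close>

definition sxt :: "('a, 'u) module \<Rightarrow> ('a, 'u) module \<Rightarrow> ('a, 'u) module \<Rightarrow> bool" where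
  "sxt U V W \<longleftrightarrow> (\<exists>U'\<in>FD. \<exists>V'\<in>FD. \<exists>W'\<in>FD. ses A U' V' W' \<and> isoc U' U \<and> isoc V' V \<and> isoc W' W)"

lemma sxt_rotate:
  assumes F: "U \<in> FD" "V \<in> FD" "W \<in> FD" and s: "sxt U V W"
  shows "sxt (Syz W) U V"
proof -
  obtain U' V' W' where *: "U' \<in> FD" "V' \<in> FD" "W' \<in> FD" "ses A U' V' W'" "isoc U' U" "isoc V' V" "isoc W' W"
    using s by (auto simp: sxt_def)
  note p = proj_cover(1)[OF *(3)]
  obtain E i1 i2 p1 p2 where E: "E \<in> FD" "biprod U' (PC W') E i1 i2 p1 p2"
    using ex_biprod[OF *(1) proj_FD[OF p]] .
  have "isoc E U" by (rule isoc_trans[OF E(1) *(1) F(1) biprod_proj_isoc[OF *(1) p E] *(5)])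
  moreover have "isoc (Syz W') (Syz W)" by (rule isoc_syz[OF *(3) F(3) *(7)])
  ultimately show ?thesis
    unfolding sxt_def using ses_rotate[OF *(1-4) E] syz_FD[OF *(3)] E(1) *(2,6) by blast
qed

text \<open>Three rotations of \<open>U\<close>, \<open>V\<close>, \<open>W\<close> give their syzygies.\<close>

lemma sxt_syz:
  assumes F: "U \<in> FD" "V \<in> FD" "W \<in> FD" and s: "sxt U V W"
  shows "sxt (Syz U) (Syz V) (Syz W)"
  using sxt_rotate[OF syz_FD[OF F(2)] syz_FD[OF F(3)] F(1)
      sxt_rotate[OF syz_FD[OF F(3)] F(1,2) sxt_rotate[OF F s]]] .

lemma FD_pow: "M \<in> FD \<Longrightarrow> (Syz ^^ r) M \<in> FD"
  by (induction r) (auto simp: syz_FD)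

lemma sxt_pow:
  assumes F: "U \<in> FD" "V \<in> FD" "W \<in> FD" and s: "sxt U V W"
  shows "sxt ((Syz ^^ r) U) ((Syz ^^ r) V) ((Syz ^^ r) W)"
  by (induction r) (use s F in \<open>auto simp: sxt_syz FD_pow\<close>)

lemma exact_triangle_sxt: "exact_triangle K A W U V a b c \<Longrightarrow> sxt U V W"
  unfolding exact_triangle_def standard_triangle_def sxt_def ses_def isoc_def Let_def by blast

lemma sxt_exact_triangle:
  assumes F: "U \<in> FD" "V \<in> FD" "W \<in> FD" and s: "sxt U V W"
  shows "\<exists>a b c. exact_triangle K A W U V a b c"
proof -
  obtain U' V' W' where *: "U' \<in> FD" "V' \<in> FD" "W' \<in> FD" "ses A U' V' W'" "isoc U' U" "isoc V' V" "isoc W' W"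
    using s by (auto simp: sxt_def)
  obtain \<upsilon> \<nu> \<omega> where i: "is_iso SC U' U \<upsilon>" "is_iso SC V' V \<nu>" "is_iso SC W' W \<omega>"
    using *(5-7) by (auto simp: isoc_def)
  obtain f g where ex: "short_exact A U' V' W' f g" using *(4) by (auto simp: ses_def)
  note e = short_exactD[OF ex]
  obtain q h where q: "q \<in> Hom (PC W') V'" "\<forall>x\<in>carrier (PC W'). g (q x) = pc W' x"
    and h: "h \<in> Hom (Syz W') U'" "\<forall>x\<in>carrier (Syz W'). f (h x) = q x" using connecting[OF *(1-3) ex] .
  note p = proj_cover[OF *(3)]
  have cq: "compose (carrier (PC W')) g q = pc W'"
    by (rule hom_ext[OF hom_compose[OF proj_lm[OF p(1)] q(1) e(2)] p(2)]) (use q(2) in \<open>simp add: compose_pt\<close>)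
  let ?a' = "cls (Syz W') U' h" and ?b' = "cls U' V' f" and ?c' = "cls V' W' g"
  have std: "standard_triangle K A W' U' V' ?a' ?b' ?c'"
    unfolding standard_triangle_def using * ex q h cq by blast
  note M = cls_Mor[OF h(1)] cls_Mor[OF e(1)] cls_Mor[OF e(2)]
  obtain \<upsilon>' where u: "is_iso SC U U' \<upsilon>'" "cmp SC U' U U' \<upsilon>' \<upsilon> = idm SC U'"
      "cmp SC U U' U \<upsilon> \<upsilon>' = idm SC U" by (rule SC.isoE[OF i(1)])
  obtain \<nu>' where n: "is_iso SC V V' \<nu>'" "cmp SC V' V V' \<nu>' \<nu> = idm SC V'"
      "cmp SC V V' V \<nu> \<nu>' = idm SC V" by (rule SC.isoE[OF i(2)])
  obtain \<omega>' where w: "is_iso SC W W' \<omega>'" "cmp SC W' W W' \<omega>' \<omega> = idm SC W'"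
      "cmp SC W W' W \<omega> \<omega>' = idm SC W" by (rule SC.isoE[OF i(3)])
  note I = SC.isoD[OF i(1)] SC.isoD[OF i(2)] SC.isoD[OF i(3)] SC.isoD[OF u(1)] SC.isoD[OF n(1)] SC.isoD[OF w(1)]
  note O = F *(1-3) syz_FD[OF F(3)] syz_FD[OF *(3)]
  let ?O = "syz_mor K A"
  have Ow: "?O W' W \<omega> \<in> Mor SC (Syz W') (Syz W)" "?O W W' \<omega>' \<in> Mor SC (Syz W) (Syz W')"
    using SC.Om_Mor[of W' W \<omega>] SC.Om_Mor[of W W' \<omega>'] O I by auto
  have Oww: "cmp SC (Syz W') (Syz W) (Syz W') (?O W W' \<omega>') (?O W' W \<omega>) = idm SC (Syz W')"
    using SC.Om_cmp[of W' W W' \<omega> \<omega>'] SC.Om_id[of W'] O I w(2) by simp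
  note cM = SC.cmp_Mor[unfolded SC_simps(1)] and as = SC.cmp_assoc[unfolded SC_simps(1)]
    and idr = SC.cmp_idr[unfolded SC_simps(1)]
  let ?a1 = "cmp SC (Syz W') U' U \<upsilon> ?a'" and ?b1 = "cmp SC U' V' V \<nu> ?b'" and ?c1 = "cmp SC V' W' W \<omega> ?c'"
  have M1: "?a1 \<in> Mor SC (Syz W') U" "?b1 \<in> Mor SC U' V" "?c1 \<in> Mor SC V' W"
    by (rule cM; use O M I in simp)+
  let ?a = "cmp SC (Syz W) (Syz W') U ?a1 (?O W W' \<omega>')" and ?b = "cmp SC U U' V ?b1 \<upsilon>'"
    and ?c = "cmp SC V V' W ?c1 \<nu>'"
  have M2: "?a \<in> Mor SC (Syz W) U" "?b \<in> Mor SC U V" "?c \<in> Mor SC V W"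
    by (rule cM; use O M1 I Ow in simp)+
  have 1: "cmp SC (Syz W') (Syz W) U ?a (?O W' W \<omega>) = ?a1"
    using as[OF O(8,7,8,1) Ow M1(1)] Oww idr[OF O(8,1) M1(1)] by simp
  have 2: "cmp SC U' U V ?b \<upsilon> = ?b1"
    using as[OF O(4,1,4,2) I(1,4) M1(2)] u(2) idr[OF O(4,2) M1(2)] by simp
  have 3: "cmp SC V' V W ?c \<nu> = ?c1"
    using as[OF O(5,2,5,3) I(2,5) M1(3)] n(2) idr[OF O(5,3) M1(3)] by simp
  have "exact_triangle K A W U V ?a ?b ?c"
    unfolding exact_triangle_def Let_def SC_simps(1,3,4)
  proof (intro conjI F M2)
    show "\<exists>W' U' V' a' b' c' \<omega> \<upsilon> \<nu>. standard_triangle K A W' U' V' a' b' c' \<and>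
      is_iso SC W' W \<omega> \<and> is_iso SC U' U \<upsilon> \<and> is_iso SC V' V \<nu> \<and>
      cmp SC (Syz W') U' U \<upsilon> a' = cmp SC (Syz W') (Syz W) U ?a (?O W' W \<omega>) \<and>
      cmp SC U' V' V \<nu> b' = cmp SC U' U V ?b \<upsilon> \<and>
      cmp SC V' W' W \<omega> c' = cmp SC V' V W ?c \<nu>"
      by (rule exI)+ (rule conjI[OF std conjI[OF i(3) conjI[OF i(1) conjI[OF i(2)
        conjI[OF 1[symmetric] conjI[OF 2[symmetric] 3[symmetric]]]]]]])
  qed
  then show ?thesis by blast
qed

section \<open>Stable degeneration and triangles\<close>

text \<open>The triangle relation inside the stable category itself.\<close>

definition tri_deg :: "('a, 'u) module \<Rightarrow> ('a, 'u) module \<Rightarrow> bool" where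
  "tri_deg X Y \<longleftrightarrow> (\<exists>V\<in>FD. \<exists>W\<in>FD. sxt Y V W \<and> is_biproduct SC X W V)"

lemma tri_deg_syz:
  assumes "X \<in> FD" "Y \<in> FD" "tri_deg X Y" shows "tri_deg (Syz X) (Syz Y)"
  using assms sxt_syz SC.biproduct_Om[unfolded SC_simps] syz_FD unfolding tri_deg_def by metis

lemma ex_proj_dsum:
  assumes "Proj P" "Proj Q" obtains R where "Proj R" "lmod_iso A (dsum P Q) R"
proof -
  obtain E i1 i2 p1 p2 where E: "E \<in> FD" "biprod P Q E i1 i2 p1 p2"
    using ex_biprod[OF proj_FD[OF assms(1)] proj_FD[OF assms(2)]] .
  show ?thesis
    by (rule that[OF proj_sum[OF assms E] lmod_iso_sym[OF biprod_iso[OF proj_lm[OF assms(1)] proj_lm[OF assms(2)] fdD[OF E(1)] E(2)]]])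
qed

lemma st_le_tri_deg:
  assumes F: "X \<in> FD" "Y \<in> FD" and st: "st_le K A X Y"
  shows "tri_deg X Y"
proof -
  obtain P Q and Z :: "('a, 'u \<times> 'u) module" where P: "Proj P" "Proj Q" and Z: "Z \<in> fd_modules K A"
    and s: "ses A (dsum Y Q) (dsum (dsum X P) Z) Z"
    using st unfolding st_le_def deg_le_def ses_def[symmetric] by blast
  obtain W where W: "W \<in> FD" "lmod_iso A Z W" using ex_copy[OF Z] .
  obtain U i1 i2 p1 p2 where U: "U \<in> FD" "biprod Y Q U i1 i2 p1 p2" using ex_biprod[OF F(2) proj_FD[OF P(2)]] .
  obtain E a1 a2 b1 b2 where E: "E \<in> FD" "biprod X P E a1 a2 b1 b2" using ex_biprod[OF F(1) proj_FD[OF P(1)]] .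
  obtain V j1 j2 q1 q2 where V: "V \<in> FD" "biprod E W V j1 j2 q1 q2" using ex_biprod[OF E(1) W(1)] .
  note l = fdD[OF F(1)] fdD[OF F(2)] proj_lm[OF P(1)] proj_lm[OF P(2)] fdD[OF Z] fdD[OF W(1)] fdD[OF U(1)]
    fdD[OF E(1)] fdD[OF V(1)]
  have U': "lmod_iso A (dsum Y Q) U" by (rule lmod_iso_sym[OF biprod_iso[OF l(2,4,7) U(2)]])
  have E': "lmod_iso A (dsum X P) E" by (rule lmod_iso_sym[OF biprod_iso[OF l(1,3,8) E(2)]])
  have V': "lmod_iso A (dsum E W) V" by (rule lmod_iso_sym[OF biprod_iso[OF l(8,6,9) V(2)]])
  have "lmod_iso A (dsum (dsum X P) Z) V"
    by (rule lmod_iso_trans[OF _ l(9) lmod_iso_dsum_cong[OF _ l(5,8,6) E' W(2)] V'])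
      (use l in \<open>simp_all add: left_module_dsum\<close>)
  then have "ses A U V W"
    using ses_iso[OF _ _ l(5,7,9,6) s U' _ W(2)] l by (simp add: left_module_dsum)
  then have "sxt Y V W"
    unfolding sxt_def using U(1) V(1) W(1) biprod_proj_isoc[OF F(2) P(2) U] isoc_refl by blast
  moreover have "is_biproduct SC X W V"
  proof -
    note a = biprodD[OF E(2)] and j = biprodD[OF V(2)]
    let ?i = "cc X j1 a1" and ?p = "cc V b1 q1"
    have h: "?i \<in> Hom X V" "?p \<in> Hom V X" using cc_hom F V(1) a j by blast+
    have 1: "cc X ?p ?i = hid X"
      by (rule extensionalityI[OF h_ext(1,2)]) (use h a j hom_closed[OF a(1)] hom_closed[OF j(1)] in simp)
    have 2: "cc W q2 j2 = hid W"
      by (rule extensionalityI[OF h_ext(1,2)]) (use j in simp)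
    have eq: "cc V ?i ?p = cc V j1 (cc V (cc E a1 b1) q1)"
      by (rule extensionalityI[OF h_ext(1,1)]) (use a j hom_closed[OF h(2)] in simp)
    have hq: "cc V (hid E) q1 \<in> Hom V E" using cc_hom V(1) j(3) hid_hom E(1) by blast
    have "st V V (hadd V V (cc V ?i ?p) (cc V j2 q2)) (hadd V V (cc V j1 (cc V (hid E) q1)) (cc V j2 q2))"
      unfolding eq
      by (intro st_add[OF V(1,1)] st_comp_left[OF V(1) E(1) V(1) _ j(1)] st_comp_right[OF V(1) E(1,1) j(3)]
        biprod_proj_st[OF F(1) P(1) E] st_refl[OF V(1,1)] cc_hom[OF V(1) j(4,2)])
    also have "hadd V V (cc V j1 (cc V (hid E) q1)) (cc V j2 q2) = hid V"
      by (rule extensionalityI[OF h_ext(3,2)]) (use j in simp)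
    finally have 3: "cls V V (hadd V V (cc V ?i ?p) (cc V j2 q2)) = cls V V (hid V)"
      by (rule cls_eqI[OF V(1,1)])
    have hh: "cc V ?i ?p \<in> Hom V V" "cc V j2 q2 \<in> Hom V V" using cc_hom V(1) h j by blast+
    show ?thesis unfolding is_biproduct_def
      by (intro conjI bexI[of _ "cls X V ?i"] bexI[of _ "cls W V j2"] bexI[of _ "cls V X ?p"] bexI[of _ "cls V W q2"])
        (use F(1) W(1) V(1) h j(1-4) 1 2 3 hh in \<open>simp_all add: cls_Mor SC_cmp SC_plus\<close>)
  qed
  ultimately show ?thesis unfolding tri_deg_def using V(1) W(1) by blast
qed

lemma is_biproduct_isoc:
  assumes F: "X \<in> FD" "Z \<in> FD" "E \<in> FD" and b: "is_biproduct SC X Z E"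
    and D: "D \<in> FD" "biprod X Z D j1 j2 q1 q2"
  shows "isoc E D"
proof -
  obtain \<phi>1 \<phi>2 \<psi>1 \<psi>2 where *: "\<phi>1 \<in> Mor SC X E" "\<phi>2 \<in> Mor SC Z E" "\<psi>1 \<in> Mor SC E X" "\<psi>2 \<in> Mor SC E Z"
    "cmp SC X E X \<psi>1 \<phi>1 = idm SC X" "cmp SC Z E Z \<psi>2 \<phi>2 = idm SC Z"
    "plus_mor SC E E (cmp SC E X E \<phi>1 \<psi>1) (cmp SC E Z E \<phi>2 \<psi>2) = idm SC E"
    using b unfolding is_biproduct_def by blast
  obtain i1 i2 p1 p2 where r: "i1 \<in> Hom X E" "i2 \<in> Hom Z E" "p1 \<in> Hom E X" "p2 \<in> Hom E Z"
    "\<phi>1 = cls X E i1" "\<phi>2 = cls Z E i2" "\<psi>1 = cls E X p1" "\<psi>2 = cls E Z p2"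
    using *(1-4)[unfolded SC_Mor] by blast
  have c: "cc X p1 i1 \<in> Hom X X" "cc Z p2 i2 \<in> Hom Z Z" "cc E i1 p1 \<in> Hom E E" "cc E i2 p2 \<in> Hom E E"
    using cc_hom F r by blast+
  have "st X X (cc X p1 i1) (hid X)" using *(5) r F c by (simp add: SC_cmp cls_eq hid_hom)
  moreover have "st Z Z (cc Z p2 i2) (hid Z)" using *(6) r F c by (simp add: SC_cmp cls_eq hid_hom)
  moreover have "st E E (hadd E E (cc E i1 p1) (cc E i2 p2)) (hid E)"
    using *(7) r F c by (simp add: SC_cmp SC_plus cls_eq hid_hom hadd_hom)
  ultimately obtain f g where "st_inv E D f g" using st_biproduct_iso[OF F D r(1-4)] by blast
  then show ?thesis using st_inv_is_iso[OF F(3) D(1)] by (auto simp: isoc_def)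
qed

lemma isoc_iso:
  assumes "M \<in> FD" "N \<in> FD" "isoc M N"
  obtains P Q where "Proj P" "Proj Q" "lmod_iso A (dsum M P) (dsum N Q)"
  using assms is_iso_st_inv st_inv_iso unfolding isoc_def by metis

text \<open>Three rearrangements of the summands of a direct sum, written out as explicit bijections.\<close>

lemma iso_shuffle1:
  assumes "lm U" "lm P" "lm Q" "lm R" "lm S"
  shows "lmod_iso A (dsum (dsum (dsum (dsum U P) Q) R) S) (dsum (dsum U Q) (dsum (dsum P R) S))"
  unfolding lmod_iso_def
proof (intro exI conjI)
  let ?D = "dsum (dsum (dsum (dsum U P) Q) R) S" and ?D' = "dsum (dsum U Q) (dsum (dsum P R) S)"
  show "restrict (\<lambda>((((u, p), q), r), s). ((u, q), ((p, r), s))) (carrier ?D) \<in> Hom ?D ?D'"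
    by (rule lmod_homI) (use assms in \<open>auto simp: left_module_dsum\<close>)
  show "restrict (\<lambda>((u, q), ((p, r), s)). ((((u, p), q), r), s)) (carrier ?D') \<in> Hom ?D' ?D"
    by (rule lmod_homI) (use assms in \<open>auto simp: left_module_dsum\<close>)
qed auto

lemma iso_shuffle2:
  assumes "lm X" "lm W" "lm Q" "lm P" "lm R" "lm S"
  shows "lmod_iso A (dsum (dsum (dsum X W) Q) (dsum (dsum P R) S)) (dsum (dsum X (dsum (dsum Q P) S)) (dsum W R))"
  unfolding lmod_iso_def
proof (intro exI conjI)
  let ?D = "dsum (dsum (dsum X W) Q) (dsum (dsum P R) S)" and ?D' = "dsum (dsum X (dsum (dsum Q P) S)) (dsum W R)"
  show "restrict (\<lambda>(((x, w), q), ((p, r), s)). ((x, ((q, p), s)), (w, r))) (carrier ?D) \<in> Hom ?D ?D'"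
    by (rule lmod_homI) (use assms in \<open>auto simp: left_module_dsum\<close>)
  show "restrict (\<lambda>((x, ((q, p), s)), (w, r)). (((x, w), q), ((p, r), s))) (carrier ?D') \<in> Hom ?D' ?D"
    by (rule lmod_homI) (use assms in \<open>auto simp: left_module_dsum\<close>)
qed auto

lemma iso_shuffle3:
  assumes "lm Y" "lm Q" "lm P" "lm R"
  shows "lmod_iso A (dsum (dsum (dsum Y Q) P) R) (dsum Y (dsum (dsum Q P) R))"
  unfolding lmod_iso_def
proof (intro exI conjI)
  let ?D = "dsum (dsum (dsum Y Q) P) R" and ?D' = "dsum Y (dsum (dsum Q P) R)"
  show "restrict (\<lambda>(((y, q), p), r). (y, ((q, p), r))) (carrier ?D) \<in> Hom ?D ?D'"
    by (rule lmod_homI) (use assms in \<open>auto simp: left_module_dsum\<close>)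
  show "restrict (\<lambda>(y, ((q, p), r)). (((y, q), p), r)) (carrier ?D') \<in> Hom ?D' ?D"
    by (rule lmod_homI) (use assms in \<open>auto simp: left_module_dsum\<close>)
qed auto

text \<open>From \<open>U' \<rightarrow> V' \<rightarrow> W'\<close> with \<open>U' \<oplus> P\<^sub>1 \<cong> Y \<oplus> Q\<^sub>1\<close>, \<open>V' \<oplus> P\<^sub>2 \<cong> (X \<oplus> W) \<oplus> Q\<^sub>2\<close> and
  \<open>W' \<oplus> P\<^sub>3 \<cong> W \<oplus> Q\<^sub>3\<close>, add \<open>P\<^sub>1\<close>, \<open>P\<^sub>2\<close> and \<open>Q\<^sub>3\<close> to the first two terms and \<open>P\<^sub>3\<close> to the last two.
  The middle term then contains \<open>W \<oplus> Q\<^sub>3\<close>, the last term, as a summand, and what remains of it is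
  \<open>X\<close> plus a projective.\<close>

lemma tri_deg_st_le:
  assumes F: "X \<in> FD" "Y \<in> FD" and t: "tri_deg X Y"
  shows "st_le K A X Y"
proof -
  obtain V W where VW: "V \<in> FD" "W \<in> FD" "sxt Y V W" "is_biproduct SC X W V" using t by (auto simp: tri_deg_def)
  obtain U' V' W' where s: "U' \<in> FD" "V' \<in> FD" "W' \<in> FD" "ses A U' V' W'" "isoc U' Y" "isoc V' V" "isoc W' W"
    using VW(3) by (auto simp: sxt_def)
  obtain D j1 j2 q1 q2 where D: "D \<in> FD" "biprod X W D j1 j2 q1 q2" using ex_biprod[OF F(1) VW(2)] .
  have iD: "isoc V' D" by (rule isoc_trans[OF s(2) VW(1) D(1) s(6) is_biproduct_isoc[OF F(1) VW(2,1,4) D]])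
  obtain P1 Q1 where 1: "Proj P1" "Proj Q1" "lmod_iso A (dsum U' P1) (dsum Y Q1)" using isoc_iso[OF s(1) F(2) s(5)] .
  obtain P2 Q2 where 2: "Proj P2" "Proj Q2" "lmod_iso A (dsum V' P2) (dsum D Q2)" using isoc_iso[OF s(2) D(1) iD] .
  obtain P3 Q3 where 3: "Proj P3" "Proj Q3" "lmod_iso A (dsum W' P3) (dsum W Q3)" using isoc_iso[OF s(3) VW(2) s(7)] .
  have lms: "lm X" "lm Y" "lm W" "lm U'" "lm V'" "lm W'" "lm D" "lm P1" "lm Q1" "lm P2" "lm Q2" "lm P3" "lm Q3"
    using F VW s D 1 2 3 by (simp_all add: fdD proj_lm)
  note [simp] = left_module_dsum lms
  have e: "ses A (dsum (dsum (dsum U' P1) P2) Q3) (dsum (dsum (dsum (dsum V' P1) P2) Q3) P3) (dsum W' P3)"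
    by (intro ses_add_right ses_add_left s(4)) simp_all
  obtain R1 where R1: "Proj R1" "lmod_iso A (dsum Q1 P2) R1" using ex_proj_dsum[OF 1(2) 2(1)] .
  obtain R where R: "Proj R" "lmod_iso A (dsum R1 Q3) R" using ex_proj_dsum[OF R1(1) 3(2)] .
  obtain T1 where T1: "Proj T1" "lmod_iso A (dsum Q2 P1) T1" using ex_proj_dsum[OF 2(2) 1(1)] .
  obtain T where T: "Proj T" "lmod_iso A (dsum T1 P3) T" using ex_proj_dsum[OF T1(1) 3(1)] .
  have lms': "lm R1" "lm R" "lm T1" "lm T" using R1 R T1 T by (simp_all add: proj_lm)
  note [simp] = lms'
  have R': "lmod_iso A (dsum (dsum Q1 P2) Q3) R"
    by (rule lmod_iso_trans[OF _ _ lmod_iso_dsum_cong[OF _ _ _ _ R1(2) lmod_iso_refl] R(2)]) simp_all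
  have T': "lmod_iso A (dsum (dsum Q2 P1) P3) T"
    by (rule lmod_iso_trans[OF _ _ lmod_iso_dsum_cong[OF _ _ _ _ T1(2) lmod_iso_refl] T(2)]) simp_all
  have D': "lmod_iso A D (dsum X W)" by (rule biprod_iso[OF _ _ _ D(2)]) simp_all
  have u1: "lmod_iso A (dsum (dsum (dsum U' P1) P2) Q3) (dsum (dsum (dsum Y Q1) P2) Q3)"
    by (intro lmod_iso_dsum_cong lmod_iso_refl 1(3)) simp_all
  have u2: "lmod_iso A (dsum (dsum (dsum Y Q1) P2) Q3) (dsum Y (dsum (dsum Q1 P2) Q3))"
    by (rule iso_shuffle3) simp_all
  have u3: "lmod_iso A (dsum Y (dsum (dsum Q1 P2) Q3)) (dsum Y R)"
    by (intro lmod_iso_dsum_cong lmod_iso_refl R') simp_all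
  have u: "lmod_iso A (dsum (dsum (dsum U' P1) P2) Q3) (dsum Y R)"
    by (rule lmod_iso_trans[OF _ _ u1 lmod_iso_trans[OF _ _ u2 u3]]) simp_all
  have v2: "lmod_iso A (dsum V' P2) (dsum (dsum X W) Q2)"
    by (rule lmod_iso_trans[OF _ _ 2(3) lmod_iso_dsum_cong[OF _ _ _ _ D' lmod_iso_refl]]) simp_all
  have v3: "lmod_iso A (dsum (dsum V' P2) (dsum (dsum P1 Q3) P3)) (dsum (dsum (dsum X W) Q2) (dsum (dsum P1 Q3) P3))"
    by (intro lmod_iso_dsum_cong[OF _ _ _ _ v2] lmod_iso_refl) simp_all
  have v1: "lmod_iso A (dsum (dsum (dsum (dsum V' P1) P2) Q3) P3) (dsum (dsum V' P2) (dsum (dsum P1 Q3) P3))"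
    by (rule iso_shuffle1) simp_all
  have v4: "lmod_iso A (dsum (dsum (dsum X W) Q2) (dsum (dsum P1 Q3) P3)) (dsum (dsum X (dsum (dsum Q2 P1) P3)) (dsum W Q3))"
    by (rule iso_shuffle2) simp_all
  have v5: "lmod_iso A (dsum (dsum X (dsum (dsum Q2 P1) P3)) (dsum W Q3)) (dsum (dsum X T) (dsum W Q3))"
    by (intro lmod_iso_dsum_cong lmod_iso_refl T') simp_all
  have v: "lmod_iso A (dsum (dsum (dsum (dsum V' P1) P2) Q3) P3) (dsum (dsum X T) (dsum W Q3))"
    by (rule lmod_iso_trans[OF _ _ v1 lmod_iso_trans[OF _ _ v3 lmod_iso_trans[OF _ _ v4 v5]]]) simp_all
  have "ses A (dsum Y R) (dsum (dsum X T) (dsum W Q3)) (dsum W Q3)"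
    by (rule ses_iso[OF _ _ _ _ _ _ e u v 3(3)]) simp_all
  then have "deg_le K A (dsum X T) (dsum Y R)"
    unfolding deg_le_def ses_def using fd_dsum[OF VW(2) proj_FD[OF 3(2)]] by blast
  then show ?thesis unfolding st_le_def using R(1) T(1) by blast
qed

abbreviation lv where "lv \<equiv> lift_ob SC"

lemma lv_FD: "X \<in> FD \<Longrightarrow> lv X m j \<in> FD"
  using SC.lo_Ob[of X m j] by simp

lemma tri_deg_tri_le:
  assumes F: "X \<in> FD" "Y \<in> FD" and j: "m \<le> j" "n \<le> j" "even j" and t: "tri_deg (lv X m j) (lv Y n j)"
  shows "tri_le K A (X, m) (Y, n)"
proof -
  obtain V W where VW: "V \<in> FD" "W \<in> FD" "sxt (lv Y n j) V W" "is_biproduct SC (lv X m j) W V"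
    using t by (auto simp: tri_deg_def)
  obtain a b c where tr: "exact_triangle K A W (lv Y n j) V a b c"
    using sxt_exact_triangle[OF lv_FD[OF F(2)] VW(1,2,3)] by blast
  have M: "a \<in> Mor SC (Syz W) (lv Y n j)" "b \<in> Mor SC (lv Y n j) V" "c \<in> Mor SC V W"
    using tr by (simp_all add: exact_triangle_def Let_def)
  have W1: "lv W (j - 1) j = Syz W" using SC.lo_prev[of j j W] by simp
  have g: "(j, a) \<in> germs SC (W, j - 1) (Y, n)" "(j, b) \<in> germs SC (Y, n) (V, j)" "(j, c) \<in> germs SC (V, j) (W, j)"
    using M j by (auto simp: SC.in_germs W1)
  let ?u = "SC.gc W (j - 1) Y n j a" and ?v = "SC.gc Y n V j j b" and ?w = "SC.gc V j W j j c"
  have m: "?u \<in> Mor (stab_mod K A) (W, j - 1) (Y, n)" "?v \<in> Mor (stab_mod K A) (Y, n) (V, j)"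
    "?w \<in> Mor (stab_mod K A) (V, j) (W, j)"
    using g SC.S_Mor by blast+
  have bp: "is_biproduct (stab_mod K A) (X, m) (W, j) (V, j)"
    by (rule SC.biproduct_from_level[of X W V m j j j]) (use F VW j in auto)
  have "stab_triangle K A (W, j) (Y, n) (V, j) ?u ?v ?w"
    unfolding stab_triangle_def Let_def prod.case Om_tilde_def
    by (intro conjI exI[of _ j], simp_all add: SC.S_Ob F VW m j)
      (intro exI[of _ a] exI[of _ b] exI[of _ c] conjI SC.gc_self g tr)
  moreover have "(W, j) \<in> Ob (stab_mod K A)" using VW(2) by (simp add: SC.S_Ob)
  ultimately show ?thesis unfolding tri_le_def using bp by blast
qed

lemma tri_le_tri_deg:
  assumes F: "X \<in> FD" "Y \<in> FD" and t: "tri_le K A (X, m) (Y, n)"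
  obtains i where "b \<le> i" "m \<le> i" "n \<le> i" "tri_deg (lv X m i) (lv Y n i)"
proof -
  obtain Z l E k u v w where *: "(Z, l) \<in> Ob (stab_mod K A)" "is_biproduct (stab_mod K A) (X, m) (Z, l) (E, k)"
    "stab_triangle K A (Z, l) (Y, n) (E, k) u v w"
    using t unfolding tri_le_def by (metis surj_pair)
  have FZ: "Z \<in> FD" "E \<in> FD" using * SC.S_Ob by (auto simp: is_biproduct_def)
  obtain j a b' c where j: "l \<le> j" "n \<le> j" "k \<le> j"
    and tr: "exact_triangle K A (lv Z l j) (lv Y n j) (lv E k j) a b' c"
    using *(3) unfolding stab_triangle_def Let_def prod.case by blast
  obtain i where i: "max b j \<le> i" "m \<le> i" "l \<le> i" "k \<le> i" "is_biproduct SC (lv X m i) (lv Z l i) (lv E k i)"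
    by (rule SC.biproduct_to_level[OF _ _ _ *(2), of "max b j"]) (use F FZ in auto)
  have ji: "j \<le> i" "b \<le> i" using i(1) by auto
  have "sxt (lv Y n i) (lv E k i) (lv Z l i)"
    using sxt_pow[OF lv_FD lv_FD lv_FD exact_triangle_sxt[OF tr], of "nat (i - j)"] F FZ
      SC.lo_shift[OF j(2) ji(1)] SC.lo_shift[OF j(3) ji(1)] SC.lo_shift[OF j(1) ji(1)] by simp
  then have "tri_deg (lv X m i) (lv Y n i)"
    unfolding tri_deg_def using i(5) lv_FD FZ by blast
  then show ?thesis using that[of i] ji i(2) j(2) by simp
qed

lemma qst_le_iff_tri_le:
  assumes F: "X \<in> FD" "Y \<in> FD"
  shows "qst_le K A (X, m) (Y, n) \<longleftrightarrow> tri_le K A (X, m) (Y, n)"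
proof
  assume "qst_le K A (X, m) (Y, n)"
  then obtain j :: nat where j: "m \<le> int j" "n \<le> int j" "st_le K A (lv X m (int j)) (lv Y n (int j))"
    by (auto simp: qst_le_def)
  note t = st_le_tri_deg[OF lv_FD[OF F(1)] lv_FD[OF F(2)] j(3)]
  show "tri_le K A (X, m) (Y, n)"
  proof (cases "even j")
    case True
    then show ?thesis using tri_deg_tri_le[OF F j(1,2) _ t] by simp
  next
    case False
    \<comment> \<open>Exact triangles are defined at even levels, so an odd level is raised by one.\<close>
    have "tri_deg (lv X m (int j + 1)) (lv Y n (int j + 1))"
      using tri_deg_syz[OF lv_FD[OF F(1)] lv_FD[OF F(2)] t] SC.lo_Suc[OF j(1), of X] SC.lo_Suc[OF j(2), of Y] by simp
    then show ?thesis using tri_deg_tri_le[OF F, of m "int j + 1" n] j False by simp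
  qed
next
  assume "tri_le K A (X, m) (Y, n)"
  then obtain i where i: "0 \<le> i" "m \<le> i" "n \<le> i" "tri_deg (lv X m i) (lv Y n i)"
    using tri_le_tri_deg[OF F, of m n 0] by blast
  have "st_le K A (lv X m i) (lv Y n i)" by (rule tri_deg_st_le[OF lv_FD[OF F(1)] lv_FD[OF F(2)] i(4)])
  then show "qst_le K A (X, m) (Y, n)"
    unfolding qst_le_def prod.case using i(1-3) by (intro exI[of _ "nat i"]) simp
qed

end

theorem proposition3p5:
  fixes K :: "'k ring"
    and A :: "('k, 'a) module"
    and X Y :: "('a, 'u) module"
    and m n :: int
    and e :: "'k list \<Rightarrow> 'u"
  assumes "fd_algebra K A"
    and large_universe: "inj_on e (lists (carrier K))"
    and "(X, m) \<in> Ob (stab_mod K A)"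
    and "(Y, n) \<in> Ob (stab_mod K A)"
  shows "qst_le K A (X, m) (Y, n) \<longleftrightarrow> tri_le K A (X, m) (Y, n)"
proof -
  interpret fd_universe K A e
    using assms(1) large_universe by (simp add: fd_universe_def fd_universe_axioms_def)
  show ?thesis
    by (rule qst_le_iff_tri_le) (use assms(3,4) in \<open>auto simp: SC.S_Ob\<close>)
qed

end
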